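(* The orders of the exceptional arrangement monoids $M(\Phi,\mathcal{H})$ are: $|M(G_2,\mathcal{H})|=7^2$; $|M(F_4,\mathcal{H})|=11\cdot 4931$; $|M(E_6,\mathcal{H})|=2^4\cdot 5^2\cdot 40543$; $|M(E_7,\mathcal{H})|=3\cdot 113\cdot 24667553$; $|M(E_8,\mathcal{H})|=11\cdot 79\cdot 55099865069$.
   Context: For a crystallographic root system $\Phi$ of type $G_2,F_4,E_6,E_7$ or $E_8$ in a Euclidean space $V$, let $W=W(\Phi)$ be the Weyl group generated by the orthogonal reflections $s_v$ ($v\in\Phi$), let $\mathcal{A}=\{v^\perp : v\in\Phi\}$ be the arrangement of its reflecting hyperplanes, and let $\mathcal{H}=L(\mathcal{A})$ be the set of all intersections of elements of $\mathcal{A}$, including the empty intersection $V$. The arrangement monoid is $M(\Phi,\mathcal{H})=\{g_X\mid g\in W,\ X\in\mathcal{H}\}$, where $g_X$ is the restriction of $g$ to $X$; it is a monoid under composition of partial maps. *)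

theory Defs
  imports
    "HOL-Analysis.Analysis"
    "HOL-Algebra.Bij"
    "HOL-Algebra.Generated_Groups"
begin

definition reflection :: "'a::euclidean_space \<Rightarrow> 'a \<Rightarrow> 'a" where
  "reflection v x = x - (2 * (x \<bullet> v) / (v \<bullet> v)) *\<^sub>R v"

text \<open>
  Crystallographic (and reduced) root systems. The roots are not required to span the ambient
  space, so root systems spanning a proper subspace are included as well.
\<close>

definition root_system :: "'a::euclidean_space set \<Rightarrow> bool" where
  "root_system \<Phi> \<longleftrightarrow>
     finite \<Phi> \<and> 0 \<notin> \<Phi> \<and>
     (\<forall>v\<in>\<Phi>. \<forall>c. c *\<^sub>R v \<in> \<Phi> \<longrightarrow> c = 1 \<or> c = -1) \<and>
     (\<forall>v\<in>\<Phi>. reflection v ` \<Phi> = \<Phi>) \<and>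
     (\<forall>u\<in>\<Phi>. \<forall>v\<in>\<Phi>. 2 * (u \<bullet> v) / (v \<bullet> v) \<in> \<int>)"

definition simple_system :: "'a::euclidean_space set \<Rightarrow> 'a set \<Rightarrow> bool" where
  "simple_system \<Phi> \<Delta> \<longleftrightarrow>
     \<Delta> \<subseteq> \<Phi> \<and> independent \<Delta> \<and>
     (\<forall>v\<in>\<Phi>. \<exists>c :: 'a \<Rightarrow> int.
        v = (\<Sum>a\<in>\<Delta>. of_int (c a) *\<^sub>R a) \<and>
        ((\<forall>a\<in>\<Delta>. c a \<ge> 0) \<or> (\<forall>a\<in>\<Delta>. c a \<le> 0)))"

datatype exceptional_type = G2 | F4 | E6 | E7 | E8

text \<open>
  Cartan matrices in Bourbaki's numbering of the simple roots; the entry in row \<open>i\<close> and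
  column \<open>j\<close> is \<open>2 (\<alpha>\<^sub>i \<bullet> \<alpha>\<^sub>j) / (\<alpha>\<^sub>j \<bullet> \<alpha>\<^sub>j)\<close>.
\<close>

fun cartan_matrix :: "exceptional_type \<Rightarrow> int list list" where
  "cartan_matrix G2 =
    [[ 2, -1],
     [-3,  2]]"
| "cartan_matrix F4 =
    [[ 2, -1,  0,  0],
     [-1,  2, -2,  0],
     [ 0, -1,  2, -1],
     [ 0,  0, -1,  2]]"
| "cartan_matrix E6 =
    [[ 2,  0, -1,  0,  0,  0],
     [ 0,  2,  0, -1,  0,  0],
     [-1,  0,  2, -1,  0,  0],
     [ 0, -1, -1,  2, -1,  0],
     [ 0,  0,  0, -1,  2, -1],
     [ 0,  0,  0,  0, -1,  2]]"
| "cartan_matrix E7 =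
    [[ 2,  0, -1,  0,  0,  0,  0],
     [ 0,  2,  0, -1,  0,  0,  0],
     [-1,  0,  2, -1,  0,  0,  0],
     [ 0, -1, -1,  2, -1,  0,  0],
     [ 0,  0,  0, -1,  2, -1,  0],
     [ 0,  0,  0,  0, -1,  2, -1],
     [ 0,  0,  0,  0,  0, -1,  2]]"
| "cartan_matrix E8 =
    [[ 2,  0, -1,  0,  0,  0,  0,  0],
     [ 0,  2,  0, -1,  0,  0,  0,  0],
     [-1,  0,  2, -1,  0,  0,  0,  0],
     [ 0, -1, -1,  2, -1,  0,  0,  0],
     [ 0,  0,  0, -1,  2, -1,  0,  0],
     [ 0,  0,  0,  0, -1,  2, -1,  0],
     [ 0,  0,  0,  0,  0, -1,  2, -1],
     [ 0,  0,  0,  0,  0,  0, -1,  2]]"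

definition has_type :: "'a::euclidean_space set \<Rightarrow> exceptional_type \<Rightarrow> bool" where
  "has_type \<Phi> T \<longleftrightarrow>
     (\<exists>\<alpha> :: 'a list.
        length \<alpha> = length (cartan_matrix T) \<and> distinct \<alpha> \<and> simple_system \<Phi> (set \<alpha>) \<and>
        (\<forall>i < length \<alpha>. \<forall>j < length \<alpha>.
           2 * (\<alpha> ! i \<bullet> \<alpha> ! j) / (\<alpha> ! j \<bullet> \<alpha> ! j) = of_int (cartan_matrix T ! i ! j)))"

definition weyl_group :: "'a::euclidean_space set \<Rightarrow> ('a \<Rightarrow> 'a) set" where
  "weyl_group \<Phi> = generate (BijGroup UNIV) (reflection ` \<Phi>)"

definition reflection_arrangement :: "'a::euclidean_space set \<Rightarrow> 'a set set" where
  "reflection_arrangement \<Phi> = (\<lambda>v. {x. v \<bullet> x = 0}) ` \<Phi>"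

text \<open>The empty intersection is the whole space, since \<open>\<Inter>{} = UNIV\<close>.\<close>

definition intersections :: "'a set set \<Rightarrow> 'a set set" where
  "intersections A = Inter ` Pow A"

text \<open>
  The partial map \<open>g\<^sub>X\<close>, undefined (\<open>None\<close>) outside \<open>X\<close>. As elements of \<open>'a \<rightharpoonup> 'a\<close>,
  two such partial maps are equal iff they have the same domain and agree on it.
\<close>

definition partial_restriction :: "('a \<Rightarrow> 'b) \<Rightarrow> 'a set \<Rightarrow> 'a \<rightharpoonup> 'b" where
  "partial_restriction g X = (\<lambda>x. Some (g x)) |` X"

definition arrangement_monoid :: "'a::euclidean_space set \<Rightarrow> ('a \<rightharpoonup> 'a) monoid" where
  "arrangement_monoid \<Phi> =
     \<lparr>carrier = {partial_restriction g X | g X.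
                  g \<in> weyl_group \<Phi> \<and> X \<in> intersections (reflection_arrangement \<Phi>)},
      mult = (\<circ>\<^sub>m),
      one = Some\<rparr>"


lemma reflection_adjoint: "u \<bullet> reflection v x = reflection v u \<bullet> x"
  by (simp add: reflection_def inner_diff_left inner_diff_right inner_commute)

lemma reflection_reflection: "v \<noteq> 0 \<Longrightarrow> reflection v (reflection v x) = x"
  by (simp add: reflection_def inner_diff_left algebra_simps)

lemma reflection_in_BijGroup: "v \<noteq> 0 \<Longrightarrow> reflection v \<in> carrier (BijGroup UNIV)"
  by (auto simp: BijGroup_def Bij_def intro!: o_bij[of "reflection v"] reflection_reflection)

lemma BijGroup_UNIV_mult:
  "g \<in> carrier (BijGroup UNIV) \<Longrightarrow> h \<in> carrier (BijGroup UNIV) \<Longrightarrow> g \<otimes>\<^bsub>BijGroup UNIV\<^esub> h = g \<circ> h"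
  by (auto simp: BijGroup_def compose_def)

lemma reflection_m_inv:
  assumes "v \<noteq> 0"
  shows "m_inv (BijGroup UNIV) (reflection v) = reflection v"
proof -
  have "reflection v \<otimes>\<^bsub>BijGroup UNIV\<^esub> reflection v = \<one>\<^bsub>BijGroup UNIV\<^esub>"
    using assms
    by (simp add: BijGroup_UNIV_mult reflection_in_BijGroup)
       (auto simp: BijGroup_def reflection_reflection)
  then show ?thesis
    using assms reflection_in_BijGroup group.inv_equality[OF group_BijGroup] by metis
qed

lemma root_system_nonzero: "root_system \<Phi> \<Longrightarrow> v \<in> \<Phi> \<Longrightarrow> v \<noteq> 0"
  by (auto simp: root_system_def)

lemma weyl_group_subset:
  assumes "root_system \<Phi>" and "g \<in> weyl_group \<Phi>"
  shows "g \<in> carrier (BijGroup UNIV)"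
  using assms reflection_in_BijGroup root_system_nonzero
    group.generate_incl[OF group_BijGroup, of "reflection ` \<Phi>" UNIV]
  unfolding weyl_group_def by blast

lemma weyl_group_comp:
  assumes "root_system \<Phi>" and "g \<in> weyl_group \<Phi>" and "h \<in> weyl_group \<Phi>"
  shows "g \<circ> h \<in> weyl_group \<Phi>"
  using assms weyl_group_subset[of \<Phi>] BijGroup_UNIV_mult[of g h]
  unfolding weyl_group_def by (metis generate.eng)

lemma weyl_group_adjoint:
  assumes "root_system \<Phi>" and "g \<in> weyl_group \<Phi>" and "v \<in> \<Phi>"
  shows "\<exists>w\<in>\<Phi>. \<forall>x. v \<bullet> g x = w \<bullet> x"
  using assms(2,3) unfolding weyl_group_def
proof (induction arbitrary: v rule: generate.induct)
  case one
  then show ?case by (auto simp: BijGroup_def)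
next
  case (incl h)
  then obtain a where "a \<in> \<Phi>" "h = reflection a" by auto
  moreover have "reflection a v \<in> \<Phi>"
    using \<open>a \<in> \<Phi>\<close> incl.prems assms(1) unfolding root_system_def by blast
  ultimately show ?case using reflection_adjoint by blast
next
  case (inv h)
  then obtain a where a: "a \<in> \<Phi>" "h = reflection a" by auto
  moreover have "reflection a v \<in> \<Phi>"
    using \<open>a \<in> \<Phi>\<close> inv.prems assms(1) unfolding root_system_def by blast
  moreover have "m_inv (BijGroup UNIV) h = reflection a"
    using a reflection_m_inv root_system_nonzero[OF assms(1)] by blast
  ultimately show ?case using reflection_adjoint by metis
next
  case (eng g h)
  have "g \<otimes>\<^bsub>BijGroup UNIV\<^esub> h = g \<circ> h"
    using eng.hyps weyl_group_subset[OF assms(1)] BijGroup_UNIV_mult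
    unfolding weyl_group_def by blast
  then show ?case using eng.IH eng.prems by (metis comp_apply)
qed

lemma vimage_intersections:
  assumes "root_system \<Phi>" and "g \<in> weyl_group \<Phi>"
    and "X \<in> intersections (reflection_arrangement \<Phi>)"
  shows "g -` X \<in> intersections (reflection_arrangement \<Phi>)"
proof -
  obtain S where S: "S \<subseteq> reflection_arrangement \<Phi>" "X = \<Inter>S"
    using assms(3) by (auto simp: intersections_def)
  have "(-`) g ` S \<subseteq> reflection_arrangement \<Phi>"
  proof (rule image_subsetI)
    fix H assume "H \<in> S"
    then obtain v where "v \<in> \<Phi>" "H = {x. v \<bullet> x = 0}"
      using S by (auto simp: reflection_arrangement_def)
    then show "g -` H \<in> reflection_arrangement \<Phi>"
      using weyl_group_adjoint[OF assms(1,2)] by (fastforce simp: reflection_arrangement_def)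
  qed
  moreover have "g -` X = \<Inter>((-`) g ` S)" using S by auto
  ultimately show ?thesis by (auto simp: intersections_def)
qed

lemma intersections_Int:
  "X \<in> intersections A \<Longrightarrow> Y \<in> intersections A \<Longrightarrow> X \<inter> Y \<in> intersections A"
  unfolding intersections_def
  by (metis (no_types, lifting) Inter_Un_distrib Pow_iff Un_least image_iff)

lemma partial_restriction_comp:
  "partial_restriction g X \<circ>\<^sub>m partial_restriction h Y = partial_restriction (g \<circ> h) (Y \<inter> h -` X)"
  by (auto simp: partial_restriction_def map_comp_def restrict_map_def fun_eq_iff)

lemma monoid_arrangement_monoid:
  assumes "root_system \<Phi>"
  shows "Group.monoid (arrangement_monoid \<Phi>)"
proof
  fix p q assume "p \<in> carrier (arrangement_monoid \<Phi>)" "q \<in> carrier (arrangement_monoid \<Phi>)"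
  then show "p \<otimes>\<^bsub>arrangement_monoid \<Phi>\<^esub> q \<in> carrier (arrangement_monoid \<Phi>)"
    using weyl_group_comp[OF assms] vimage_intersections[OF assms]
    by (fastforce simp: arrangement_monoid_def partial_restriction_comp intro: intersections_Int)
next
  have "(Some :: 'a \<rightharpoonup> 'a) = partial_restriction (\<one>\<^bsub>BijGroup UNIV\<^esub>) UNIV"
    by (auto simp: partial_restriction_def BijGroup_def)
  moreover have "\<one>\<^bsub>BijGroup UNIV\<^esub> \<in> weyl_group \<Phi>"
    unfolding weyl_group_def by (rule generate.one)
  moreover have "UNIV \<in> intersections (reflection_arrangement \<Phi>)"
    unfolding intersections_def by (rule image_eqI[of _ _ "{}"]) auto
  ultimately show "\<one>\<^bsub>arrangement_monoid \<Phi>\<^esub> \<in> carrier (arrangement_monoid \<Phi>)"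
    by (auto simp: arrangement_monoid_def)
qed (auto simp: arrangement_monoid_def map_comp_def fun_eq_iff split: option.split)

end

theory Submission
  imports Defs
begin

text \<open>
  Write \<open>W\<^sub>X\<close> for the pointwise stabilizer of a flat \<open>X\<close>. Two elements of \<open>W\<close> have the same restriction
  to \<open>X\<close> iff they differ by an element of \<open>W\<^sub>X\<close>, so the order of the monoid is the sum of
  \<open>|W| / |W\<^sub>X|\<close> over all flats. The flats are counted through parabolic bases, that is, the images
  \<open>g K\<close> of sets \<open>K\<close> of simple roots under elements of \<open>W\<close>. Every flat is the orthogonal complement of
  a parabolic base, and \<open>W\<^sub>X\<close> permutes the parabolic bases with complement \<open>X\<close> simply transitively
  (\<open>card_bases_of_flat\<close>), which turns the order into the sum of \<open>|W| / |W\<^sub>X|\<^sup>2\<close> over all parabolic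
  bases, \<open>X\<close> being the complement (\<open>order_arrangement_monoid\<close>).

  This sum is evaluated classwise. The class of a parabolic base \<open>B\<close> is given by three numbers that
  \<open>W\<close> preserves (\<open>moments\<close>): with \<open>s = \<Sum>B\<close>, the cardinality of \<open>B\<close>, the sum of the cubes
  \<open>(s \<bullet> v)\<^sup>3\<close>, and the squared length of \<open>\<Sum>v\<in>B. (s \<bullet> v) v\<close>. In the exceptional types they are fine
  enough for \<open>|W\<^sub>X|\<close> to be constant on each class, although a class can consist of several \<open>W\<close>-orbits.
  Two double counts provide the rest.

  The order of \<open>W\<^sub>X\<close> comes from an orbit count. For \<open>X = K\<^sup>\<bottom>\<close> the group \<open>W\<^sub>X\<close> is generated by the
  reflections in \<open>K\<close>. If \<open>\<theta>\<close> is the highest root of a component of \<open>K\<close>, its orbit consists of all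
  roots of the component with the length of \<open>\<theta>\<close>, and its stabilizer is generated by the reflections in
  the simple roots of \<open>K\<close> orthogonal to \<open>\<theta>\<close> (\<open>card_parabolic_step\<close>). For \<open>E\<^sub>8\<close> this gives
  \<open>|W(E\<^sub>8)| = 240 |W(E\<^sub>7)|\<close>, \<open>|W(E\<^sub>7)| = 126 |W(D\<^sub>6)|\<close>, and so on.

  The size of a class comes from counting pairs of a base \<open>B\<close> of one class and a base \<open>B - {b}\<close> of
  another: if each \<open>B\<close> has \<open>c\<close> such subsets and each smaller base \<open>e\<close> such extensions, then the two
  sizes have ratio \<open>e / c\<close> (\<open>card_base_class_edge\<close>). By invariance it suffices to find \<open>c\<close> and \<open>e\<close> for sets
  \<open>K\<close> of simple roots, where the only question is which roots \<open>b\<close> make \<open>K \<union> {b}\<close> a parabolic base. In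
  general this holds iff all roots in the span are nonnegative or nonpositive integral combinations of
  \<open>K \<union> {b}\<close> (\<open>parabolic_base_insert_iff\<close>). In the simply laced types an evenness argument replaces this
  by two quick tests: \<open>b\<close> has nonpositive products with \<open>K\<close>, and its coefficients outside \<open>K\<close> have
  greatest common divisor 1 (\<open>simply_laced_parabolic_base_insert_iff\<close>).

  In coordinates with respect to the simple roots everything is integer arithmetic. The tables for the
  five types are certificates: the list of positive roots, the highest roots of the connected
  subdiagrams, the classes with their sizes and stabilizer orders, and the incidence numbers that connect
  the classes. Rewriting confirms them, and \<open>order_by_certificate\<close> turns them into the orders.
\<close>

section \<open>Dual and generic vectors\<close>

text \<open>
  A linear form with prescribed values on an independent set is an inner product, by adjointness.
\<close>
lemma exists_dual_vector:
  fixes S :: "'a::euclidean_space set"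
  assumes "independent S"
  shows "\<exists>p. \<forall>a\<in>S. p \<bullet> a = f a"
proof -
  obtain g where g: "linear g" "\<forall>a\<in>S. g a = f a"
    using linear_independent_extend[OF assms, of f] by auto
  have "g x = adjoint g 1 \<bullet> x" for x
    using adjoint_works[OF g(1), of x 1] by (simp add: inner_commute)
  then show ?thesis using g(2) by metis
qed

text \<open>
  Finitely many hyperplanes, none of which contains \<open>Y\<close>, do not cover \<open>Y\<close>: along a line in direction
  \<open>y\<close> only finitely many points are bad.
\<close>
lemma exists_generic_vector:
  fixes F :: "'a::euclidean_space set"
  assumes Y: "subspace Y" and "finite F" and F: "\<And>v. v \<in> F \<Longrightarrow> \<exists>y\<in>Y. y \<bullet> v \<noteq> 0"
  shows "\<exists>p\<in>Y. \<forall>v\<in>F. p \<bullet> v \<noteq> 0"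
  using assms(2) F
proof (induction F rule: finite_induct)
  case empty
  then show ?case using subspace_0[OF Y] by auto
next
  case (insert v F)
  obtain p where p: "p \<in> Y" "\<forall>v\<in>F. p \<bullet> v \<noteq> 0" using insert by auto
  obtain y where y: "y \<in> Y" "y \<bullet> v \<noteq> 0" using insert.prems by auto
  \<comment> \<open>the parameters \<open>t\<close> for which \<open>p + t y\<close> meets one of the hyperplanes\<close>
  let ?bad = "(\<lambda>u. - (p \<bullet> u) / (y \<bullet> u)) ` insert v F \<union> {0}"
  have "finite ?bad" using insert.hyps by auto
  then obtain t :: real where t: "t \<notin> ?bad" using ex_new_if_finite[OF infinite_UNIV_char_0] by blast
  have "(p + t *\<^sub>R y) \<bullet> u \<noteq> 0" if "u \<in> insert v F" for u
  proof (cases "y \<bullet> u = 0")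
    case True
    then show ?thesis using that p y by (auto simp: inner_add_left)
  next
    case False
    have "t \<noteq> - (p \<bullet> u) / (y \<bullet> u)" using t that by blast
    then show ?thesis using False by (auto simp: inner_add_left field_simps)
  qed
  moreover have "p + t *\<^sub>R y \<in> Y" using p y Y by (simp add: subspace_add subspace_scale)
  ultimately show ?case by blast
qed

section \<open>Reflection groups with a system of simple roots\<close>

lemma reflection_inner [simp]: "v \<noteq> 0 \<Longrightarrow> reflection v x \<bullet> reflection v y = x \<bullet> y"
  by (metis reflection_adjoint reflection_reflection)

lemma linear_reflection: "linear (reflection v)"
  by (rule linearI) (simp_all add: reflection_def inner_add_left algebra_simps add_divide_distrib)

lemma reflection_self [simp]: "reflection v v = - v"
  by (cases "v = 0") (simp_all add: reflection_def scaleR_2)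

lemma reflection_fixes: "x \<bullet> v = 0 \<Longrightarrow> reflection v x = x"
  by (simp add: reflection_def)

locale based_root_system =
  fixes \<Phi> \<Delta> :: "'a::euclidean_space set"
  assumes root_system: "root_system \<Phi>" and simple_system: "simple_system \<Phi> \<Delta>"
begin

lemma finite_roots: "finite \<Phi>"
  and root_nonzero: "v \<in> \<Phi> \<Longrightarrow> v \<noteq> 0"
  and root_multiple: "v \<in> \<Phi> \<Longrightarrow> c *\<^sub>R v \<in> \<Phi> \<Longrightarrow> c = 1 \<or> c = -1"
  and reflection_root_image: "v \<in> \<Phi> \<Longrightarrow> reflection v ` \<Phi> = \<Phi>"
  and cartan_Ints: "u \<in> \<Phi> \<Longrightarrow> v \<in> \<Phi> \<Longrightarrow> 2 * (u \<bullet> v) / (v \<bullet> v) \<in> \<int>"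
  using root_system unfolding root_system_def by auto

lemma reflection_root: "v \<in> \<Phi> \<Longrightarrow> u \<in> \<Phi> \<Longrightarrow> reflection v u \<in> \<Phi>"
  using reflection_root_image by blast

lemma uminus_root: "v \<in> \<Phi> \<Longrightarrow> - v \<in> \<Phi>"
  using reflection_root[of v v] by simp

lemma simple_root: "a \<in> \<Delta> \<Longrightarrow> a \<in> \<Phi>"
  and independent_simple: "independent \<Delta>"
  using simple_system unfolding simple_system_def by auto

lemma finite_simple: "finite \<Delta>"
  by (rule finite_subset[OF _ finite_roots]) (auto simp: simple_root)

lemma simple_nonzero: "a \<in> \<Delta> \<Longrightarrow> a \<noteq> 0"
  using simple_root root_nonzero by blast

text \<open>
  On \<open>span \<Delta>\<close> the products with these vectors are the coefficients with respect to \<open>\<Delta>\<close>. As the roots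
  need not span the space, the vectors are not unique; any choice works.
\<close>
definition coweight :: "'a \<Rightarrow> 'a" where
  "coweight a = (SOME p. \<forall>b\<in>\<Delta>. p \<bullet> b = (if b = a then 1 else 0))"

lemma coweight_simple: "b \<in> \<Delta> \<Longrightarrow> coweight a \<bullet> b = (if b = a then 1 else 0)"
  using someI_ex[OF exists_dual_vector[OF independent_simple, of "\<lambda>b. if b = a then 1 else 0"]]
  unfolding coweight_def by blast

lemma coweight_sum: "a \<in> \<Delta> \<Longrightarrow> coweight a \<bullet> (\<Sum>b\<in>\<Delta>. c b *\<^sub>R b) = c a"
  by (simp add: inner_sum_right coweight_simple finite_simple if_distrib[of "\<lambda>x. _ * x"] cong: if_cong)

lemma span_simple_expand: "v \<in> span \<Delta> \<Longrightarrow> v = (\<Sum>a\<in>\<Delta>. (coweight a \<bullet> v) *\<^sub>R a)"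
  by (auto simp: span_finite[OF finite_simple] coweight_sum intro!: sum.cong)

lemma root_coords:
  assumes "v \<in> \<Phi>"
  shows "v \<in> span \<Delta>" "\<And>a. a \<in> \<Delta> \<Longrightarrow> coweight a \<bullet> v \<in> \<int>"
    "(\<forall>a\<in>\<Delta>. coweight a \<bullet> v \<ge> 0) \<or> (\<forall>a\<in>\<Delta>. coweight a \<bullet> v \<le> 0)"
proof -
  obtain c :: "'a \<Rightarrow> int" where c: "v = (\<Sum>a\<in>\<Delta>. of_int (c a) *\<^sub>R a)"
    "(\<forall>a\<in>\<Delta>. c a \<ge> 0) \<or> (\<forall>a\<in>\<Delta>. c a \<le> 0)"
    using simple_system assms unfolding simple_system_def by blast
  show "v \<in> span \<Delta>" using c(1) by (simp add: span_base span_scale span_sum)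
  have "coweight a \<bullet> v = of_int (c a)" if "a \<in> \<Delta>" for a using coweight_sum[OF that] c(1) by simp
  then show "\<And>a. a \<in> \<Delta> \<Longrightarrow> coweight a \<bullet> v \<in> \<int>"
    "(\<forall>a\<in>\<Delta>. coweight a \<bullet> v \<ge> 0) \<or> (\<forall>a\<in>\<Delta>. coweight a \<bullet> v \<le> 0)"
    using c(2) by auto
qed

lemma root_expand: "v \<in> \<Phi> \<Longrightarrow> v = (\<Sum>a\<in>\<Delta>. (coweight a \<bullet> v) *\<^sub>R a)"
  using span_simple_expand root_coords(1) by blast

lemma inner_root_expand: "v \<in> \<Phi> \<Longrightarrow> x \<bullet> v = (\<Sum>a\<in>\<Delta>. (coweight a \<bullet> v) * (x \<bullet> a))"
  by (subst (1) root_expand) (auto simp: inner_sum_right)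

definition pos :: "'a \<Rightarrow> bool" where
  "pos v \<longleftrightarrow> v \<in> \<Phi> \<and> (\<forall>a\<in>\<Delta>. coweight a \<bullet> v \<ge> 0)"

lemma pos_root: "pos v \<Longrightarrow> v \<in> \<Phi>"
  by (simp add: pos_def)

lemma pos_cases: "v \<in> \<Phi> \<Longrightarrow> pos v \<or> pos (- v)"
  using root_coords(3) uminus_root by (auto simp: pos_def)

lemma pos_not_both: "pos v \<Longrightarrow> \<not> pos (- v)"
proof
  assume v: "pos v" "pos (- v)"
  then have "\<forall>a\<in>\<Delta>. coweight a \<bullet> v = 0" by (auto simp: pos_def intro: antisym)
  then have "v = 0" using root_expand[OF pos_root[OF v(1)]] by simp
  then show False using v pos_root root_nonzero by blast
qed

lemma pos_simple: "a \<in> \<Delta> \<Longrightarrow> pos a"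
  by (auto simp: pos_def simple_root coweight_simple)

lemma not_pos_iff: "v \<in> \<Phi> \<Longrightarrow> \<not> pos v \<longleftrightarrow> pos (- v)"
  using pos_cases pos_not_both by blast

lemma pos_if_coord_pos: "v \<in> \<Phi> \<Longrightarrow> a \<in> \<Delta> \<Longrightarrow> coweight a \<bullet> v > 0 \<Longrightarrow> pos v"
  using root_coords(3)[of v] by (force simp: pos_def)

lemma coweight_reflection:
  "a \<in> \<Delta> \<Longrightarrow> coweight b \<bullet> reflection a v =
     coweight b \<bullet> v - (if a = b then 2 * (v \<bullet> a) / (a \<bullet> a) else 0)"
  by (auto simp: reflection_def inner_diff_right coweight_simple)

text \<open>
  The reflection in \<open>a\<close> only changes the coefficient at \<open>a\<close>, and a positive root other than \<open>a\<close> has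
  another coefficient that is positive. Coefficients of a root have a common sign, so it stays positive.
\<close>
lemma pos_reflection:
  assumes a: "a \<in> \<Delta>" and v: "pos v" "v \<noteq> a"
  shows "pos (reflection a v)"
proof -
  have "\<exists>b\<in>\<Delta>. b \<noteq> a \<and> coweight b \<bullet> v \<noteq> 0"
  proof (rule ccontr)
    assume *: "\<not> ?thesis"
    have "v = (\<Sum>b\<in>\<Delta>. (coweight b \<bullet> v) *\<^sub>R b)" using v pos_root root_expand by blast
    also have "\<dots> = (\<Sum>b\<in>\<Delta>. if b = a then (coweight a \<bullet> v) *\<^sub>R a else 0)"
      using * by (intro sum.cong) auto
    also have "\<dots> = (coweight a \<bullet> v) *\<^sub>R a" using a finite_simple by simp
    finally have e: "v = (coweight a \<bullet> v) *\<^sub>R a" .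
    then have "coweight a \<bullet> v = 1 \<or> coweight a \<bullet> v = -1"
      using root_multiple[of a "coweight a \<bullet> v"] simple_root[OF a] pos_root[OF v(1)] by simp
    moreover have "coweight a \<bullet> v \<ge> 0" using v a by (auto simp: pos_def)
    ultimately show False using e v by simp
  qed
  then obtain b where b: "b \<in> \<Delta>" "b \<noteq> a" "coweight b \<bullet> v > 0"
    using v by (force simp: pos_def)
  then show ?thesis
    using pos_if_coord_pos[of "reflection a v" b] coweight_reflection[OF a]
      reflection_root[OF simple_root[OF a] pos_root[OF v(1)]] by auto
qed

lemma reflection_neg_imp_eq:
  "a \<in> \<Delta> \<Longrightarrow> pos v \<Longrightarrow> \<not> pos (reflection a v) \<Longrightarrow> v = a"
  using pos_reflection by blast

lemma reflection_conj:
  assumes "linear g" "\<And>x y. g x \<bullet> g y = x \<bullet> y"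
  shows "reflection (g v) (g x) = g (reflection v x)"
  by (simp add: reflection_def assms linear_diff linear_cmul)

fun act :: "'a list \<Rightarrow> 'a \<Rightarrow> 'a" where
  "act [] x = x"
| "act (a # w) x = reflection a (act w x)"

lemma act_Nil: "act [] = id"
  and act_Cons: "act (a # w) = reflection a \<circ> act w"
  and act_single: "act [a] = reflection a"
  by auto

lemma act_append: "act (u @ w) = act u \<circ> act w"
  by (induction u) (auto simp: act_Nil act_Cons comp_assoc)

lemma linear_act: "linear (act w)"
proof (induction w)
  case (Cons a w)
  show ?case unfolding act_Cons by (rule linear_compose[OF Cons linear_reflection])
qed (simp only: act_Nil linear_id)

lemma act_inner: "set w \<subseteq> \<Phi> \<Longrightarrow> act w x \<bullet> act w y = x \<bullet> y"
  by (induction w) (auto simp: root_nonzero)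

lemma act_root: "set w \<subseteq> \<Phi> \<Longrightarrow> v \<in> \<Phi> \<Longrightarrow> act w v \<in> \<Phi>"
  by (induction w) (auto simp: reflection_root)

lemma act_rev: "set w \<subseteq> \<Phi> \<Longrightarrow> act (rev w) \<circ> act w = id"
proof (induction w)
  case (Cons a w)
  then have "act (rev w) (reflection a (reflection a (act w x))) = x" for x
    by (simp add: reflection_reflection root_nonzero) (metis comp_apply id_apply)
  then show ?case by (auto simp: act_append fun_eq_iff)
qed auto

lemma act_rev': "set w \<subseteq> \<Phi> \<Longrightarrow> act w \<circ> act (rev w) = id"
  using act_rev[of "rev w"] by simp

lemma simple_word: "set w \<subseteq> \<Delta> \<Longrightarrow> set w \<subseteq> \<Phi>"
  using simple_root by auto

text \<open>
  Positive roots are built up from simple ones by simple reflections that raise the height: from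
  \<open>v \<bullet> v > 0\<close> some simple \<open>a\<close> satisfies \<open>v \<bullet> a > 0\<close>, and reflecting in it lowers the height of \<open>v\<close>.
\<close>
lemma pos_root_induct [consumes 1, case_names simple reflect]:
  assumes "pos v"
    and simple: "\<And>a. a \<in> \<Delta> \<Longrightarrow> P a"
    and reflect: "\<And>v a. pos v \<Longrightarrow> a \<in> \<Delta> \<Longrightarrow> v \<bullet> a < 0 \<Longrightarrow> P v \<Longrightarrow> P (reflection a v)"
  shows "P v"
proof -
  have ex: "\<exists>n. (\<Sum>a\<in>\<Delta>. coweight a \<bullet> v) = real n" if "pos v" for v
  proof -
    have "(\<Sum>a\<in>\<Delta>. coweight a \<bullet> v) \<in> \<int>" "(\<Sum>a\<in>\<Delta>. coweight a \<bullet> v) \<ge> 0"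
      using that root_coords(2)[of v] by (auto simp: pos_def intro!: sum_nonneg)
    then show ?thesis by (metis Ints_cases of_int_0_le_iff of_int_of_nat_eq nonneg_int_cases)
  qed
  obtain n where "(\<Sum>a\<in>\<Delta>. coweight a \<bullet> v) = real n" using ex[OF assms(1)] by blast
  then show ?thesis using assms(1)
  proof (induction n arbitrary: v rule: less_induct)
    case (less n)
    have "v \<bullet> v > 0" using less.prems pos_root root_nonzero by auto
    then have "(\<Sum>a\<in>\<Delta>. (coweight a \<bullet> v) * (v \<bullet> a)) > 0"
      using inner_root_expand[OF pos_root[OF less.prems(2)], of v] by simp
    then obtain a where a: "a \<in> \<Delta>" "(coweight a \<bullet> v) * (v \<bullet> a) > 0"
      by (meson not_less sum_nonpos)
    then have va: "v \<bullet> a > 0" using less.prems by (auto simp: pos_def zero_less_mult_iff)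
    show ?case
    proof (cases "v = a")
      case True
      then show ?thesis using simple a by simp
    next
      case False
      let ?v = "reflection a v"
      have p: "pos ?v" using pos_reflection a(1) less.prems False by blast
      obtain m where m: "(\<Sum>a\<in>\<Delta>. coweight a \<bullet> ?v) = real m" using ex[OF p] by blast
      have "real m = real n - 2 * (v \<bullet> a) / (a \<bullet> a)"
        using m less.prems(1) a(1) finite_simple
        by (simp add: coweight_reflection sum_subtractf)
      moreover have "2 * (v \<bullet> a) / (a \<bullet> a) > 0" using va simple_nonzero[OF a(1)] by simp
      ultimately have "m < n" by linarith
      then have "P ?v" using less.IH[OF _ m p] by blast
      moreover have "?v \<bullet> a < 0"
        using va reflection_adjoint[of a a v] by (simp add: inner_commute)
      ultimately have "P (reflection a ?v)" using reflect p a(1) by blast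
      then show ?thesis using simple_nonzero[OF a(1)] by (simp add: reflection_reflection)
    qed
  qed
qed

lemma root_conj_simple:
  assumes "pos v"
  shows "\<exists>w a. set w \<subseteq> \<Delta> \<and> a \<in> \<Delta> \<and> v = act w a"
  using assms
proof (induction rule: pos_root_induct)
  case (simple a)
  then show ?case by (intro exI[of _ "[]"] exI[of _ a]) simp
next
  case (reflect v a)
  then obtain w b where "set w \<subseteq> \<Delta>" "b \<in> \<Delta>" "v = act w b" by blast
  then show ?case using reflect by (intro exI[of _ "a # w"] exI[of _ b]) simp
qed

lemma reflection_uminus: "reflection (- v) = reflection v"
  by (auto simp: reflection_def)

text \<open>
  Reflections in conjugate roots are conjugate, so the simple reflections generate \<open>W\<close>.
\<close>
lemma reflection_word:
  assumes "v \<in> \<Phi>"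
  shows "\<exists>w. set w \<subseteq> \<Delta> \<and> reflection v = act w"
proof -
  have *: "\<exists>w. set w \<subseteq> \<Delta> \<and> reflection v = act w" if "pos v" for v
  proof -
    obtain w a where w: "set w \<subseteq> \<Delta>" "a \<in> \<Delta>" "v = act w a" using root_conj_simple \<open>pos v\<close> by blast
    have "reflection v x = act (w @ [a] @ rev w) x" for x
    proof -
      have "act w (act (rev w) x) = x" using act_rev'[OF simple_word[OF w(1)]] by (metis comp_apply id_apply)
      then show ?thesis
        using reflection_conj[OF linear_act act_inner[OF simple_word[OF w(1)]], of a "act (rev w) x"] w(3)
        by (simp add: act_append)
    qed
    then have "reflection v = act (w @ [a] @ rev w)" by (rule ext)
    moreover have "set (w @ [a] @ rev w) \<subseteq> \<Delta>" using w(1,2) by auto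
    ultimately show ?thesis by (intro exI[of _ "w @ [a] @ rev w"] conjI)
  qed
  show ?thesis using pos_cases[OF assms] *[of v] *[of "- v"] by (auto simp: reflection_uminus)
qed

abbreviation W :: "('a \<Rightarrow> 'a) set" where "W \<equiv> weyl_group \<Phi>"

lemma act_in_W: "set w \<subseteq> \<Phi> \<Longrightarrow> act w \<in> W"
proof (induction w)
  case Nil
  have "\<one>\<^bsub>BijGroup UNIV\<^esub> \<in> W" unfolding weyl_group_def by (rule generate.one)
  moreover have "\<one>\<^bsub>BijGroup UNIV\<^esub> = (id :: 'a \<Rightarrow> 'a)" by (auto simp: BijGroup_def)
  ultimately show ?case by (metis act_Nil)
next
  case (Cons a w)
  have "reflection a \<in> W" unfolding weyl_group_def using Cons.prems by (auto intro: generate.incl)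
  moreover have "act w \<in> W" using Cons by simp
  ultimately show ?case unfolding act_Cons by (rule weyl_group_comp[OF root_system])
qed

lemma W_word: "g \<in> W \<Longrightarrow> \<exists>w. set w \<subseteq> \<Delta> \<and> g = act w"
  unfolding weyl_group_def
proof (induction rule: generate.induct)
  case one
  have "\<one>\<^bsub>BijGroup UNIV\<^esub> = (id :: 'a \<Rightarrow> 'a)" by (auto simp: BijGroup_def)
  then show ?case by (intro exI[of _ "[]"]) (auto simp: act_Nil)
next
  case (incl h)
  then show ?case using reflection_word by auto
next
  case (inv h)
  then show ?case using reflection_word reflection_m_inv root_nonzero by force
next
  case (eng g h)
  then obtain u w where "set u \<subseteq> \<Delta>" "g = act u" "set w \<subseteq> \<Delta>" "h = act w" by blast
  moreover have "g \<otimes>\<^bsub>BijGroup UNIV\<^esub> h = g \<circ> h"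
    using eng.hyps weyl_group_subset[OF root_system] BijGroup_UNIV_mult
    unfolding weyl_group_def by blast
  ultimately show ?case by (intro exI[of _ "u @ w"]) (auto simp: act_append fun_eq_iff)
qed

lemma W_id: "id \<in> W"
  using act_in_W[of "[]"] by (simp add: act_Nil)

lemma W_comp: "g \<in> W \<Longrightarrow> h \<in> W \<Longrightarrow> g \<circ> h \<in> W"
  using weyl_group_comp[OF root_system] .

lemma W_linear: "g \<in> W \<Longrightarrow> linear g"
  using W_word linear_act by blast

lemma W_inner: "g \<in> W \<Longrightarrow> g x \<bullet> g y = x \<bullet> y"
  using W_word act_inner simple_word by blast

lemma W_root: "g \<in> W \<Longrightarrow> v \<in> \<Phi> \<Longrightarrow> g v \<in> \<Phi>"
  using W_word act_root simple_word by blast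

lemma W_inverse:
  assumes "g \<in> W"
  obtains h where "h \<in> W" "g \<circ> h = id" "h \<circ> g = id"
proof -
  obtain w where w: "set w \<subseteq> \<Delta>" "g = act w" using W_word assms by blast
  then show ?thesis
    using act_rev[OF simple_word] act_rev'[OF simple_word] that[of "act (rev w)"] act_in_W[of "rev w"] simple_word
    by auto
qed

lemma W_inj: "g \<in> W \<Longrightarrow> inj g"
  by (metis W_inverse inj_on_id inj_on_imageI2)

lemma W_adjoint: "g \<in> W \<Longrightarrow> g \<circ> h = id \<Longrightarrow> g x \<bullet> y = x \<bullet> h y"
  by (metis W_inner comp_apply id_apply)

text \<open>
  The exchange condition. Along the word the image of \<open>a\<close> turns negative at some letter, which must then
  be that image; deleting the letter amounts to multiplying with the reflection in \<open>a\<close>.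
\<close>
lemma exchange:
  assumes "set w \<subseteq> \<Delta>" "a \<in> \<Delta>" "\<not> pos (act w a)"
  shows "\<exists>u. set u \<subseteq> set w \<and> length u < length w \<and> act u = act w \<circ> reflection a"
  using assms
proof (induction w)
  case Nil
  then show ?case using pos_simple by auto
next
  case (Cons b w)
  show ?case
  proof (cases "pos (act w a)")
    case False
    then obtain u where "set u \<subseteq> set w" "length u < length w" "act u = act w \<circ> reflection a"
      using Cons.IH Cons.prems by (metis insert_subset list.simps(15))
    then show ?thesis by (intro exI[of _ "b # u"]) (auto simp: fun_eq_iff)
  next
    case True
    then have "act w a = b" using Cons.prems reflection_neg_imp_eq[of b "act w a"] by auto
    moreover have "set w \<subseteq> \<Phi>" using Cons.prems simple_word by simp
    ultimately have conj: "reflection b (act w x) = act w (reflection a x)" for x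
      using reflection_conj[OF linear_act[of w] act_inner[of w], of a x] by simp
    have "b \<noteq> 0" using Cons.prems simple_nonzero by auto
    then have "act w = act (b # w) \<circ> reflection a"
      by (simp add: fun_eq_iff conj[symmetric] reflection_reflection)
    moreover have "set w \<subseteq> set (b # w)" "length w < length (b # w)" by auto
    ultimately show ?thesis by (intro exI[of _ w] conjI)
  qed
qed

text \<open>
  A nonempty word of minimal length ends in some \<open>a\<close> that the group element sends to a negative root,
  for otherwise the exchange condition would shorten it.
\<close>
lemma word_positive_imp_id:
  assumes "set w \<subseteq> \<Delta>" "\<And>a. a \<in> \<Delta> \<Longrightarrow> pos (act w a)"
  shows "act w = id"
proof -
  \<comment> \<open>the length of the group element\<close>
  define n where "n = (LEAST n. \<exists>u. set u \<subseteq> \<Delta> \<and> length u = n \<and> act u = act w)"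
  have "\<exists>n u. set u \<subseteq> \<Delta> \<and> length u = n \<and> act u = act w" using assms by blast
  then obtain u where u: "set u \<subseteq> \<Delta>" "length u = n" "act u = act w"
    using LeastI_ex[of "\<lambda>n. \<exists>u. set u \<subseteq> \<Delta> \<and> length u = n \<and> act u = act w"] unfolding n_def by blast
  have least: "n \<le> length u" if "set u \<subseteq> \<Delta>" "act u = act w" for u
    unfolding n_def using that by (intro Least_le) auto
  show ?thesis
  proof (cases u rule: rev_cases)
    case Nil
    then show ?thesis using u act_Nil by metis
  next
    case (snoc v a)
    have a: "a \<in> \<Delta>" "set v \<subseteq> \<Delta>" using u snoc by auto
    have w: "act w = act v \<circ> reflection a" using u(3) snoc by (simp add: act_append act_single)
    then have "act v (- a) = act w a" by simp
    then have "\<not> pos (act v a)"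
      using assms(2)[OF a(1)] pos_not_both by (metis linear_act linear_neg minus_minus)
    then obtain t where "set t \<subseteq> set v" "length t < length v" "act t = act w"
      using exchange[OF a(2,1)] w by metis
    then show ?thesis using least[of t] a(2) u(2) snoc by auto
  qed
qed

lemma W_positive_imp_id: "g \<in> W \<Longrightarrow> (\<And>a. a \<in> \<Delta> \<Longrightarrow> pos (g a)) \<Longrightarrow> g = id"
  using W_word word_positive_imp_id by metis

text \<open>
  An element is determined by its action on \<open>\<Phi>\<close>: if it fixes all roots, then it keeps the simple roots
  positive.
\<close>
lemma finite_W: "finite W"
proof -
  have "inj_on (\<lambda>g. restrict g \<Phi>) W"
  proof (rule inj_onI)
    fix g h assume gh: "g \<in> W" "h \<in> W" "restrict g \<Phi> = restrict h \<Phi>"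
    obtain k where k: "k \<in> W" "h \<circ> k = id" "k \<circ> h = id" using W_inverse gh(2) by blast
    have "(k \<circ> g) v = v" if "v \<in> \<Phi>" for v
      using gh(3) that k(3) by (metis comp_apply id_apply restrict_apply)
    then have "k \<circ> g = id"
      using W_positive_imp_id[OF W_comp[OF k(1) gh(1)]] pos_simple simple_root by simp
    then have "h \<circ> (k \<circ> g) = h" by simp
    then show "g = h" using k(2) by (simp add: comp_assoc[symmetric])
  qed
  moreover have "(\<lambda>g. restrict g \<Phi>) ` W \<subseteq> (\<Phi> \<rightarrow>\<^sub>E \<Phi>)" using W_root by auto
  ultimately show ?thesis
    using finite_PiE[OF finite_roots, of "\<lambda>_. \<Phi>"] finite_roots finite_subset finite_imageD by metis
qed

definition parabolic :: "'a set \<Rightarrow> ('a \<Rightarrow> 'a) set" where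
  "parabolic K = {act w | w. set w \<subseteq> K}"

lemma parabolic_subset: "K \<subseteq> \<Delta> \<Longrightarrow> parabolic K \<subseteq> W"
  using act_in_W simple_root unfolding parabolic_def by blast

text \<open>
  Choose the element of the orbit with the largest product with \<open>\<rho>\<close>. Here \<open>\<rho>\<close> is a vector whose product
  with every simple root is 1, so a negative product with some \<open>a \<in> K\<close> could be improved by reflecting.
\<close>
lemma parabolic_dominant:
  assumes "K \<subseteq> \<Delta>"
  shows "\<exists>g\<in>parabolic K. \<forall>a\<in>K. g u \<bullet> a \<ge> 0"
proof -
  define \<rho> where "\<rho> = (\<Sum>a\<in>\<Delta>. coweight a)"
  have rho: "\<rho> \<bullet> a = 1" if "a \<in> \<Delta>" for a
    using that finite_simple by (simp add: \<rho>_def inner_sum_left coweight_simple)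
  have fin: "finite (parabolic K)" using finite_W parabolic_subset[OF assms] finite_subset by blast
  have ne: "parabolic K \<noteq> {}" unfolding parabolic_def by (auto intro: exI[of _ "[]"])
  obtain g where g: "g \<in> parabolic K" "\<And>h. h \<in> parabolic K \<Longrightarrow> h u \<bullet> \<rho> \<le> g u \<bullet> \<rho>"
  proof -
    have "Max ((\<lambda>h. h u \<bullet> \<rho>) ` parabolic K) \<in> (\<lambda>h. h u \<bullet> \<rho>) ` parabolic K"
      using fin ne by (intro Max_in) auto
    then obtain g where "g \<in> parabolic K" "Max ((\<lambda>h. h u \<bullet> \<rho>) ` parabolic K) = g u \<bullet> \<rho>" by auto
    then show ?thesis using that[of g] fin by (metis Max_ge finite_imageI image_eqI)
  qed
  have "g u \<bullet> a \<ge> 0" if a: "a \<in> K" for a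
  proof -
    obtain w where w: "set w \<subseteq> K" "g = act w" using g(1) unfolding parabolic_def by blast
    have "act (a # w) \<in> parabolic K" unfolding parabolic_def using w a by (intro CollectI exI[of _ "a # w"]) auto
    then have "reflection a (g u) \<bullet> \<rho> \<le> g u \<bullet> \<rho>" using g(2)[of "act (a # w)"] w(2) by simp
    moreover have "a \<bullet> \<rho> = 1" using rho a assms by (subst inner_commute) blast
    ultimately have "2 * (g u \<bullet> a) / (a \<bullet> a) \<ge> 0" by (simp add: reflection_def inner_diff_left)
    moreover have "a \<bullet> a > 0" using simple_nonzero a assms by auto
    ultimately show ?thesis by (simp add: zero_le_divide_iff)
  qed
  then show ?thesis using g(1) by blast
qed

text \<open>
  Induction over the length of a word: if \<open>g \<noteq> id\<close> fixes the dominant \<open>x\<close>, then \<open>g a\<close> is negative for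
  some simple \<open>a\<close>, whence \<open>0 \<le> x \<bullet> a = x \<bullet> g a \<le> 0\<close> and the exchange condition shortens \<open>g\<close> by a
  reflection fixing \<open>x\<close>.
\<close>
lemma dominant_stabilizer:
  assumes g: "g \<in> W" "g x = x" and x: "\<And>a. a \<in> \<Delta> \<Longrightarrow> x \<bullet> a \<ge> 0"
  shows "g \<in> parabolic {a\<in>\<Delta>. x \<bullet> a = 0}"
proof -
  obtain w where "set w \<subseteq> \<Delta>" "g = act w" using W_word g by blast
  then show ?thesis using g
  proof (induction "length w" arbitrary: g w rule: less_induct)
    case less
    show ?case
    proof (cases "\<forall>a\<in>\<Delta>. pos (act w a)")
      case True
      then have "g = act []" using word_positive_imp_id[of w] less.prems(1,2) act_Nil by metis
      then show ?thesis unfolding parabolic_def by (intro CollectI exI[of _ "[]"]) auto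
    next
      case False
      then obtain a where a: "a \<in> \<Delta>" "\<not> pos (act w a)" by blast
      have p: "pos (- g a)" using a less.prems W_root[OF less.prems(3) simple_root[OF a(1)]] not_pos_iff by auto
      have "x \<bullet> (- g a) \<ge> 0"
        using p x unfolding inner_root_expand[OF pos_root[OF p], of x]
        by (intro sum_nonneg mult_nonneg_nonneg) (auto simp: pos_def)
      moreover have "x \<bullet> a = x \<bullet> g a" using W_inner[OF less.prems(3), of x a] less.prems(4) by simp
      ultimately have xa: "x \<bullet> a = 0" using x[OF a(1)] by simp
      obtain u where u: "set u \<subseteq> set w" "length u < length w" "act u = act w \<circ> reflection a"
        using exchange less.prems a by blast
      have "set u \<subseteq> \<Delta>" using u less.prems by auto
      moreover have "act u x = x" using u(3) xa less.prems by (simp add: reflection_fixes)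
      ultimately have "act u \<in> parabolic {a\<in>\<Delta>. x \<bullet> a = 0}"
        using less.hyps[OF u(2) _ refl] act_in_W simple_word by auto
      then obtain t where t: "set t \<subseteq> {a\<in>\<Delta>. x \<bullet> a = 0}" "act u = act t" unfolding parabolic_def by blast
      have "g = act u \<circ> reflection a"
        using u(3) less.prems a simple_nonzero by (auto simp: fun_eq_iff reflection_reflection)
      then have "g = act (t @ [a])" using t by (simp add: act_append act_single)
      then show ?thesis unfolding parabolic_def using t a xa by (intro CollectI exI[of _ "t @ [a]"]) auto
    qed
  qed
qed

end

section \<open>Flats and parabolic bases\<close>

lemma card_eq_image_times_fiber:
  assumes "finite G"
    and fib: "\<And>g. g \<in> G \<Longrightarrow> bij_betw (\<lambda>h. g \<circ> h) H {g' \<in> G. \<Psi> g' = \<Psi> g}"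
  shows "card G = card (\<Psi> ` G) * card H"
proof -
  have "card G = (\<Sum>p\<in>\<Psi> ` G. card {g \<in> G. \<Psi> g = p})"
    using sum.image_gen[OF assms(1), of "\<lambda>_. 1::nat" \<Psi>] by simp
  also have "\<dots> = (\<Sum>p\<in>\<Psi> ` G. card H)"
    using fib bij_betw_same_card by (intro sum.cong) fastforce+
  finally show ?thesis by simp
qed

definition perp :: "'a::euclidean_space set \<Rightarrow> 'a set" where
  "perp B = {x. \<forall>b\<in>B. b \<bullet> x = 0}"

lemma subspace_perp: "subspace (perp B)"
  by (auto simp: perp_def subspace_def inner_add_right)

lemma perp_span: "x \<in> perp B \<Longrightarrow> v \<in> span B \<Longrightarrow> v \<bullet> x = 0"
  using span_minimal[of B "{v. v \<bullet> x = 0}"]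
  by (auto simp: perp_def inner_add_left subspace_def)

lemma in_span_iff_perp: "v \<in> span B \<longleftrightarrow> (\<forall>x\<in>perp B. v \<bullet> x = 0)"
proof
  assume *: "\<forall>x\<in>perp B. v \<bullet> x = 0"
  obtain y z where yz: "y \<in> span B" "\<And>w. w \<in> span B \<Longrightarrow> orthogonal z w" "v = y + z"
    using orthogonal_subspace_decomp_exists[of B v] by metis
  have "z \<in> perp B" using yz(2) span_base by (auto simp: perp_def orthogonal_def inner_commute)
  then have "v \<bullet> z = 0" using * by auto
  moreover have "y \<bullet> z = 0" using yz(1,2) by (auto simp: orthogonal_def inner_commute)
  ultimately have "z = 0" using yz(3) by (simp add: inner_add_left)
  then show "v \<in> span B" using yz by simp
qed (use perp_span in blast)

lemma perp_eq_imp_span_eq: "perp B = perp C \<Longrightarrow> span B = span C"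
  by (auto simp: in_span_iff_perp)

lemma flat_iff_perp: "X \<in> intersections (reflection_arrangement \<Phi>) \<longleftrightarrow> (\<exists>S\<subseteq>\<Phi>. X = perp S)"
proof
  assume "X \<in> intersections (reflection_arrangement \<Phi>)"
  then obtain A where A: "A \<subseteq> (\<lambda>v. {x. v \<bullet> x = 0}) ` \<Phi>" "X = \<Inter>A"
    by (auto simp: intersections_def reflection_arrangement_def)
  then obtain S where "S \<subseteq> \<Phi>" "A = (\<lambda>v. {x. v \<bullet> x = 0}) ` S" by (auto simp: subset_image_iff)
  then show "\<exists>S\<subseteq>\<Phi>. X = perp S" using A by (intro exI[of _ S]) (auto simp: perp_def)
next
  assume "\<exists>S\<subseteq>\<Phi>. X = perp S"
  then obtain S where "S \<subseteq> \<Phi>" "X = \<Inter>((\<lambda>v. {x. v \<bullet> x = 0}) ` S)" by (auto simp: perp_def)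
  then show "X \<in> intersections (reflection_arrangement \<Phi>)"
    unfolding intersections_def reflection_arrangement_def by blast
qed

context based_root_system
begin

lemma W_perp_image: "g \<in> W \<Longrightarrow> perp (g ` B) = g ` perp B"
proof -
  assume g: "g \<in> W"
  obtain h where h: "h \<in> W" "g \<circ> h = id" "h \<circ> g = id" using W_inverse g by blast
  have "x \<in> g ` perp B" if "x \<in> perp (g ` B)" for x
  proof (rule image_eqI[of _ _ "h x"])
    show "x = g (h x)" using h(2) by (metis comp_apply id_apply)
    show "h x \<in> perp B" using that W_adjoint[OF g h(2)] by (auto simp: perp_def)
  qed
  then show ?thesis using W_inner[OF g] by (auto simp: perp_def)
qed

lemma W_dominant: "\<exists>g\<in>W. \<forall>a\<in>\<Delta>. g u \<bullet> a \<ge> 0"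
  using parabolic_dominant[of \<Delta> u] parabolic_subset[of \<Delta>] by auto

lemma dominant_root_inner:
  assumes "pos v" "\<And>a. a \<in> \<Delta> \<Longrightarrow> x \<bullet> a \<ge> 0"
  shows "x \<bullet> v \<ge> 0"
  using assms unfolding inner_root_expand[OF pos_root[OF assms(1)], of x]
  by (intro sum_nonneg mult_nonneg_nonneg) (auto simp: pos_def)

definition parabolic_base :: "'a set \<Rightarrow> bool" where
  "parabolic_base B \<longleftrightarrow> (\<exists>g\<in>W. \<exists>K\<subseteq>\<Delta>. B = g ` K)"

lemma parabolic_base_simple: "K \<subseteq> \<Delta> \<Longrightarrow> parabolic_base K"
  unfolding parabolic_base_def using W_id by (intro bexI[of _ id] exI[of _ K]) auto

lemma parabolic_base_image:
  assumes "parabolic_base B" "g \<in> W" shows "parabolic_base (g ` B)"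
proof -
  obtain h K where "h \<in> W" "K \<subseteq> \<Delta>" "B = h ` K" using assms unfolding parabolic_base_def by blast
  then show ?thesis unfolding parabolic_base_def
    using W_comp[OF assms(2)] by (intro bexI[of _ "g \<circ> h"] exI[of _ K]) (auto simp: image_comp)
qed

lemma parabolic_base_subset:
  assumes "parabolic_base B" "B' \<subseteq> B" shows "parabolic_base B'"
proof -
  obtain h K where h: "h \<in> W" "K \<subseteq> \<Delta>" "B = h ` K" using assms unfolding parabolic_base_def by blast
  then obtain K' where "K' \<subseteq> K" "B' = h ` K'" using assms(2) by (auto simp: subset_image_iff)
  then show ?thesis unfolding parabolic_base_def using h by blast
qed

lemma parabolic_base_roots: "parabolic_base B \<Longrightarrow> B \<subseteq> \<Phi>"
  unfolding parabolic_base_def using W_root simple_root by blast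

lemma finite_parabolic_bases: "finite {B. parabolic_base B}"
proof (rule finite_subset)
  show "{B. parabolic_base B} \<subseteq> Pow \<Phi>" using parabolic_base_roots by blast
  show "finite (Pow \<Phi>)" using finite_roots by simp
qed

text \<open>
  Move a generic point \<open>p\<close> of the flat into the closed dominant chamber. The roots orthogonal to its
  image are the combinations of the simple roots orthogonal to it.
\<close>
lemma flat_eq_perp_parabolic_base:
  assumes S: "S \<subseteq> \<Phi>"
  shows "\<exists>B. parabolic_base B \<and> perp S = perp B"
proof -
  let ?F = "{v\<in>\<Phi>. \<exists>y\<in>perp S. y \<bullet> v \<noteq> 0}"
  have "\<exists>p\<in>perp S. \<forall>v\<in>?F. p \<bullet> v \<noteq> 0"
    by (rule exists_generic_vector[OF subspace_perp]) (simp_all add: finite_roots)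
  then obtain p where p: "p \<in> perp S" "\<forall>v\<in>?F. p \<bullet> v \<noteq> 0" by blast
  obtain g where g: "g \<in> W" "\<forall>a\<in>\<Delta>. g p \<bullet> a \<ge> 0" using W_dominant by blast
  obtain h where h: "h \<in> W" "g \<circ> h = id" "h \<circ> g = id" using W_inverse g by blast
  define K where "K = {a\<in>\<Delta>. g p \<bullet> a = 0}"
  have "x \<in> perp (h ` K)" if "x \<in> perp S" for x
    unfolding perp_def
  proof (intro CollectI ballI)
    fix b assume "b \<in> h ` K"
    then obtain a where a: "a \<in> \<Delta>" "g p \<bullet> a = 0" "b = h a" by (auto simp: K_def)
    then have "p \<bullet> b = 0" using W_adjoint[OF g(1) h(2)] by simp
    moreover have "b \<in> \<Phi>" using a W_root[OF h(1)] simple_root by auto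
    ultimately have "b \<notin> ?F" using p by blast
    then show "b \<bullet> x = 0" using \<open>b \<in> \<Phi>\<close> that by (auto simp: inner_commute)
  qed
  moreover have "x \<in> perp S" if x: "x \<in> perp (h ` K)" for x
  proof -
    have *: "u \<bullet> x = 0" if u: "pos (g u)" "u \<in> \<Phi>" "p \<bullet> u = 0" for u
    proof -
      have "(\<Sum>a\<in>\<Delta>. (coweight a \<bullet> g u) * (g p \<bullet> a)) = 0"
        using inner_root_expand[OF pos_root[OF u(1)], of "g p"] W_inner[OF g(1), of p u] u(3) by simp
      then have z: "(coweight a \<bullet> g u) * (g p \<bullet> a) = 0" if "a \<in> \<Delta>" for a
        using sum_nonneg_eq_0_iff[OF finite_simple, of "\<lambda>a. (coweight a \<bullet> g u) * (g p \<bullet> a)"] that g(2) u(1)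
        by (auto simp: pos_def)
      have "(coweight a \<bullet> g u) * (g x \<bullet> a) = 0" if a: "a \<in> \<Delta>" for a
      proof (cases "a \<in> K")
        case True
        then have "h a \<bullet> x = 0" using x by (auto simp: perp_def)
        then show ?thesis using W_adjoint[OF g(1) h(2), of x a] by (simp add: inner_commute)
      next
        case False
        then show ?thesis using z[OF a] a by (auto simp: K_def)
      qed
      then have "g x \<bullet> g u = 0"
        unfolding inner_root_expand[OF pos_root[OF u(1)], of "g x"] by (intro sum.neutral) blast
      then show ?thesis using W_inner[OF g(1)] by (simp add: inner_commute)
    qed
    have "v \<bullet> x = 0" if v: "v \<in> S" for v
    proof -
      have vr: "v \<in> \<Phi>" "p \<bullet> v = 0" using v S p(1) by (auto simp: perp_def inner_commute)
      have "g (- v) = - g v" using W_linear[OF g(1)] by (simp add: linear_neg)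
      then show ?thesis
        using pos_cases[OF W_root[OF g(1) vr(1)]] *[of v] *[of "- v"] vr uminus_root by auto
    qed
    then show ?thesis by (auto simp: perp_def)
  qed
  ultimately have "perp S = perp (h ` K)" by blast
  moreover have "parabolic_base (h ` K)" unfolding parabolic_base_def using h K_def by blast
  ultimately show ?thesis by blast
qed

text \<open>
  With \<open>q\<close> at least 1 on all simple roots involved, a positive root with \<open>q\<close>-height 1 has only one
  simple constituent.
\<close>
lemma simple_if_height_one:
  assumes v: "pos v" "q \<bullet> v = 1" and q: "\<And>a. a \<in> \<Delta> \<Longrightarrow> coweight a \<bullet> v > 0 \<Longrightarrow> q \<bullet> a \<ge> 1"
  shows "v \<in> \<Delta>"
proof -
  let ?c = "\<lambda>a. coweight a \<bullet> v"
  have c: "?c a = 0 \<or> ?c a \<ge> 1" if a: "a \<in> \<Delta>" for a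
  proof -
    obtain k :: int where "?c a = of_int k" using root_coords(2)[OF pos_root[OF v(1)] a] Ints_cases by blast
    moreover have "?c a \<ge> 0" using v(1) a by (auto simp: pos_def)
    ultimately show ?thesis by auto
  qed
  have sum1: "(\<Sum>a\<in>\<Delta>. ?c a * (q \<bullet> a)) = 1" using inner_root_expand[OF pos_root[OF v(1)], of q] v(2) by simp
  then obtain a where a: "a \<in> \<Delta>" "?c a \<noteq> 0" by (metis (no_types, lifting) mult_zero_left sum.neutral zero_neq_one)
  have ge1: "?c b * (q \<bullet> b) \<ge> 1" if "b \<in> \<Delta>" "?c b \<noteq> 0" for b
    using c[OF that(1)] that q[OF that(1)] mult_mono[of 1 "?c b" 1 "q \<bullet> b"] by auto
  have nn: "?c b * (q \<bullet> b) \<ge> 0" if "b \<in> \<Delta>" for b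
    using ge1[OF that] by (cases "?c b = 0") auto
  have "(\<Sum>b\<in>\<Delta>. ?c b * (q \<bullet> b)) = ?c a * (q \<bullet> a) + (\<Sum>b\<in>\<Delta> - {a}. ?c b * (q \<bullet> b))"
    using a(1) finite_simple by (rule sum.remove[rotated])
  moreover have "(\<Sum>b\<in>\<Delta> - {a}. ?c b * (q \<bullet> b)) \<ge> 0" using nn by (intro sum_nonneg) auto
  ultimately have a1: "?c a * (q \<bullet> a) = 1" "(\<Sum>b\<in>\<Delta> - {a}. ?c b * (q \<bullet> b)) = 0"
    using ge1[OF a] sum1 by linarith+
  have "?c b = 0" if "b \<in> \<Delta> - {a}" for b
  proof (rule ccontr)
    assume "?c b \<noteq> 0"
    then have "?c b * (q \<bullet> b) \<ge> 1" using ge1 that by auto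
    moreover have "?c b * (q \<bullet> b) \<le> (\<Sum>b\<in>\<Delta> - {a}. ?c b * (q \<bullet> b))"
      using that nn finite_simple by (intro member_le_sum) auto
    ultimately show False using a1(2) by linarith
  qed
  then have "(\<Sum>b\<in>\<Delta>. ?c b *\<^sub>R b) = ?c a *\<^sub>R a"
    using a(1) finite_simple by (subst sum.remove[of _ a]) auto
  then have va: "v = ?c a *\<^sub>R a" using root_expand[OF pos_root[OF v(1)]] by simp
  have "?c a \<ge> 1" "q \<bullet> a \<ge> 1" using c[OF a(1)] a q[OF a(1)] by auto
  then have "?c a \<le> ?c a * (q \<bullet> a)" by simp
  then have "?c a = 1" using a1(1) \<open>?c a \<ge> 1\<close> by linarith
  then show ?thesis using va a(1) by simp
qed

text \<open>
  If \<open>q\<close> is 1 on \<open>B\<close> and no root of \<open>span B\<close> has \<open>q\<close>-height strictly between -1 and 1, then the elements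
  of \<open>B\<close> are indecomposable. The vector \<open>u = N p + q\<close>, with \<open>p \<in> B\<^sup>\<bottom>\<close> generic and \<open>N\<close> large, orders the
  roots so that those of \<open>span B\<close> come lowest. Moving \<open>u\<close> into the dominant chamber makes the elements
  of \<open>B\<close> simple.
\<close>
lemma parabolic_base_criterion:
  assumes B: "B \<subseteq> \<Phi>" and q1: "\<And>b. b \<in> B \<Longrightarrow> q \<bullet> b = 1"
    and q2: "\<And>v. v \<in> \<Phi> \<Longrightarrow> v \<in> span B \<Longrightarrow> \<bar>q \<bullet> v\<bar> \<ge> 1"
  shows "parabolic_base B"
proof -
  let ?F = "\<Phi> - span B"
  have "\<exists>p\<in>perp B. \<forall>v\<in>?F. p \<bullet> v \<noteq> 0"
  proof (rule exists_generic_vector[OF subspace_perp])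
    fix v assume "v \<in> ?F"
    then show "\<exists>y\<in>perp B. y \<bullet> v \<noteq> 0"
      using in_span_iff_perp[of v B] by (auto simp: inner_commute)
  qed (simp add: finite_roots)
  then obtain p where p: "p \<in> perp B" "\<forall>v\<in>?F. p \<bullet> v \<noteq> 0" by blast
  \<comment> \<open>so large that outside \<open>span B\<close> the sign of \<open>N p + q\<close> is that of \<open>p\<close>\<close>
  define N where "N = 1 + (\<Sum>v\<in>?F. \<bar>q \<bullet> v\<bar> / \<bar>p \<bullet> v\<bar>)"
  have N0: "N > 0" unfolding N_def by (smt (verit) divide_nonneg_nonneg sum_nonneg abs_ge_zero)
  have N: "\<bar>q \<bullet> v\<bar> < N * \<bar>p \<bullet> v\<bar>" if "v \<in> ?F" for v
  proof -
    have "\<bar>q \<bullet> v\<bar> / \<bar>p \<bullet> v\<bar> \<le> (\<Sum>v\<in>?F. \<bar>q \<bullet> v\<bar> / \<bar>p \<bullet> v\<bar>)"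
      using finite_roots that by (intro member_le_sum[of v ?F "\<lambda>v. \<bar>q \<bullet> v\<bar> / \<bar>p \<bullet> v\<bar>"]) auto
    then have "\<bar>q \<bullet> v\<bar> / \<bar>p \<bullet> v\<bar> < N" unfolding N_def by simp
    moreover have "\<bar>p \<bullet> v\<bar> > 0" using p that by auto
    ultimately show ?thesis by (simp add: divide_less_eq)
  qed
  define u where "u = N *\<^sub>R p + q"
  obtain g where g: "g \<in> W" "\<forall>a\<in>\<Delta>. g u \<bullet> a \<ge> 0" using W_dominant by blast
  obtain h where h: "h \<in> W" "g \<circ> h = id" "h \<circ> g = id" using W_inverse g by blast
  have ha: "u \<bullet> h a \<ge> 0" "h a \<in> \<Phi>" if "a \<in> \<Delta>" for a
    using g(2) W_adjoint[OF g(1) h(2)] that W_root[OF h(1) simple_root] by auto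
  have uv: "u \<bullet> v = N * (p \<bullet> v) + q \<bullet> v" for v by (simp add: u_def inner_add_left)
  have p0: "p \<bullet> h a \<ge> 0" if a: "a \<in> \<Delta>" for a
  proof (cases "h a \<in> span B")
    case True
    then show ?thesis using perp_span[OF p(1) True] by (simp add: inner_commute)
  next
    case False
    show ?thesis
    proof (rule ccontr)
      assume "\<not> ?thesis"
      then have "u \<bullet> h a < 0" using uv[of "h a"] N[of "h a"] ha[OF a] False by (auto simp: abs_if split: if_splits)
      then show False using ha[OF a] by simp
    qed
  qed
  have "g b \<in> \<Delta>" if b: "b \<in> B" for b
  proof -
    have "p \<bullet> b = 0" using p(1) b by (auto simp: perp_def inner_commute)
    then have ub: "u \<bullet> b = 1" using uv q1[OF b] by simp
    have gb: "g b \<in> \<Phi>" using W_root[OF g(1)] b B by auto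
    have inn: "g x \<bullet> a = x \<bullet> h a" for x a using W_adjoint[OF g(1) h(2)] .
    have posb: "pos (g b)"
    proof (rule ccontr)
      assume "\<not> pos (g b)"
      then have "pos (- g b)" using not_pos_iff gb by blast
      then have "g u \<bullet> (- g b) \<ge> 0" using dominant_root_inner g(2) by blast
      then show False using W_inner[OF g(1), of u b] ub by simp
    qed
    have "g p \<bullet> g b = 0" using W_inner[OF g(1), of p b] \<open>p \<bullet> b = 0\<close> by simp
    then have sum0: "(\<Sum>a\<in>\<Delta>. (coweight a \<bullet> g b) * (p \<bullet> h a)) = 0"
      using inner_root_expand[OF gb, of "g p"] inn by simp
    have "g q \<bullet> a \<ge> 1" if a: "a \<in> \<Delta>" "coweight a \<bullet> g b > 0" for a
    proof -
      have "(coweight a \<bullet> g b) * (p \<bullet> h a) = 0"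
        using sum_nonneg_eq_0_iff[OF finite_simple, of "\<lambda>a. (coweight a \<bullet> g b) * (p \<bullet> h a)"] sum0 a(1) p0 posb
        by (auto simp: pos_def)
      then have pa: "p \<bullet> h a = 0" using a by simp
      then have "h a \<in> span B" using p(2) ha(2)[OF a(1)] by blast
      then have "\<bar>q \<bullet> h a\<bar> \<ge> 1" using q2 ha(2)[OF a(1)] by blast
      moreover have "q \<bullet> h a \<ge> 0" using ha(1)[OF a(1)] uv[of "h a"] pa by simp
      ultimately show ?thesis using inn by simp
    qed
    moreover have "g q \<bullet> g b = 1" using W_inner[OF g(1)] q1[OF b] by simp
    ultimately show ?thesis using simple_if_height_one[OF posb] by blast
  qed
  then have "g ` B \<subseteq> \<Delta>" by blast
  moreover have "B = h ` (g ` B)" using h(3) by (simp add: image_comp)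
  ultimately show ?thesis unfolding parabolic_base_def using h(1) by blast
qed

section \<open>Pointwise stabilizers of flats\<close>

definition fixer :: "'a set \<Rightarrow> ('a \<Rightarrow> 'a) set" where
  "fixer X = {g\<in>W. \<forall>x\<in>X. g x = x}"

lemma fixer_comp: "f \<in> fixer X \<Longrightarrow> g \<in> fixer X \<Longrightarrow> f \<circ> g \<in> fixer X"
  unfolding fixer_def using W_comp by auto

lemma fixer_inverse:
  assumes "f \<in> fixer X" obtains g where "g \<in> fixer X" "f \<circ> g = id" "g \<circ> f = id"
proof -
  have f: "f \<in> W" "\<And>x. x \<in> X \<Longrightarrow> f x = x" using assms unfolding fixer_def by auto
  obtain g where g: "g \<in> W" "f \<circ> g = id" "g \<circ> f = id" using W_inverse[OF f(1)] by blast
  have "g x = x" if "x \<in> X" for x using f(2)[OF that] fun_cong[OF g(3), of x] by simp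
  then have "g \<in> fixer X" using g(1) by (simp add: fixer_def)
  then show ?thesis using that g by blast
qed

lemma parabolic_coweight:
  "g \<in> parabolic K \<Longrightarrow> K \<subseteq> \<Delta> \<Longrightarrow> a \<in> \<Delta> - K \<Longrightarrow> coweight a \<bullet> g v = coweight a \<bullet> v"
proof -
  have "coweight a \<bullet> act w v = coweight a \<bullet> v" if "set w \<subseteq> K" "K \<subseteq> \<Delta>" "a \<in> \<Delta> - K" for w
    using that by (induction w) (auto simp: coweight_reflection subset_iff)
  then show "g \<in> parabolic K \<Longrightarrow> K \<subseteq> \<Delta> \<Longrightarrow> a \<in> \<Delta> - K \<Longrightarrow> coweight a \<bullet> g v = coweight a \<bullet> v"
    unfolding parabolic_def by blast
qed

lemma sum_coweights_inner:
  assumes "b \<in> \<Delta>" "A \<subseteq> \<Delta>"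
  shows "(\<Sum>a\<in>A. coweight a) \<bullet> b = (if b \<in> A then 1 else 0)"
  using assms finite_subset[OF assms(2) finite_simple] by (simp add: inner_sum_left coweight_simple)

text \<open>
  The sum of the coweights outside \<open>K\<close> is a dominant point of \<open>K\<^sup>\<bottom>\<close> that lies on no other simple
  hyperplane, so \<open>dominant_stabilizer\<close> applies to it.
\<close>
lemma fixer_perp_simple:
  assumes "K \<subseteq> \<Delta>"
  shows "fixer (perp K) = parabolic K"
proof
  let ?p = "\<Sum>a\<in>\<Delta> - K. coweight a"
  have p: "?p \<bullet> b = (if b \<in> K then 0 else 1)" if "b \<in> \<Delta>" for b
    using sum_coweights_inner[OF that, of "\<Delta> - K"] that by auto
  have "?p \<in> perp K" using p assms by (auto simp: perp_def inner_commute[of _ ?p])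
  have "{a\<in>\<Delta>. ?p \<bullet> a = 0} = K" using p assms by (auto split: if_splits)
  then show "fixer (perp K) \<subseteq> parabolic K"
    using dominant_stabilizer[of _ ?p] p \<open>?p \<in> perp K\<close> unfolding fixer_def by auto
  have "act w x = x" if "set w \<subseteq> K" "x \<in> perp K" for w x
    using that by (induction w) (auto simp: reflection_fixes perp_def inner_commute)
  then show "parabolic K \<subseteq> fixer (perp K)"
    using parabolic_subset[OF assms] unfolding fixer_def parabolic_def by auto
qed

text \<open>
  An element of \<open>parabolic K\<close> does not change coefficients outside \<open>K\<close>; if it also permutes \<open>K\<close>, then
  it keeps all simple roots positive.
\<close>
lemma parabolic_stabilizes_simple_imp_id:
  assumes "K \<subseteq> \<Delta>" "g \<in> parabolic K" "g ` K = K"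
  shows "g = id"
proof (rule W_positive_imp_id)
  show gW: "g \<in> W" using parabolic_subset assms by blast
  fix a assume a: "a \<in> \<Delta>"
  show "pos (g a)"
  proof (cases "a \<in> K")
    case True
    then show ?thesis using assms pos_simple by blast
  next
    case False
    then have "coweight a \<bullet> g a = 1" using parabolic_coweight[OF assms(2,1), of a a] a coweight_simple by auto
    then show ?thesis using pos_if_coord_pos[of "g a" a] a W_root[OF gW simple_root[OF a]] by simp
  qed
qed

lemma W_span: "g \<in> W \<Longrightarrow> g ` span B = span (g ` B)"
  using W_linear linear_span_image by metis

lemma simple_coords_span:
  assumes "K \<subseteq> \<Delta>" "v \<in> span K" "a \<in> \<Delta> - K" shows "coweight a \<bullet> v = 0"
  using assms(2)
  by (induction v rule: span_induct) (use assms in \<open>auto simp: subspace_def inner_add_right coweight_simple subset_iff\<close>)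

text \<open>
  In the coordinates of \<open>B\<close> the value \<open>q \<bullet> v\<close> is the sum of the coefficients of \<open>v\<close>, which are integers of
  a common sign.
\<close>
lemma parabolic_base_height:
  assumes B: "parabolic_base B" and q: "\<And>b. b \<in> B \<Longrightarrow> q \<bullet> b = 1" and v: "v \<in> \<Phi>" "v \<in> span B"
  shows "\<bar>q \<bullet> v\<bar> \<ge> 1"
proof -
  obtain g K where g: "g \<in> W" "K \<subseteq> \<Delta>" "B = g ` K" using B unfolding parabolic_base_def by blast
  obtain h where h: "h \<in> W" "g \<circ> h = id" "h \<circ> g = id" using W_inverse g by blast
  have "h ` B = K" using g(3) h(3) by (simp add: image_comp)
  then have hv: "h v \<in> span K" using W_span[OF h(1), of B] v(2) by auto
  have hr: "h v \<in> \<Phi>" using W_root[OF h(1) v(1)] .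
  have hq: "h q \<bullet> a = 1" if "a \<in> K" for a using W_adjoint[OF h(1) h(3)] q g(3) that by auto
  have "q \<bullet> v = h q \<bullet> h v" using W_inner[OF h(1)] by simp
  also have "\<dots> = (\<Sum>a\<in>\<Delta>. (coweight a \<bullet> h v) * (h q \<bullet> a))" using inner_root_expand[OF hr] .
  also have "\<dots> = (\<Sum>a\<in>\<Delta>. coweight a \<bullet> h v)"
  proof (rule sum.cong[OF refl])
    fix a assume "a \<in> \<Delta>"
    then show "(coweight a \<bullet> h v) * (h q \<bullet> a) = coweight a \<bullet> h v"
      using hq[of a] simple_coords_span[OF g(2) hv, of a] by (cases "a \<in> K") auto
  qed
  finally have e: "q \<bullet> v = (\<Sum>a\<in>\<Delta>. coweight a \<bullet> h v)" .
  have "h v \<noteq> 0" using hr root_nonzero by blast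
  then obtain a where a: "a \<in> \<Delta>" "coweight a \<bullet> h v \<noteq> 0" using root_expand[OF hr] by (metis (no_types, lifting) scale_zero_left sum.neutral)
  obtain k :: int where k: "coweight a \<bullet> h v = of_int k" using root_coords(2)[OF hr a(1)] Ints_cases by blast
  have k1: "\<bar>coweight a \<bullet> h v\<bar> \<ge> 1" using a k by auto
  from root_coords(3)[OF hr] show ?thesis
  proof
    assume p: "\<forall>a\<in>\<Delta>. coweight a \<bullet> h v \<ge> 0"
    then have "coweight a \<bullet> h v \<le> (\<Sum>a\<in>\<Delta>. coweight a \<bullet> h v)"
      using a finite_simple by (intro member_le_sum) auto
    then show ?thesis using e k1 p a by auto
  next
    assume p: "\<forall>a\<in>\<Delta>. coweight a \<bullet> h v \<le> 0"
    then have "- (coweight a \<bullet> h v) \<le> (\<Sum>a\<in>\<Delta>. - (coweight a \<bullet> h v))"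
      using a finite_simple by (intro member_le_sum) auto
    then show ?thesis using e k1 p a by (auto simp: sum_negf)
  qed
qed

lemma independent_parabolic_base: "parabolic_base B \<Longrightarrow> independent B"
  unfolding parabolic_base_def
  using W_linear W_inj independent_mono[OF independent_simple] linear_independent_injective_image
  by (metis inj_on_subset subset_UNIV)

text \<open>
  Make the vector that is 1 on \<open>B\<close> dominant for \<open>K\<close>. Then \<open>K\<close> and the image of \<open>B\<close> are bases with the
  same positive roots, and a base consists of the indecomposable positive roots.
\<close>
lemma parabolic_transitive_bases:
  assumes K: "K \<subseteq> \<Delta>" and B: "parabolic_base B" "perp B = perp K"
  shows "\<exists>h\<in>parabolic K. h ` B = K"
proof -
  obtain q where q: "\<And>b. b \<in> B \<Longrightarrow> q \<bullet> b = 1"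
    using exists_dual_vector[OF independent_parabolic_base[OF B(1)], of "\<lambda>_. 1"] by blast
  obtain h where h: "h \<in> parabolic K" "\<forall>a\<in>K. h q \<bullet> a \<ge> 0" using parabolic_dominant[OF K, of q] by blast
  have hW: "h \<in> W" using parabolic_subset K h(1) by blast
  have hX: "h ` perp K = perp K"
    using h(1) fixer_perp_simple[OF K] by (force simp: fixer_def)
  have B': "parabolic_base (h ` B)" "perp (h ` B) = perp K"
    using parabolic_base_image[OF B(1) hW] W_perp_image[OF hW] B(2) hX by auto
  have spn: "span (h ` B) = span K" using perp_eq_imp_span_eq[OF B'(2)] .
  have q': "h q \<bullet> b = 1" if "b \<in> h ` B" for b using that q W_inner[OF hW] by auto
  have qa: "h q \<bullet> a \<ge> 1" if "a \<in> K" for a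
  proof -
    have "\<bar>h q \<bullet> a\<bar> \<ge> 1"
      using parabolic_base_height[OF B'(1) q', of a] spn that K simple_root by (auto intro: span_base)
    then show ?thesis using h(2) that by fastforce
  qed
  have "b \<in> K" if b: "b \<in> h ` B" for b
  proof -
    have br: "b \<in> \<Phi>" using b B' parabolic_base_roots by blast
    have bs: "b \<in> span K" using span_base[OF b] spn by simp
    have co: "coweight a \<bullet> b = 0" if "a \<in> \<Delta> - K" for a using simple_coords_span[OF K bs that] .
    have "pos b"
    proof (rule ccontr)
      assume "\<not> pos b"
      then have p: "pos (- b)" using not_pos_iff br by blast
      have "h q \<bullet> (- b) = (\<Sum>a\<in>\<Delta>. (coweight a \<bullet> (- b)) * (h q \<bullet> a))" using inner_root_expand[OF pos_root[OF p]] .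
      also have "\<dots> \<ge> 0"
      proof (intro sum_nonneg)
        fix a assume a: "a \<in> \<Delta>"
        show "0 \<le> (coweight a \<bullet> (- b)) * (h q \<bullet> a)"
        proof (cases "a \<in> K")
          case True
          then show ?thesis using p a qa[of a] by (intro mult_nonneg_nonneg) (auto simp: pos_def)
        next
          case False
          then show ?thesis using co[of a] a by simp
        qed
      qed
      finally show False using q'[OF b] by simp
    qed
    moreover have "h q \<bullet> a \<ge> 1" if "a \<in> \<Delta>" "coweight a \<bullet> b > 0" for a
      using that co[of a] qa by fastforce
    ultimately have "b \<in> \<Delta>" using simple_if_height_one q'[OF b] by blast
    then show "b \<in> K" using co[of b] coweight_simple[of b b] by auto
  qed
  then have sub: "h ` B \<subseteq> K" by blast
  have "K \<subseteq> h ` B"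
  proof
    fix a assume a: "a \<in> K"
    show "a \<in> h ` B"
    proof (rule ccontr)
      assume "a \<notin> h ` B"
      then have "h ` B \<subseteq> K - {a}" using sub by blast
      then have "span (h ` B) \<subseteq> span (K - {a})" by (rule span_mono)
      then have "a \<in> span (K - {a})" using span_base[OF a] spn by auto
      moreover have "independent K" using independent_mono[OF independent_simple K] .
      ultimately show False using a unfolding dependent_def by blast
    qed
  qed
  then show ?thesis using sub h(1) by blast
qed

text \<open>
  The pointwise stabilizer of the flat acts simply transitively on the parabolic bases whose orthogonal
  complement is the flat. After conjugation one of the bases consists of simple roots.
\<close>
theorem card_bases_of_flat:
  assumes B: "parabolic_base B0"
  shows "card {B. parabolic_base B \<and> perp B = perp B0} = card (fixer (perp B0))"
proof -
  obtain g K where g: "g \<in> W" "K \<subseteq> \<Delta>" "B0 = g ` K" using B unfolding parabolic_base_def by blast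
  obtain h where h: "h \<in> W" "g \<circ> h = id" "h \<circ> g = id" using W_inverse g by blast
  have gh: "g (h x) = x" "h (g x) = x" for x using h by (metis comp_apply id_apply)+
  have conj1: "h \<circ> f \<circ> g \<in> parabolic K" if "f \<in> fixer (perp B0)" for f
  proof -
    have "f (g x) = g x" if "x \<in> perp K" for x
      using \<open>f \<in> fixer (perp B0)\<close> that W_perp_image[OF g(1), of K] g(3) by (auto simp: fixer_def)
    then have "h \<circ> f \<circ> g \<in> fixer (perp K)"
      using that W_comp g h gh unfolding fixer_def by auto
    then show ?thesis using fixer_perp_simple[OF g(2)] by simp
  qed
  have conj2: "g \<circ> f \<circ> h \<in> fixer (perp B0)" if "f \<in> parabolic K" for f
  proof -
    have f: "f \<in> W" "\<forall>x\<in>perp K. f x = x" using that fixer_perp_simple[OF g(2)] by (auto simp: fixer_def)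
    then show ?thesis
      using W_perp_image[OF g(1), of K] g(3) W_comp g h gh unfolding fixer_def by auto
  qed
  have "inj_on (\<lambda>f. f ` B0) (fixer (perp B0))"
    proof (rule inj_onI)
      fix f1 f2 assume f: "f1 \<in> fixer (perp B0)" "f2 \<in> fixer (perp B0)" "f1 ` B0 = f2 ` B0"
      obtain k where k: "k \<in> fixer (perp B0)" "f2 \<circ> k = id" "k \<circ> f2 = id" using fixer_inverse f(2) by blast
      have "(k \<circ> f1) ` B0 = B0" using f(3) k(3) by (metis image_comp image_id id_apply image_ident)
      then have "(h \<circ> (k \<circ> f1) \<circ> g) ` K = K" using g(3) h(3) by (metis image_comp id_apply image_ident image_id)
      then have e: "h \<circ> (k \<circ> f1) \<circ> g = id"
        using parabolic_stabilizes_simple_imp_id[OF g(2) conj1] fixer_comp[OF k(1) f(1)] by blast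
      have "k (f1 x) = x" for x
        using fun_cong[OF e, of "h x"] gh by (metis comp_apply id_apply)
      then show "f1 = f2" using k(2) by (metis comp_apply ext id_apply)
    qed
  moreover have "(\<lambda>f. f ` B0) ` fixer (perp B0) = {B. parabolic_base B \<and> perp B = perp B0}"
  proof (intro equalityI subsetI)
    fix B assume "B \<in> (\<lambda>f. f ` B0) ` fixer (perp B0)"
    then obtain f where f: "f \<in> fixer (perp B0)" "B = f ` B0" by blast
    then have "f ` perp B0 = perp B0" by (force simp: fixer_def)
    then show "B \<in> {B. parabolic_base B \<and> perp B = perp B0}"
      using f parabolic_base_image[OF B] W_perp_image[of f B0] by (auto simp: fixer_def)
  next
    fix B assume "B \<in> {B. parabolic_base B \<and> perp B = perp B0}"
    then have B1: "parabolic_base B" "perp B = perp B0" by auto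
    have "perp (h ` B) = h ` g ` perp K" using W_perp_image[OF h(1)] W_perp_image[OF g(1)] B1(2) g(3) by simp
    also have "\<dots> = perp K" by (simp add: image_image gh)
    finally obtain k where k: "k \<in> parabolic K" "k ` (h ` B) = K"
      using parabolic_transitive_bases[OF g(2) parabolic_base_image[OF B1(1) h(1)]] by blast
    have "g \<circ> k \<circ> h \<in> fixer (perp B0)" using conj2[OF k(1)] .
    then obtain f where f: "f \<in> fixer (perp B0)" "(g \<circ> k \<circ> h) \<circ> f = id" "f \<circ> (g \<circ> k \<circ> h) = id"
      using fixer_inverse by blast
    have "(g \<circ> k \<circ> h) ` B = g ` (k ` (h ` B))" by (simp only: image_comp comp_assoc)
    then have "(g \<circ> k \<circ> h) ` B = B0" using k(2) g(3) by simp
    then have "f ` B0 = B" using f(3) by (metis image_comp image_id id_apply image_ident)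
    then show "B \<in> (\<lambda>f. f ` B0) ` fixer (perp B0)" using f(1) by blast
  qed
  ultimately show ?thesis using card_image by metis
qed

section \<open>The order as a sum over parabolic bases\<close>

lemma finite_fixer: "finite (fixer X)"
  using finite_W unfolding fixer_def by simp

lemma fixer_id: "id \<in> fixer X"
  using W_id unfolding fixer_def by simp

lemma card_fixer_pos: "card (fixer X) > 0"
  using fixer_id finite_fixer card_gt_0_iff by blast

lemma partial_restriction_eq_iff:
  "partial_restriction g X = partial_restriction h X \<longleftrightarrow> (\<forall>x\<in>X. g x = h x)"
  by (auto simp: partial_restriction_def restrict_map_def fun_eq_iff)

lemma card_restrictions: "card W = card ((\<lambda>g. partial_restriction g X) ` W) * card (fixer X)"
proof (rule card_eq_image_times_fiber[OF finite_W])
  fix g assume g: "g \<in> W"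
  obtain h where h: "h \<in> W" "g \<circ> h = id" "h \<circ> g = id" using W_inverse g by blast
  have gh: "g (h x) = x" "h (g x) = x" for x using h by (metis comp_apply id_apply)+
  show "bij_betw (\<lambda>h. g \<circ> h) (fixer X) {g' \<in> W. partial_restriction g' X = partial_restriction g X}"
    unfolding partial_restriction_eq_iff
    by (rule bij_betw_byWitness[where f' = "\<lambda>f. h \<circ> f"])
      (use g h gh W_comp in \<open>auto simp: fixer_def fun_eq_iff\<close>)
qed

text \<open>
  A flat \<open>X\<close> carries \<open>|W| / |W\<^sub>X|\<close> restrictions; distributing this over the \<open>|W\<^sub>X|\<close> parabolic bases of
  \<open>X\<close> yields the square.
\<close>
lemma order_arrangement_monoid:
  "real (Coset.order (arrangement_monoid \<Phi>)) =
     (\<Sum>B\<in>{B. parabolic_base B}. real (card W) / (real (card (fixer (perp B))))\<^sup>2)"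
proof -
  let ?L = "perp ` {B. parabolic_base B}"
  let ?R = "\<lambda>X. (\<lambda>g. partial_restriction g X) ` W"
  have L: "intersections (reflection_arrangement \<Phi>) = ?L"
    using flat_iff_perp[of _ \<Phi>] flat_eq_perp_parabolic_base parabolic_base_roots
    by (auto simp: image_iff) metis
  have fin: "finite ?L" using finite_parabolic_bases by simp
  have disj: "?R X \<inter> ?R Y = {}" if "X \<noteq> Y" for X Y :: "'a set"
  proof -
    have "dom (partial_restriction g X) = X" for g :: "'a \<Rightarrow> 'a" and X
      by (auto simp: partial_restriction_def)
    then show ?thesis using that by (metis (no_types, lifting) disjoint_iff image_iff)
  qed
  have "carrier (arrangement_monoid \<Phi>) = (\<Union>X\<in>?L. ?R X)"
    unfolding arrangement_monoid_def L by auto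
  moreover have "card (\<Union>X\<in>?L. ?R X) = (\<Sum>X\<in>?L. card (?R X))"
    using fin finite_W disj by (intro card_UN_disjoint) blast+
  ultimately have "Coset.order (arrangement_monoid \<Phi>) = (\<Sum>X\<in>?L. card (?R X))"
    unfolding Coset.order_def by simp
  also have "real \<dots> = (\<Sum>X\<in>?L. real (card W) / real (card (fixer X)))"
    unfolding of_nat_sum
  proof (rule sum.cong[OF refl])
    fix X show "real (card (?R X)) = real (card W) / real (card (fixer X))"
      using card_fixer_pos[of X] by (subst card_restrictions[of X]) simp
  qed
  also have "\<dots> = (\<Sum>X\<in>?L. \<Sum>B\<in>{B\<in>{B. parabolic_base B}. perp B = X}. real (card W) / (real (card (fixer (perp B))))\<^sup>2)"
  proof (intro sum.cong refl)
    fix X assume "X \<in> ?L"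
    then obtain B0 where B0: "parabolic_base B0" "X = perp B0" by blast
    have "(\<Sum>B\<in>{B\<in>{B. parabolic_base B}. perp B = X}. real (card W) / (real (card (fixer (perp B))))\<^sup>2)
      = (\<Sum>B\<in>{B. parabolic_base B \<and> perp B = X}. real (card W) / (real (card (fixer X)))\<^sup>2)"
      by (intro sum.cong) auto
    also have "\<dots> = real (card (fixer X)) * (real (card W) / (real (card (fixer X)))\<^sup>2)"
      using card_bases_of_flat[OF B0(1)] B0(2) by simp
    also have "\<dots> = real (card W) / real (card (fixer X))"
      using card_fixer_pos[of X] by (simp add: power2_eq_square)
    finally show "real (card W) / real (card (fixer X)) = (\<Sum>B\<in>{B\<in>{B. parabolic_base B}. perp B = X}. real (card W) / (real (card (fixer (perp B))))\<^sup>2)"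
      by simp
  qed
  also have "\<dots> = (\<Sum>B\<in>{B. parabolic_base B}. real (card W) / (real (card (fixer (perp B))))\<^sup>2)"
    using sum.image_gen[OF finite_parabolic_bases, of _ perp] by (rule sym)
  finally show ?thesis .
qed

end

section \<open>Orders of parabolic subgroups from orbits of highest roots\<close>

context based_root_system
begin

lemma inner_span_zero: "x \<in> span C \<Longrightarrow> (\<And>c. c \<in> C \<Longrightarrow> c \<bullet> a = 0) \<Longrightarrow> x \<bullet> a = 0"
  using span_minimal[of C "{v. v \<bullet> a = 0}"] by (auto simp: subspace_def inner_add_left)

text \<open>
  Adding a large multiple of a dominant point of \<open>K\<^sup>\<bottom>\<close> to \<open>x\<close> makes it dominant for all of \<open>\<Delta>\<close> and does
  not change its stabilizer in \<open>parabolic K\<close>.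
\<close>
lemma parabolic_stabilizer:
  assumes K: "K \<subseteq> \<Delta>" and x: "\<And>a. a \<in> K \<Longrightarrow> x \<bullet> a \<ge> 0"
  shows "{f\<in>parabolic K. f x = x} = parabolic {a\<in>K. x \<bullet> a = 0}"
proof (intro equalityI subsetI)
  let ?p = "\<Sum>a\<in>\<Delta> - K. coweight a"
  define N where "N = 1 + (\<Sum>a\<in>\<Delta>. \<bar>x \<bullet> a\<bar>)"
  have p: "?p \<bullet> b = (if b \<in> K then 0 else 1)" if "b \<in> \<Delta>" for b
    using sum_coweights_inner[OF that, of "\<Delta> - K"] that by auto
  have pK: "?p \<in> perp K" using p K by (auto simp: perp_def inner_commute[of _ ?p])
  have N: "- (x \<bullet> a) < N" if "a \<in> \<Delta>" for a
  proof -
    have "\<bar>x \<bullet> a\<bar> \<le> (\<Sum>a\<in>\<Delta>. \<bar>x \<bullet> a\<bar>)"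
      using that finite_simple by (intro member_le_sum[of a \<Delta> "\<lambda>a. \<bar>x \<bullet> a\<bar>"]) auto
    then show ?thesis unfolding N_def by linarith
  qed
  let ?y = "x + N *\<^sub>R ?p"
  have y: "?y \<bullet> a = (if a \<in> K then x \<bullet> a else x \<bullet> a + N)" if "a \<in> \<Delta>" for a
    using p[OF that] by (simp add: inner_add_left)
  have yz: "{a\<in>\<Delta>. ?y \<bullet> a = 0} = {a\<in>K. x \<bullet> a = 0}"
    using y N K by (fastforce split: if_splits)
  fix f assume "f \<in> {f\<in>parabolic K. f x = x}"
  then have f: "f \<in> parabolic K" "f x = x" by auto
  have fW: "f \<in> W" and fp: "f ?p = ?p" using f fixer_perp_simple[OF K] pK by (auto simp: fixer_def)
  have "f ?y = ?y" using W_linear[OF fW] f fp by (simp add: linear_add linear_cmul)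
  moreover have "?y \<bullet> a \<ge> 0" if "a \<in> \<Delta>" for a using y[OF that] N[OF that] x by auto
  ultimately show "f \<in> parabolic {a\<in>K. x \<bullet> a = 0}" using dominant_stabilizer[OF fW] yz by metis
next
  have "act w x = x" if "set w \<subseteq> {a\<in>K. x \<bullet> a = 0}" for w
    using that by (induction w) (auto simp: reflection_fixes)
  then show "f \<in> {f\<in>parabolic K. f x = x}" if "f \<in> parabolic {a\<in>K. x \<bullet> a = 0}" for f
    using that unfolding parabolic_def by auto
qed

lemma reflection_span: "a \<in> C \<Longrightarrow> v \<in> span C \<Longrightarrow> reflection a v \<in> span C"
  by (simp add: reflection_def span_base span_diff span_scale)

text \<open>
  Orbit and stabilizer of the dominant root \<open>\<theta>\<close> of a component \<open>C\<close>: each root of the component with the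
  length of \<open>\<theta>\<close> can be made dominant and then has to be \<open>\<theta>\<close>.
\<close>
lemma card_parabolic_step:
  assumes K: "K \<subseteq> \<Delta>" and C: "C \<subseteq> K" and orth: "\<And>a c. a \<in> K - C \<Longrightarrow> c \<in> C \<Longrightarrow> c \<bullet> a = 0"
    and \<theta>: "\<theta> \<in> \<Phi>" "\<theta> \<in> span C" "\<And>a. a \<in> C \<Longrightarrow> \<theta> \<bullet> a \<ge> 0"
    and unique: "\<And>v. v \<in> \<Phi> \<Longrightarrow> v \<in> span C \<Longrightarrow> v \<bullet> v = \<theta> \<bullet> \<theta> \<Longrightarrow> (\<And>a. a \<in> C \<Longrightarrow> v \<bullet> a \<ge> 0) \<Longrightarrow> v = \<theta>"
  shows "card (parabolic K) =
    card {v\<in>\<Phi>. v \<in> span C \<and> v \<bullet> v = \<theta> \<bullet> \<theta>} * card (parabolic {a\<in>K. \<theta> \<bullet> a = 0})"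
proof -
  have \<theta>K: "\<theta> \<bullet> a \<ge> 0" if "a \<in> K" for a
    using \<theta>(3) inner_span_zero[OF \<theta>(2), of a] orth that by (cases "a \<in> C") auto
  have KR: "K \<subseteq> \<Phi>" using K simple_root by blast
  have "act w \<theta> \<in> \<Phi> \<and> act w \<theta> \<in> span C \<and> act w \<theta> \<bullet> act w \<theta> = \<theta> \<bullet> \<theta>" if "set w \<subseteq> K" for w
    using that
  proof (induction w)
    case (Cons a w)
    then have IH: "act w \<theta> \<in> \<Phi>" "act w \<theta> \<in> span C" "act w \<theta> \<bullet> act w \<theta> = \<theta> \<bullet> \<theta>" and a: "a \<in> K" by auto
    have "a \<in> \<Phi>" using a KR by blast
    have "reflection a (act w \<theta>) \<in> span C"
    proof (cases "a \<in> C")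
      case True
      then show ?thesis using IH(2) by (rule reflection_span)
    next
      case False
      then have "act w \<theta> \<bullet> a = 0" using inner_span_zero[OF IH(2)] orth a by blast
      then show ?thesis using IH(2) by (simp add: reflection_fixes)
    qed
    then show ?case using IH reflection_root[OF \<open>a \<in> \<Phi>\<close> IH(1)] root_nonzero[OF \<open>a \<in> \<Phi>\<close>] by simp
  qed (use \<theta> in auto)
  then have sub: "(\<lambda>g. g \<theta>) ` parabolic K \<subseteq> {v\<in>\<Phi>. v \<in> span C \<and> v \<bullet> v = \<theta> \<bullet> \<theta>}"
    unfolding parabolic_def by blast
  have "v \<in> (\<lambda>g. g \<theta>) ` parabolic K" if v: "v \<in> \<Phi>" "v \<in> span C" "v \<bullet> v = \<theta> \<bullet> \<theta>" for v
  proof -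
    have CD: "C \<subseteq> \<Delta>" using C K by blast
    obtain g where g: "g \<in> parabolic C" "\<forall>a\<in>C. g v \<bullet> a \<ge> 0" using parabolic_dominant[OF CD] by blast
    have gW: "g \<in> W" using parabolic_subset[OF CD] g(1) by blast
    have "act w v \<in> span C" if "set w \<subseteq> C" for w
      using that v(2) by (induction w) (auto intro: reflection_span)
    then have "g v \<in> span C" using g(1) unfolding parabolic_def by blast
    then have gv: "g v = \<theta>" using unique[of "g v"] W_root[OF gW v(1)] W_inner[OF gW] v(3) g(2) by auto
    have "g \<in> fixer (perp K)" using g(1) C fixer_perp_simple[OF K] unfolding parabolic_def by blast
    then obtain f where f: "f \<in> fixer (perp K)" "f \<circ> g = id" using fixer_inverse by metis
    have "v = f \<theta>" using fun_cong[OF f(2), of v] gv by simp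
    then show ?thesis using f(1) fixer_perp_simple[OF K] by blast
  qed
  then have "(\<lambda>g. g \<theta>) ` parabolic K = {v\<in>\<Phi>. v \<in> span C \<and> v \<bullet> v = \<theta> \<bullet> \<theta>}" using sub by blast
  moreover have "card (parabolic K) = card ((\<lambda>g. g \<theta>) ` parabolic K) * card (parabolic {a\<in>K. \<theta> \<bullet> a = 0})"
  proof (rule card_eq_image_times_fiber)
    show "finite (parabolic K)" using finite_subset[OF parabolic_subset[OF K] finite_W] .
    fix g assume g: "g \<in> parabolic K"
    then obtain h where h: "h \<in> parabolic K" "g \<circ> h = id" "h \<circ> g = id"
      using fixer_inverse fixer_perp_simple[OF K] by metis
    have gh: "g (h x) = x" "h (g x) = x" for x using h by (metis comp_apply id_apply)+
    have comp: "f1 \<circ> f2 \<in> parabolic K" if "f1 \<in> parabolic K" "f2 \<in> parabolic K" for f1 f2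
      using that fixer_comp fixer_perp_simple[OF K] by metis
    have comps: "g \<circ> f \<in> parabolic K" "h \<circ> f \<in> parabolic K" if "f \<in> parabolic K" for f
      using comp g h that by auto
    have "bij_betw (\<lambda>h. g \<circ> h) {f\<in>parabolic K. f \<theta> = \<theta>} {g' \<in> parabolic K. g' \<theta> = g \<theta>}"
      by (rule bij_betw_byWitness[where f' = "\<lambda>f. h \<circ> f"])
        (use comps gh in \<open>auto simp: fun_eq_iff\<close>)
    then show "bij_betw (\<lambda>h. g \<circ> h) (parabolic {a\<in>K. \<theta> \<bullet> a = 0}) {g' \<in> parabolic K. g' \<theta> = g \<theta>}"
      using parabolic_stabilizer[OF K \<theta>K] by simp
  qed
  ultimately show ?thesis by simp
qed

lemma card_fixer_image:
  assumes g: "g \<in> W" shows "card (fixer (g ` X)) = card (fixer X)"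
proof -
  obtain h where h: "h \<in> W" "g \<circ> h = id" "h \<circ> g = id" using W_inverse g by blast
  have gh: "g (h x) = x" "h (g x) = x" for x using h by (metis comp_apply id_apply)+
  have "bij_betw (\<lambda>f. g \<circ> f \<circ> h) (fixer X) (fixer (g ` X))"
    by (rule bij_betw_byWitness[where f' = "\<lambda>f. h \<circ> f \<circ> g"])
      (use W_comp g h gh in \<open>auto simp: fixer_def fun_eq_iff\<close>)
  then show ?thesis using bij_betw_same_card by metis
qed

lemma parabolic_simple_eq_W: "parabolic \<Delta> = W"
proof
  show "parabolic \<Delta> \<subseteq> W" by (rule parabolic_subset) simp
  show "W \<subseteq> parabolic \<Delta>" unfolding parabolic_def using W_word by blast
qed

section \<open>Counting parabolic bases by class\<close>

definition base_class :: "('a set \<Rightarrow> 't) \<Rightarrow> 't \<Rightarrow> 'a set set" where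
  "base_class tag t = {B. parabolic_base B \<and> tag B = t}"

lemma finite_base_class: "finite (base_class tag t)"
  unfolding base_class_def by (rule finite_subset[OF _ finite_parabolic_bases]) auto

text \<open>
  Count the pairs of a base in the class of \<open>t\<close> and one of its elements whose removal leads into the class of
  \<open>s\<close>. As \<open>W\<close> preserves the numbers of choices on both sides, sets of simple roots determine them.
\<close>
lemma card_base_class_edge:
  fixes tag :: "'a set \<Rightarrow> 't"
  assumes inv: "\<And>g B. g \<in> W \<Longrightarrow> tag (g ` B) = tag B"
    and c: "\<And>K. K \<subseteq> \<Delta> \<Longrightarrow> tag K = t \<Longrightarrow> card {a\<in>K. tag (K - {a}) = s} = c"
    and e: "\<And>K. K \<subseteq> \<Delta> \<Longrightarrow> tag K = s \<Longrightarrow>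
      card {b\<in>\<Phi>. b \<notin> K \<and> parabolic_base (insert b K) \<and> tag (insert b K) = t} = e"
  shows "card (base_class tag t) * c = card (base_class tag s) * e"
proof -
  define down where "down B = {a\<in>B. tag (B - {a}) = s}" for B
  define up where "up B = {b\<in>\<Phi>. b \<notin> B \<and> parabolic_base (insert b B) \<and> tag (insert b B) = t}" for B
  have down: "card (down B) = c" if B: "B \<in> base_class tag t" for B
  proof -
    obtain g K where g: "g \<in> W" "K \<subseteq> \<Delta>" "B = g ` K" "tag B = t"
      using B unfolding base_class_def parabolic_base_def by blast
    have gi: "inj g" using W_inj[OF g(1)] .
    have "down B = g ` down K"
    proof -
      have "tag (g ` K - {g a}) = tag (K - {a})" if "a \<in> K" for a
      proof -
        have "g ` K - {g a} = g ` (K - {a})" using gi by (auto dest: injD)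
        then show ?thesis using inv[OF g(1)] by simp
      qed
      then show ?thesis unfolding down_def g(3) by auto
    qed
    then have "card (down B) = card (down K)" using gi by (metis card_image inj_on_subset subset_UNIV)
    then show ?thesis using c[OF g(2)] g inv[OF g(1), of K] unfolding down_def by simp
  qed
  have up: "card (up B) = e" if B: "B \<in> base_class tag s" for B
  proof -
    obtain g K where g: "g \<in> W" "K \<subseteq> \<Delta>" "B = g ` K" "tag B = s"
      using B unfolding base_class_def parabolic_base_def by blast
    obtain h where h: "h \<in> W" "g \<circ> h = id" "h \<circ> g = id" using W_inverse g by blast
    have gh: "g (h x) = x" "h (g x) = x" for x using h by (metis comp_apply id_apply)+
    have gi: "inj g" using W_inj[OF g(1)] .
    have up_iff: "g b \<in> up B \<longleftrightarrow> b \<in> up K" for b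
    proof -
      have "insert (g b) B = g ` insert b K" using g(3) by simp
      moreover have "h ` (g ` insert b K) = insert b K" by (simp add: image_image gh)
      ultimately have "parabolic_base (insert (g b) B) \<longleftrightarrow> parabolic_base (insert b K)"
        using parabolic_base_image[OF _ g(1), of "insert b K"] parabolic_base_image[OF _ h(1), of "g ` insert b K"] by auto
      moreover have "tag (insert (g b) B) = tag (insert b K)" using inv[OF g(1), of "insert b K"] g(3) by simp
      moreover have "g b \<in> \<Phi> \<longleftrightarrow> b \<in> \<Phi>" using W_root[OF g(1), of b] W_root[OF h(1), of "g b"] gh by auto
      moreover have "g b \<in> B \<longleftrightarrow> b \<in> K" using g(3) gi by (auto dest: injD)
      ultimately show ?thesis unfolding up_def by simp
    qed
    have "up B = g ` up K"
    proof (intro equalityI subsetI)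
      fix x assume "x \<in> up B"
      then have "h x \<in> up K" using up_iff[of "h x"] gh by simp
      then show "x \<in> g ` up K" using gh by (metis image_eqI)
    qed (use up_iff in auto)
    then have "card (up B) = card (up K)" using gi by (metis card_image inj_on_subset subset_UNIV)
    then show ?thesis using e[OF g(2)] g inv[OF g(1), of K] unfolding up_def by simp
  qed
  have fin: "finite (down B)" if "B \<in> base_class tag t" for B
    using that parabolic_base_roots finite_roots finite_subset unfolding base_class_def down_def
    by (metis (no_types, lifting) mem_Collect_eq subsetI)
  have fin': "finite (up B)" for B using finite_roots unfolding up_def by simp
  have "bij_betw (\<lambda>(B, a). (B - {a}, a)) (Sigma (base_class tag t) down) (Sigma (base_class tag s) up)"
  proof (rule bij_betw_byWitness[where f' = "\<lambda>(B, b). (insert b B, b)"])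
    show "(\<lambda>(B, a). (B - {a}, a)) ` Sigma (base_class tag t) down \<subseteq> Sigma (base_class tag s) up"
      using parabolic_base_subset parabolic_base_roots
      by (fastforce simp: base_class_def down_def up_def insert_absorb)
    show "(\<lambda>(B, b). (insert b B, b)) ` Sigma (base_class tag s) up \<subseteq> Sigma (base_class tag t) down"
      by (auto simp: base_class_def down_def up_def)
  qed (auto simp: down_def up_def)
  then have "card (Sigma (base_class tag t) down) = card (Sigma (base_class tag s) up)"
    by (rule bij_betw_same_card)
  moreover have "card (Sigma (base_class tag t) down) = card (base_class tag t) * c"
    using card_SigmaI[OF finite_base_class, of tag t down] fin down by simp
  moreover have "card (Sigma (base_class tag s) up) = card (base_class tag s) * e"
    using card_SigmaI[OF finite_base_class, of tag s up] fin' up by simp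
  ultimately show ?thesis by simp
qed

lemma order_arrangement_monoid_by_class:
  fixes tag :: "'a set \<Rightarrow> 't"
  assumes inv: "\<And>g B. g \<in> W \<Longrightarrow> tag (g ` B) = tag B"
    and T: "finite T" "\<And>K. K \<subseteq> \<Delta> \<Longrightarrow> tag K \<in> T"
    and b: "\<And>K. K \<subseteq> \<Delta> \<Longrightarrow> card (parabolic K) = b (tag K)"
  shows "real (Coset.order (arrangement_monoid \<Phi>)) =
    (\<Sum>t\<in>T. real (card (base_class tag t)) * real (b (tag \<Delta>)) / (real (b t))\<^sup>2)"
proof -
  have bB: "card (fixer (perp B)) = b (tag B)" and tB: "tag B \<in> T" if "parabolic_base B" for B
  proof -
    obtain g K where g: "g \<in> W" "K \<subseteq> \<Delta>" "B = g ` K" using \<open>parabolic_base B\<close> unfolding parabolic_base_def by blast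
    have "card (fixer (perp B)) = card (parabolic K)"
      using W_perp_image[OF g(1)] card_fixer_image[OF g(1)] fixer_perp_simple[OF g(2)] g(3) by simp
    then show "card (fixer (perp B)) = b (tag B)" "tag B \<in> T"
      using b[OF g(2)] inv[OF g(1)] g(3) T(2)[OF g(2)] by auto
  qed
  have W: "card W = b (tag \<Delta>)" using b[of \<Delta>] parabolic_simple_eq_W by simp
  have "real (Coset.order (arrangement_monoid \<Phi>)) =
    (\<Sum>B\<in>{B. parabolic_base B}. real (card W) / (real (b (tag B)))\<^sup>2)"
    unfolding order_arrangement_monoid using bB by (intro sum.cong) auto
  also have "\<dots> = (\<Sum>t\<in>T. \<Sum>B\<in>{B\<in>{B. parabolic_base B}. tag B = t}. real (card W) / (real (b (tag B)))\<^sup>2)"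
    using tB by (intro sum.group[symmetric] finite_parabolic_bases T(1)) auto
  also have "\<dots> = (\<Sum>t\<in>T. real (card (base_class tag t)) * real (b (tag \<Delta>)) / (real (b t))\<^sup>2)"
    by (intro sum.cong) (auto simp: W base_class_def)
  finally show ?thesis .
qed

text \<open>
  The Dynkin diagram of \<open>B\<close> determines these numbers: \<open>s \<bullet> v\<close> is the row sum at \<open>v\<close> of the Gram matrix, so
  in the simply laced case it is, up to scaling, 2 minus the degree of the node \<open>v\<close>. The third number also
  sees which degrees are adjacent; this separates \<open>E\<^sub>6\<close> from \<open>D\<^sub>6\<close>, which have the same degrees.
\<close>
definition moments :: "'a set \<Rightarrow> int \<times> real \<times> real" where
  "moments B = (let s = \<Sum>B; t = (\<Sum>v\<in>B. (s \<bullet> v) *\<^sub>R v)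
     in (int (card B), \<Sum>v\<in>B. (s \<bullet> v) ^ 3, t \<bullet> t))"

lemma moments_image:
  assumes g: "g \<in> W" shows "moments (g ` B) = moments B"
proof -
  have inj: "inj_on g B" using W_inj[OF g] by (metis inj_on_subset subset_UNIV)
  have s: "\<Sum>(g ` B) = g (\<Sum>B)" using inj W_linear[OF g] by (simp add: sum.reindex linear_sum)
  have "(\<Sum>v\<in>g ` B. (g x \<bullet> v) *\<^sub>R v) = g (\<Sum>v\<in>B. (x \<bullet> v) *\<^sub>R v)" for x
    using inj W_linear[OF g] W_inner[OF g] by (simp add: sum.reindex linear_sum linear_cmul)
  note t = this[of "\<Sum>B"]
  show ?thesis
    unfolding moments_def Let_def s t using inj W_inner[OF g] by (simp add: sum.reindex card_image)
qed

end

section \<open>Extending a set of simple roots to a parabolic base\<close>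

context based_root_system
begin

definition integral_vector :: "'a \<Rightarrow> bool" where
  "integral_vector v \<longleftrightarrow> v \<in> span \<Delta> \<and> (\<forall>a\<in>\<Delta>. coweight a \<bullet> v \<in> \<int>)"

lemma integral_root: "v \<in> \<Phi> \<Longrightarrow> integral_vector v"
  using root_coords unfolding integral_vector_def by blast

lemma integral_W:
  assumes "g \<in> W" "integral_vector v" shows "integral_vector (g v)"
proof -
  have refl: "integral_vector (reflection a v)" if a: "a \<in> \<Delta>" and v: "integral_vector v" for a v
  proof -
    have "v \<in> span \<Delta>" using v by (simp add: integral_vector_def)
    then have "v \<bullet> a = (\<Sum>b\<in>\<Delta>. (coweight b \<bullet> v) * (b \<bullet> a))"
      by (subst (1) span_simple_expand) (auto simp: inner_sum_left)
    then have "2 * (v \<bullet> a) / (a \<bullet> a) = (\<Sum>b\<in>\<Delta>. (coweight b \<bullet> v) * (2 * (b \<bullet> a) / (a \<bullet> a)))"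
      by (simp add: sum_distrib_left sum_divide_distrib algebra_simps)
    also have "\<dots> \<in> \<int>"
      using v cartan_Ints simple_root a by (intro Ints_sum Ints_mult) (auto simp: integral_vector_def)
    finally show ?thesis
      using v a coweight_reflection[OF a] reflection_span[OF a, of v] by (auto simp: integral_vector_def)
  qed
  obtain w where w: "set w \<subseteq> \<Delta>" "g = act w" using W_word assms(1) by blast
  have "integral_vector (act w v)" using w(1)
    by (induction w) (use assms(2) refl in auto)
  then show ?thesis using w(2) by simp
qed

lemma span_simple_subset_expand:
  assumes "K \<subseteq> \<Delta>" "v \<in> span K" shows "v = (\<Sum>a\<in>K. (coweight a \<bullet> v) *\<^sub>R a)"
proof -
  have "v \<in> span \<Delta>" using assms span_mono by blast
  then have "v = (\<Sum>a\<in>\<Delta>. (coweight a \<bullet> v) *\<^sub>R a)" by (rule span_simple_expand)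
  also have "\<dots> = (\<Sum>a\<in>K. (coweight a \<bullet> v) *\<^sub>R a)"
    using finite_simple assms simple_coords_span[OF assms] by (intro sum.mono_neutral_right) auto
  finally show ?thesis .
qed

text \<open>
  Transport to simple roots: both integrality and the common sign hold there.
\<close>
lemma parabolic_base_coords:
  assumes B: "parabolic_base B" and v: "integral_vector v" "v \<in> span B"
  obtains c :: "'a \<Rightarrow> int" where "v = (\<Sum>b\<in>B. of_int (c b) *\<^sub>R b)"
    "v \<in> \<Phi> \<Longrightarrow> (\<forall>b\<in>B. c b \<ge> 0) \<or> (\<forall>b\<in>B. c b \<le> 0)"
proof -
  obtain g K where g: "g \<in> W" "K \<subseteq> \<Delta>" "B = g ` K" using B unfolding parabolic_base_def by blast
  obtain h where h: "h \<in> W" "g \<circ> h = id" "h \<circ> g = id" using W_inverse g by blast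
  have gh: "g (h x) = x" "h (g x) = x" for x using h by (metis comp_apply id_apply)+
  have "h ` B = K" using g(3) by (simp add: image_image gh)
  then have hv: "h v \<in> span K" using W_span[OF h(1), of B] v(2) by auto
  have int: "integral_vector (h v)" using integral_W[OF h(1) v(1)] .
  define c where "c b = \<lfloor>coweight (h b) \<bullet> h v\<rfloor>" for b
  have c: "of_int (c (g a)) = coweight a \<bullet> h v" if "a \<in> K" for a
  proof -
    have "coweight a \<bullet> h v \<in> \<int>" using int that g(2) unfolding integral_vector_def by blast
    then show ?thesis unfolding c_def gh by (metis Ints_cases floor_of_int)
  qed
  have "v = g (h v)" by (simp add: gh)
  also have "h v = (\<Sum>a\<in>K. (coweight a \<bullet> h v) *\<^sub>R a)" using span_simple_subset_expand[OF g(2) hv] .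
  also have "g \<dots> = (\<Sum>a\<in>K. of_int (c (g a)) *\<^sub>R g a)"
    using W_linear[OF g(1)] c by (simp add: linear_sum linear_cmul)
  also have "\<dots> = (\<Sum>b\<in>B. of_int (c b) *\<^sub>R b)"
    unfolding g(3) using W_inj[OF g(1)] by (subst sum.reindex) (auto intro: inj_on_subset)
  finally have e: "v = (\<Sum>b\<in>B. of_int (c b) *\<^sub>R b)" .
  moreover have "(\<forall>b\<in>B. c b \<ge> 0) \<or> (\<forall>b\<in>B. c b \<le> 0)" if "v \<in> \<Phi>"
  proof -
    have "(\<forall>a\<in>K. of_int (c (g a)) \<ge> (0::real)) \<or> (\<forall>a\<in>K. of_int (c (g a)) \<le> (0::real))"
      using root_coords(3)[OF W_root[OF h(1) that]] c g(2) by (metis subsetD)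
    then show ?thesis using g(3) by auto
  qed
  ultimately show ?thesis using that by blast
qed

lemma simple_obtuse: 
  assumes "a \<in> \<Delta>" "b \<in> \<Delta>" "a \<noteq> b" shows "a \<bullet> b \<le> 0"
proof -
  have "pos (reflection a b)" using pos_reflection[OF assms(1) pos_simple[OF assms(2)]] assms(3) by blast
  then have "coweight a \<bullet> reflection a b \<ge> 0" using assms(1) by (simp add: pos_def)
  then have "2 * (b \<bullet> a) / (a \<bullet> a) \<le> 0" using coweight_reflection[OF assms(1), of a b] coweight_simple[OF assms(2), of a] assms(3) by simp
  moreover have "a \<bullet> a > 0" using simple_nonzero assms(1) by simp
  ultimately have "b \<bullet> a \<le> 0" by (simp add: divide_le_0_iff)
  then show ?thesis by (simp add: inner_commute)
qed

lemma parabolic_base_obtuse: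
  assumes "parabolic_base B" "b \<in> B" "c \<in> B" "b \<noteq> c" shows "b \<bullet> c \<le> 0"
proof -
  obtain g K where g: "g \<in> W" "K \<subseteq> \<Delta>" "B = g ` K" using assms(1) unfolding parabolic_base_def by blast
  obtain a a' where "a \<in> K" "a' \<in> K" "b = g a" "c = g a'" using assms(2,3) g(3) by blast
  then show ?thesis using simple_obtuse[of a a'] W_inner[OF g(1)] g(2) assms(4) by auto
qed

lemma parabolic_base_insert_notin_span:
  assumes "parabolic_base (insert b K)" "b \<notin> K" shows "b \<notin> span K"
  using independent_parabolic_base[OF assms(1)] assms(2) unfolding dependent_def
  by (metis Diff_insert_absorb insertI1)

lemma independent_insert_simple: "K \<subseteq> \<Delta> \<Longrightarrow> b \<notin> span K \<Longrightarrow> independent (insert b K)"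
  using independent_insertI independent_mono[OF independent_simple] by blast

lemma off_coordinate:
  assumes "K \<subseteq> \<Delta>" "b \<in> \<Phi>" "b \<notin> span K"
  obtains a where "a \<in> \<Delta> - K" "coweight a \<bullet> b \<noteq> 0"
proof (rule ccontr)
  assume "\<not> thesis"
  then have z: "\<forall>a\<in>\<Delta> - K. coweight a \<bullet> b = 0" using that by blast
  have "b = (\<Sum>a\<in>\<Delta>. (coweight a \<bullet> b) *\<^sub>R a)" using root_expand assms(2) .
  also have "\<dots> = (\<Sum>a\<in>K. (coweight a \<bullet> b) *\<^sub>R a)"
    using finite_simple assms(1) z by (intro sum.mono_neutral_right) auto
  also have "\<dots> \<in> span K" by (intro span_sum span_scale span_base)
  finally show False using assms(3) by blast
qed

text \<open>
  Modulo \<open>span K\<close> the vector \<open>v\<close> is an integral multiple of \<open>b\<close>, and all its coefficients with respect to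
  \<open>insert b K\<close> have the sign of that multiple.
\<close>
definition coherent :: "'a set \<Rightarrow> 'a \<Rightarrow> 'a \<Rightarrow> bool" where
  "coherent K b v \<longleftrightarrow> (\<exists>m::int. v - of_int m *\<^sub>R b \<in> span K \<and>
     (m \<ge> 0 \<and> (\<forall>a\<in>K. coweight a \<bullet> (v - of_int m *\<^sub>R b) \<ge> 0) \<or>
      m \<le> 0 \<and> (\<forall>a\<in>K. coweight a \<bullet> (v - of_int m *\<^sub>R b) \<le> 0)))"

text \<open>
  A set of independent roots is a parabolic base iff the roots in its span are integral combinations with
  coefficients of a common sign.
\<close>
lemma parabolic_base_insert_iff:
  assumes K: "K \<subseteq> \<Delta>" and b: "b \<in> \<Phi>"
  shows "b \<notin> K \<and> parabolic_base (insert b K) \<longleftrightarrow>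
    b \<notin> span K \<and> (\<forall>v\<in>\<Phi>. v \<in> span (insert b K) \<longrightarrow> coherent K b v)" (is "?L \<longleftrightarrow> ?R")
proof
  assume L: ?L
  have nb: "b \<notin> span K" using parabolic_base_insert_notin_span L by blast
  moreover have "coherent K b v" if v: "v \<in> \<Phi>" "v \<in> span (insert b K)" for v
  proof -
    obtain c :: "'a \<Rightarrow> int" where c: "v = (\<Sum>b\<in>insert b K. of_int (c b) *\<^sub>R b)"
      "(\<forall>b\<in>insert b K. c b \<ge> 0) \<or> (\<forall>b\<in>insert b K. c b \<le> 0)"
      using parabolic_base_coords[OF conjunct2[OF L] integral_root[OF v(1)] v(2)] v(1) by metis
    have fin: "finite K" using K finite_simple finite_subset by blast
    then have e: "v - of_int (c b) *\<^sub>R b = (\<Sum>b\<in>K. of_int (c b) *\<^sub>R b)" using c(1) L by simp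
    have "coweight a \<bullet> (v - of_int (c b) *\<^sub>R b) = of_int (c a)" if "a \<in> K" for a
    proof -
      have "coweight a \<bullet> (\<Sum>b\<in>K. of_int (c b) *\<^sub>R b) = (\<Sum>b\<in>K. if b = a then of_int (c b) else 0)"
        using K by (auto simp: inner_sum_right coweight_simple subset_iff intro!: sum.cong)
      then show ?thesis using e that fin by simp
    qed
    moreover have "v - of_int (c b) *\<^sub>R b \<in> span K" unfolding e by (intro span_sum span_scale span_base)
    ultimately show ?thesis using c(2) unfolding coherent_def by (intro exI[of _ "c b"]) auto
  qed
  ultimately show ?R by blast
next
  assume R: ?R
  then have nb: "b \<notin> span K" by blast
  obtain q where q: "\<And>x. x \<in> insert b K \<Longrightarrow> q \<bullet> x = 1"
    using exists_dual_vector[OF independent_insert_simple[OF K nb], of "\<lambda>_. 1"] by blast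
  have "\<bar>q \<bullet> v\<bar> \<ge> 1" if v: "v \<in> \<Phi>" "v \<in> span (insert b K)" for v
  proof -
    obtain m :: int where m: "v - of_int m *\<^sub>R b \<in> span K"
      "m \<ge> 0 \<and> (\<forall>a\<in>K. coweight a \<bullet> (v - of_int m *\<^sub>R b) \<ge> 0) \<or>
       m \<le> 0 \<and> (\<forall>a\<in>K. coweight a \<bullet> (v - of_int m *\<^sub>R b) \<le> 0)" using R v unfolding coherent_def by blast
    define u where "u = v - of_int m *\<^sub>R b"
    have u: "u = (\<Sum>a\<in>K. (coweight a \<bullet> u) *\<^sub>R a)" using span_simple_subset_expand[OF K] m(1) u_def by blast
    then have "q \<bullet> u = q \<bullet> (\<Sum>a\<in>K. (coweight a \<bullet> u) *\<^sub>R a)" by simp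
    then have qu: "q \<bullet> u = (\<Sum>a\<in>K. coweight a \<bullet> u)" using q by (simp add: inner_sum_right)
    have qv: "q \<bullet> v = of_int m + (\<Sum>a\<in>K. coweight a \<bullet> u)"
      using qu q[of b] by (simp add: u_def inner_diff_right)
    have int: "coweight a \<bullet> u \<in> \<int>" if "a \<in> K" for a
      unfolding u_def inner_diff_right inner_scaleR_right
      using root_coords(2) v(1) b that K by (intro Ints_diff Ints_mult) auto
    then obtain k :: int where k: "(\<Sum>a\<in>K. coweight a \<bullet> u) = of_int k" using Ints_sum Ints_cases by metis
    have "q \<bullet> v \<noteq> 0"
    proof
      assume 0: "q \<bullet> v = 0"
      have fin: "finite K" using K finite_simple finite_subset by blast
      have "m = 0 \<and> (\<forall>a\<in>K. coweight a \<bullet> u = 0)" using m(2)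
      proof
        assume *: "m \<ge> 0 \<and> (\<forall>a\<in>K. coweight a \<bullet> (v - of_int m *\<^sub>R b) \<ge> 0)"
        then have "(\<Sum>a\<in>K. coweight a \<bullet> u) \<ge> 0" unfolding u_def by (intro sum_nonneg) auto
        then have "m = 0" "(\<Sum>a\<in>K. coweight a \<bullet> u) = 0" using 0 qv * by linarith+
        then show ?thesis using * fin unfolding u_def by (simp add: sum_nonneg_eq_0_iff)
      next
        assume *: "m \<le> 0 \<and> (\<forall>a\<in>K. coweight a \<bullet> (v - of_int m *\<^sub>R b) \<le> 0)"
        then have "(\<Sum>a\<in>K. coweight a \<bullet> u) \<le> 0" unfolding u_def by (intro sum_nonpos) auto
        then have "m = 0" "(\<Sum>a\<in>K. coweight a \<bullet> u) = 0" using 0 qv * by linarith+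
        moreover from this have "(\<Sum>a\<in>K. - (coweight a \<bullet> u)) = 0" by (simp add: sum_negf)
        then have "\<forall>a\<in>K. - (coweight a \<bullet> u) = 0"
          using * fin unfolding u_def by (subst (asm) sum_nonneg_eq_0_iff) auto
        ultimately show ?thesis by simp
      qed
      moreover from this have "(\<Sum>a\<in>K. (coweight a \<bullet> u) *\<^sub>R a) = 0" by (intro sum.neutral) auto
      ultimately have "v = 0" using u[symmetric] by (simp add: u_def)
      then show False using v(1) root_nonzero by blast
    qed
    moreover have e: "q \<bullet> v = of_int (m + k)" using qv k by simp
    ultimately have "m + k \<noteq> 0" by (metis of_int_0)
    then have "1 \<le> \<bar>m + k\<bar>" by linarith
    then have "(1::real) \<le> of_int \<bar>m + k\<bar>" by (simp only: of_int_1_le_iff)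
    then show ?thesis unfolding e by (simp only: of_int_abs)
  qed
  then have "parabolic_base (insert b K)"
    using parabolic_base_criterion[of "insert b K" q] q b K simple_root by blast
  then show ?L using nb span_base by blast
qed

text \<open>
  If all simple roots have squared length \<open>N\<close>, then all values of the quadratic form on the root lattice are
  integral multiples of \<open>N\<close>.
\<close>
lemma simply_laced_norm_ge:
  assumes N: "\<And>a. a \<in> \<Delta> \<Longrightarrow> a \<bullet> a = N" and v: "integral_vector v" "v \<noteq> 0"
  shows "v \<bullet> v \<ge> N"
proof -
  have quad: "\<exists>k::int. (\<Sum>a\<in>S. c a *\<^sub>R a) \<bullet> (\<Sum>a\<in>S. c a *\<^sub>R a) = N * of_int k"
    if "S \<subseteq> \<Delta>" "\<And>a. a \<in> S \<Longrightarrow> c a \<in> \<int>" for S and c :: "'a \<Rightarrow> real"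
    using finite_subset[OF that(1) finite_simple] that
  proof (induction S rule: finite_induct)
    case empty
    show ?case by (intro exI[of _ 0]) simp
  next
    case (insert x S)
    let ?u = "\<Sum>a\<in>S. c a *\<^sub>R a"
    obtain k :: int where k: "?u \<bullet> ?u = N * of_int k" using insert by auto
    obtain d :: int where d: "c x = of_int d" using insert.prems(2)[of x] by (auto elim: Ints_cases)
    have x: "x \<in> \<Delta>" using insert.prems by auto
    have N0: "N \<noteq> 0" using N[OF x] simple_nonzero[OF x] by auto
    have "2 * (?u \<bullet> x) / N = (\<Sum>a\<in>S. c a * (2 * (a \<bullet> x) / (x \<bullet> x)))"
      using N[OF x] by (simp add: inner_sum_left sum_distrib_left sum_divide_distrib algebra_simps)
    also have "\<dots> \<in> \<int>"
      using insert.prems cartan_Ints simple_root x by (intro Ints_sum Ints_mult) auto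
    finally obtain e :: int where "2 * (?u \<bullet> x) / N = of_int e" by (auto elim: Ints_cases)
    then have e: "2 * (?u \<bullet> x) = N * of_int e" using N0 by (simp add: field_simps)
    have "(\<Sum>a\<in>insert x S. c a *\<^sub>R a) = c x *\<^sub>R x + ?u" using insert.hyps by simp
    then have "(\<Sum>a\<in>insert x S. c a *\<^sub>R a) \<bullet> (\<Sum>a\<in>insert x S. c a *\<^sub>R a)
      = c x * c x * (x \<bullet> x) + c x * (2 * (?u \<bullet> x)) + ?u \<bullet> ?u"
      by (simp add: inner_add_left inner_add_right inner_commute algebra_simps)
    also have "\<dots> = N * of_int (d * d + d * e + k)"
      unfolding e k d N[OF x] by (simp add: algebra_simps)
    finally show ?case by blast
  qed
  have "v = (\<Sum>a\<in>\<Delta>. (coweight a \<bullet> v) *\<^sub>R a)" using span_simple_expand v by (simp add: integral_vector_def)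
  then obtain k :: int where k: "v \<bullet> v = N * of_int k"
    using quad[of \<Delta> "\<lambda>a. coweight a \<bullet> v"] v(1) by (auto simp: integral_vector_def)
  have "v \<bullet> v > 0" using v(2) by simp
  moreover have "N > 0"
  proof (rule ccontr)
    assume "\<not> N > 0"
    then have "\<Delta> = {}" using N simple_nonzero by (metis equals0I inner_gt_zero_iff)
    moreover have "v \<in> span \<Delta>" using v(1) by (simp add: integral_vector_def)
    ultimately show False using v(2) by simp
  qed
  ultimately have "k \<ge> 1" using k by (simp add: zero_less_mult_iff)
  then have "N * 1 \<le> N * of_int k" using \<open>N > 0\<close> by (intro mult_left_mono) auto
  then show ?thesis using k by simp
qed

lemma integral_combination:
  assumes "K \<subseteq> \<Delta>" "\<And>a. a \<in> K \<Longrightarrow> c a \<in> \<int>"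
  shows "integral_vector (\<Sum>a\<in>K. c a *\<^sub>R a)"
proof -
  have fin: "finite K" using assms finite_simple finite_subset by blast
  have "coweight b \<bullet> (\<Sum>a\<in>K. c a *\<^sub>R a) = (\<Sum>a\<in>K. if a = b then c a else 0)" if "b \<in> \<Delta>" for b
    using assms(1) by (auto simp: inner_sum_right coweight_simple subset_iff intro!: sum.cong)
  moreover have "(\<Sum>a\<in>K. c a *\<^sub>R a) \<in> span \<Delta>"
    using assms(1) by (intro span_sum span_scale span_base) auto
  ultimately show ?thesis unfolding integral_vector_def using assms fin by auto
qed

text \<open>
  The second condition says that the coefficients of \<open>b\<close> outside \<open>K\<close> are coprime; it forces the multiple
  of \<open>b\<close> in any root of the span to be integral. Suppose that \<open>v = m b + p - n\<close> is such a root with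
  \<open>m > 0\<close>, where \<open>p\<close> and \<open>n\<close> are nonnegative combinations of disjoint parts of \<open>K\<close>. The product of
  \<open>m b + p\<close> with \<open>n\<close> is nonpositive, so \<open>N = |v|\<^sup>2 \<ge> |m b + p|\<^sup>2 + |n|\<^sup>2\<close>. If \<open>n \<noteq> 0\<close>, then \<open>|n|\<^sup>2 \<ge> N\<close> and
  \<open>m b + p\<close> would vanish.
\<close>
lemma simply_laced_parabolic_base_insert_iff:
  assumes N: "\<And>v. v \<in> \<Phi> \<Longrightarrow> v \<bullet> v = N" and K: "K \<subseteq> \<Delta>" and b: "b \<in> \<Phi>"
  shows "b \<notin> K \<and> parabolic_base (insert b K) \<longleftrightarrow> (\<forall>a\<in>K. b \<bullet> a \<le> 0) \<and>
    (\<forall>t::real. (\<forall>a\<in>\<Delta> - K. t * (coweight a \<bullet> b) \<in> \<int>) \<longrightarrow> t \<in> \<int>)" (is "?L \<longleftrightarrow> ?R")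
proof
  assume L: ?L
  have "b \<bullet> a \<le> 0" if "a \<in> K" for a using parabolic_base_obtuse[of "insert b K" b a] L that by auto
  moreover have "t \<in> \<int>" if t: "\<forall>a\<in>\<Delta> - K. t * (coweight a \<bullet> b) \<in> \<int>" for t :: real
  proof -
    \<comment> \<open>a lattice vector in the span, equal to \<open>t b\<close> modulo \<open>span K\<close>\<close>
    define y where "y = (\<Sum>a\<in>\<Delta> - K. (t * (coweight a \<bullet> b)) *\<^sub>R a)"
    have y: "integral_vector y" unfolding y_def using t by (intro integral_combination) auto
    have "b = (\<Sum>a\<in>\<Delta>. (coweight a \<bullet> b) *\<^sub>R a)" using root_expand[OF b] .
    also have "\<dots> = (\<Sum>a\<in>\<Delta> - K. (coweight a \<bullet> b) *\<^sub>R a) + (\<Sum>a\<in>K. (coweight a \<bullet> b) *\<^sub>R a)"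
      using sum.subset_diff[OF K finite_simple] .
    finally have "b = (\<Sum>a\<in>\<Delta> - K. (coweight a \<bullet> b) *\<^sub>R a) + (\<Sum>a\<in>K. (coweight a \<bullet> b) *\<^sub>R a)" .
    from arg_cong[OF this, of "\<lambda>x. t *\<^sub>R x"]
    have "t *\<^sub>R b = t *\<^sub>R (\<Sum>a\<in>\<Delta> - K. (coweight a \<bullet> b) *\<^sub>R a) + t *\<^sub>R (\<Sum>a\<in>K. (coweight a \<bullet> b) *\<^sub>R a)"
      unfolding scaleR_add_right .
    moreover have "y = t *\<^sub>R (\<Sum>a\<in>\<Delta> - K. (coweight a \<bullet> b) *\<^sub>R a)"
      unfolding y_def by (simp add: scaleR_sum_right)
    ultimately have "y = t *\<^sub>R b - t *\<^sub>R (\<Sum>a\<in>K. (coweight a \<bullet> b) *\<^sub>R a)" by simp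
    moreover have "(\<Sum>a\<in>K. (coweight a \<bullet> b) *\<^sub>R a) \<in> span (insert b K)" by (intro span_sum span_scale span_base) simp
    ultimately have "y \<in> span (insert b K)" by (simp add: span_diff span_scale span_base)
    then obtain c :: "'a \<Rightarrow> int" where c: "y = (\<Sum>b\<in>insert b K. of_int (c b) *\<^sub>R b)"
      using parabolic_base_coords[OF conjunct2[OF L] y] by metis
    obtain a where a: "a \<in> \<Delta> - K" "coweight a \<bullet> b \<noteq> 0"
      using off_coordinate[OF K b parabolic_base_insert_notin_span] L by blast
    have fin: "finite K" using K finite_simple finite_subset by blast
    have "coweight a \<bullet> (\<Sum>b\<in>K. of_int (c b) *\<^sub>R b) = 0"
      using simple_coords_span[OF K _ a(1)] by (simp add: span_sum span_scale span_base)
    then have "coweight a \<bullet> y = of_int (c b) * (coweight a \<bullet> b)"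
      using c L fin by (simp add: inner_add_right)
    moreover have "coweight a \<bullet> y = t * (coweight a \<bullet> b)"
    proof -
      have "coweight a \<bullet> y = (\<Sum>x\<in>\<Delta> - K. if x = a then t * (coweight x \<bullet> b) else 0)"
        unfolding y_def by (auto simp: inner_sum_right coweight_simple intro!: sum.cong)
      then show ?thesis using a finite_simple by simp
    qed
    ultimately show ?thesis using a(2) by simp
  qed
  ultimately show ?R by blast
next
  assume R: ?R
  have nb: "b \<notin> span K"
  proof
    assume "b \<in> span K"
    then have "\<forall>a\<in>\<Delta> - K. 1/2 * (coweight a \<bullet> b) \<in> \<int>" using simple_coords_span[OF K] by simp
    then have "(1/2::real) \<in> \<int>" using R by blast
    then show False by (auto elim!: Ints_cases simp: field_simps)
  qed
  have posc: "\<forall>a\<in>K. coweight a \<bullet> (v - of_int m *\<^sub>R b) \<ge> 0"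
    if v: "v \<in> \<Phi>" and vm: "v - of_int m *\<^sub>R b \<in> span K" and m: "m > 0" for v and m :: int
  proof -
    define u where "u = v - of_int m *\<^sub>R b"
    define p n where "p = (\<Sum>a\<in>K. max (coweight a \<bullet> u) 0 *\<^sub>R a)"
      and "n = (\<Sum>a\<in>K. max (- (coweight a \<bullet> u)) 0 *\<^sub>R a)"
    have int: "coweight a \<bullet> u \<in> \<int>" if "a \<in> K" for a
      unfolding u_def inner_diff_right inner_scaleR_right
      using root_coords(2) v(1) b that K by (intro Ints_diff Ints_mult) auto
    have u: "u = p - n"
    proof -
      have "u = (\<Sum>a\<in>K. (coweight a \<bullet> u) *\<^sub>R a)" using span_simple_subset_expand[OF K] vm u_def by blast
      also have "\<dots> = p - n" unfolding p_def n_def sum_subtractf[symmetric] scaleR_diff_left[symmetric]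
        by (intro sum.cong) (auto simp: max_def)
      finally show ?thesis .
    qed
    have pK: "p \<in> span K" unfolding p_def by (intro span_sum span_scale span_base)
    have iz: "integral_vector n" unfolding n_def
      using int by (intro integral_combination[OF K]) (auto simp: max_def)
    have bn: "b \<bullet> n \<le> 0" unfolding n_def inner_sum_right
      using R by (intro sum_nonpos) (auto simp: mult_nonneg_nonpos)
    have pn: "p \<bullet> n \<le> 0" unfolding n_def p_def inner_sum_right inner_sum_left
    proof (intro sum_nonpos)
      fix a c assume ac: "a \<in> K" "c \<in> K"
      show "max (coweight c \<bullet> u) 0 *\<^sub>R c \<bullet> max (- (coweight a \<bullet> u)) 0 *\<^sub>R a \<le> 0"
      proof (cases "a = c")
        case True
        then show ?thesis by (auto simp: max_def)
      next
        case False
        then have "c \<bullet> a \<le> 0" using simple_obtuse ac K by blast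
        then show ?thesis by (auto simp: mult_nonneg_nonpos max_def)
      qed
    qed
    let ?w = "of_int m *\<^sub>R b + p"
    have vw: "v = ?w - n" using u by (simp add: u_def algebra_simps)
    have "n = 0"
    proof (rule ccontr)
      assume "n \<noteq> 0"
      have Nn: "n \<bullet> n \<ge> N" using simply_laced_norm_ge[OF N[OF simple_root] iz \<open>n \<noteq> 0\<close>] .
      have wn: "?w \<bullet> n \<le> 0"
        using bn pn m by (auto simp: inner_add_left intro!: add_nonpos_nonpos mult_nonneg_nonpos)
      have "v \<bullet> v = ?w \<bullet> ?w - 2 * (?w \<bullet> n) + n \<bullet> n"
        unfolding vw by (simp add: inner_diff_left inner_diff_right inner_commute)
      then have "?w \<bullet> ?w \<le> 0" using N[OF v] Nn wn by linarith
      then have "?w = 0" by (metis inner_gt_zero_iff not_less)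
      then have "of_int m *\<^sub>R b = - p" by (simp add: add_eq_0_iff2)
      then have "(1 / of_int m) *\<^sub>R (of_int m *\<^sub>R b) \<in> span K" using pK span_neg span_scale by metis
      moreover have "(1 / of_int m) *\<^sub>R (of_int m *\<^sub>R b) = b" using m by simp
      ultimately show False using nb by simp
    qed
    then have "coweight a \<bullet> u \<ge> 0" if "a \<in> K" for a
    proof -
      have "coweight a \<bullet> u = coweight a \<bullet> p" using u \<open>n = 0\<close> by simp
      also have "\<dots> = (\<Sum>x\<in>K. if x = a then max (coweight x \<bullet> u) 0 else 0)"
        unfolding p_def using K by (auto simp: inner_sum_right coweight_simple subset_iff intro!: sum.cong)
      also have "\<dots> \<ge> 0" by (intro sum_nonneg) auto
      finally show ?thesis .
    qed
    then show ?thesis by (simp add: u_def)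
  qed
  have "coherent K b v"
    if v: "v \<in> \<Phi>" "v \<in> span (insert b K)" for v
  proof -
    obtain t where t: "v - t *\<^sub>R b \<in> span K" using span_breakdown_eq v(2) by blast
    have "t * (coweight a \<bullet> b) \<in> \<int>" if a: "a \<in> \<Delta> - K" for a
    proof -
      have "coweight a \<bullet> v - t * (coweight a \<bullet> b) = 0"
        using simple_coords_span[OF K t a] by (simp add: inner_diff_right)
      then show ?thesis using root_coords(2)[OF v(1), of a] a by auto
    qed
    then obtain m :: int where m: "t = of_int m" using R by (meson Ints_cases)
    have tm: "v - of_int m *\<^sub>R b \<in> span K" using t m by simp
    consider "m > 0" | "m = 0" | "m < 0" by linarith
    then show ?thesis
    proof cases
      case 1
      then show ?thesis using posc[OF v(1) tm] tm unfolding coherent_def by (intro exI[of _ m]) auto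
    next
      case 2
      then show ?thesis using root_coords(3)[OF v(1)] tm K unfolding coherent_def by (intro exI[of _ m]) auto
    next
      case 3
      have "- v - of_int (- m) *\<^sub>R b = - (v - of_int m *\<^sub>R b)" by simp
      then have "- v - of_int (- m) *\<^sub>R b \<in> span K" using tm span_neg by metis
      then have "\<forall>a\<in>K. coweight a \<bullet> (- v - of_int (- m) *\<^sub>R b) \<ge> 0"
        using posc[OF uminus_root[OF v(1)], of "- m"] 3 by auto
      then show ?thesis using tm 3 unfolding coherent_def by (intro exI[of _ m]) (auto simp: inner_diff_right)
    qed
  qed
  then show ?L using parabolic_base_insert_iff[OF K b] nb by blast
qed

end

section \<open>Integer coordinates\<close>

fun dotp :: "int list \<Rightarrow> int list \<Rightarrow> int" where
  "dotp (x # xs) (y # ys) = x * y + dotp xs ys"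
| "dotp _ _ = 0"

definition mat_vec :: "int list list \<Rightarrow> int list \<Rightarrow> int list" where
  "mat_vec G c = map (\<lambda>r. dotp r c) G"

definition indicator_list :: "bool list \<Rightarrow> int list" where
  "indicator_list J = map (\<lambda>b. if b then 1 else 0) J"

fun select :: "bool list \<Rightarrow> int list \<Rightarrow> int list" where
  "select (b # bs) (x # xs) = (if b then x else 0) # select bs xs"
| "select _ _ = []"

text \<open>
  The moments of the roots selected by \<open>J\<close>, together with the root with coordinates \<open>b\<close>, where \<open>h\<close> lists the
  products of the simple roots with the sum of all these roots. The offset \<open>k\<close> of the cardinality is 1 if
  \<open>b\<close> counts as an element; for \<open>b = 0\<close> and \<open>k = 0\<close> only the selected roots remain.
\<close>
definition list_moments :: "int list list \<Rightarrow> int \<Rightarrow> bool list \<Rightarrow> int list \<Rightarrow> int list \<Rightarrow> int \<times> int \<times> int" where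
  "list_moments G k J b h = (let r = dotp h b; m = select J h; t = map2 (\<lambda>x y. x + r * y) m b
     in (k + sum_list (indicator_list J), sum_list (map (\<lambda>x. x * x * x) m) + r * r * r, dotp (mat_vec G t) t))"

definition simple_moments :: "int list list \<Rightarrow> bool list \<Rightarrow> int \<times> int \<times> int" where
  "simple_moments G J = list_moments G 0 J (map (\<lambda>_. 0) J) (mat_vec G (indicator_list J))"

fun nonpos_on :: "bool list \<Rightarrow> int list \<Rightarrow> bool" where
  "nonpos_on (b # bs) (x # xs) = (if b \<and> x > 0 then False else nonpos_on bs xs)"
| "nonpos_on _ _ = True"

fun zero_off :: "bool list \<Rightarrow> int list \<Rightarrow> bool" where
  "zero_off (b # bs) (x # xs) = (if b \<or> x = 0 then zero_off bs xs else False)"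
| "zero_off _ _ = True"

fun off_gcd :: "bool list \<Rightarrow> int list \<Rightarrow> int" where
  "off_gcd (b # bs) (x # xs) = (if b then off_gcd bs xs else gcd x (off_gcd bs xs))"
| "off_gcd _ _ = 0"

text \<open>
  The entries of both lists at the first unselected position where the first list is nonzero; the quotient is
  the only possible factor between the unselected parts.
\<close>
fun off_pivot :: "bool list \<Rightarrow> int list \<Rightarrow> int list \<Rightarrow> int \<times> int" where
  "off_pivot (b # bs) (x # xs) (y # ys) = (if b \<or> x = 0 then off_pivot bs xs ys else (x, y))"
| "off_pivot _ _ _ = (0, 0)"

definition unit_list :: "nat \<Rightarrow> nat \<Rightarrow> int list" where
  "unit_list n i = (replicate n 0)[i := 1]"

definition reflect_list :: "int list list \<Rightarrow> nat \<Rightarrow> int list \<Rightarrow> int list" where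
  "reflect_list Ct i c = c[i := c ! i - dotp (Ct ! i) c]"

fun check_heights :: "nat \<Rightarrow> int \<Rightarrow> int list list list \<Rightarrow> bool" where
  "check_heights n k [] = True"
| "check_heights n k (L # Ls) \<longleftrightarrow>
     list_all (\<lambda>c. length c = n \<and> sum_list c = k \<and> list_all (\<lambda>x. 0 \<le> x) c) L \<and> distinct L \<and>
     check_heights n (k + 1) Ls"

text \<open>
  Levels contain the positive roots of increasing height, so a reflection that raises the height leads to a
  later level.
\<close>
fun check_closed :: "int list list \<Rightarrow> int list list list \<Rightarrow> bool" where
  "check_closed Ct [] = True"
| "check_closed Ct (L # Ls) \<longleftrightarrow>
     list_all (\<lambda>c. list_all (\<lambda>i. if dotp (Ct ! i) c < 0
       then list_ex (\<lambda>M. reflect_list Ct i c \<in> set M) Ls else True) [0..<length Ct]) L \<and>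
     check_closed Ct Ls"

fun check_reached :: "int list list \<Rightarrow> int list list list \<Rightarrow> int list list list \<Rightarrow> bool" where
  "check_reached Ct Ms [] = True"
| "check_reached Ct Ms (L # Ls) \<longleftrightarrow>
     list_all (\<lambda>c. list_ex (\<lambda>i. if dotp (Ct ! i) c > 0
       then list_ex (\<lambda>M. reflect_list Ct i c \<in> set M) Ms else False) [0..<length Ct]) L \<and>
     check_reached Ct (L # Ms) Ls"

fun check_roots :: "int list list \<Rightarrow> int list list list \<Rightarrow> bool" where
  "check_roots Ct [] = False"
| "check_roots Ct (L # Ls) \<longleftrightarrow> L = map (unit_list (length Ct)) [0..<length Ct] \<and>
     check_heights (length Ct) 1 (L # Ls) \<and> check_closed Ct (L # Ls) \<and> check_reached Ct [L] Ls"

definition signed_list :: "int list list list \<Rightarrow> int list list list" where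
  "signed_list Ls = map (\<lambda>L. concat (map (\<lambda>c. [c, map uminus c]) L)) Ls"

text \<open>
  Each root is paired with its products with the simple roots, so that the searches through all roots
  do not recompute them.
\<close>
definition with_products :: "int list list \<Rightarrow> int list list list \<Rightarrow> (int list \<times> int list) list list" where
  "with_products G Ls = map (map (\<lambda>c. (c, mat_vec G c))) Ls"

lemma length_mat_vec [simp]: "length (mat_vec G c) = length G"
  by (simp add: mat_vec_def)

lemma nth_mat_vec: "i < length G \<Longrightarrow> mat_vec G c ! i = dotp (G ! i) c"
  by (simp add: mat_vec_def)

lemma length_indicator_list [simp]: "length (indicator_list J) = length J"
  by (simp add: indicator_list_def)

lemma nth_indicator_list: "i < length J \<Longrightarrow> indicator_list J ! i = (if J ! i then 1 else 0)"
  by (simp add: indicator_list_def)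

lemma dotp_eq_sum: "length xs = length ys \<Longrightarrow> dotp xs ys = (\<Sum>i<length xs. xs ! i * ys ! i)"
  by (induction xs ys rule: list_induct2) (simp_all add: sum.lessThan_Suc_shift del: sum.lessThan_Suc)

lemma select_eq_map2: "length J = length xs \<Longrightarrow> select J xs = map2 (\<lambda>b x. if b then x else 0) J xs"
  by (induction J xs rule: list_induct2) auto

lemma length_select: "length J = length xs \<Longrightarrow> length (select J xs) = length J"
  by (simp add: select_eq_map2)

lemma nth_select: "length J = length xs \<Longrightarrow> i < length J \<Longrightarrow> select J xs ! i = (if J ! i then xs ! i else 0)"
  by (simp add: select_eq_map2)

lemma nonpos_on_iff: "length J = length xs \<Longrightarrow> nonpos_on J xs \<longleftrightarrow> (\<forall>i<length J. J ! i \<longrightarrow> xs ! i \<le> 0)"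
  by (induction J xs rule: list_induct2) (auto simp: All_less_Suc2)

lemma zero_off_iff: "length J = length xs \<Longrightarrow> zero_off J xs \<longleftrightarrow> (\<forall>i<length J. \<not> J ! i \<longrightarrow> xs ! i = 0)"
  by (induction J xs rule: list_induct2) (auto simp: All_less_Suc2)

lemma off_gcd_nonneg: "off_gcd J xs \<ge> 0"
  by (induction J xs rule: off_gcd.induct) auto

lemma off_gcd_dvd:
  "length J = length xs \<Longrightarrow> i < length J \<Longrightarrow> \<not> J ! i \<Longrightarrow> off_gcd J xs dvd xs ! i"
proof (induction J xs arbitrary: i rule: list_induct2)
  case (Cons b J x xs)
  then show ?case
    by (cases i) (auto intro: dvd_trans[OF gcd_dvd2])
qed simp

lemma Ints_mult_gcd:
  assumes "t * of_int a \<in> \<int>" "t * of_int b \<in> \<int>" shows "(t::real) * of_int (gcd a b) \<in> \<int>"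
proof -
  obtain u v where "u * a + v * b = gcd a b" using bezout_int by blast
  then have "t * of_int (gcd a b) = of_int u * (t * of_int a) + of_int v * (t * of_int b)"
    by (metis (no_types, lifting) distrib_left mult.commute mult.left_commute of_int_add of_int_mult)
  then show ?thesis using assms by (metis Ints_add Ints_mult Ints_of_int)
qed

lemma Ints_mult_off_gcd:
  assumes "length J = length xs" "\<And>i. i < length J \<Longrightarrow> \<not> J ! i \<Longrightarrow> (t::real) * of_int (xs ! i) \<in> \<int>"
  shows "t * of_int (off_gcd J xs) \<in> \<int>"
  using assms
proof (induction J xs rule: list_induct2)
  case (Cons b J x xs)
  have "t * of_int (off_gcd J xs) \<in> \<int>" 
  proof (rule Cons.IH)
    fix i assume "i < length J" "\<not> J ! i"
    then show "t * of_int (xs ! i) \<in> \<int>" using Cons.prems[of "Suc i"] by simp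
  qed
  moreover have "t * of_int x \<in> \<int>" if "\<not> b" using Cons.prems[of 0] that by simp
  ultimately show ?case using Ints_mult_gcd by auto
qed simp

text \<open>
  Coprimality in the form needed for \<open>simply_laced_parabolic_base_insert_iff\<close>.
\<close>
lemma off_gcd_eq_1_iff:
  assumes "length J = length xs"
  shows "off_gcd J xs = 1 \<longleftrightarrow>
    (\<forall>t::real. (\<forall>i<length J. \<not> J ! i \<longrightarrow> t * of_int (xs ! i) \<in> \<int>) \<longrightarrow> t \<in> \<int>)" (is "?L \<longleftrightarrow> ?R")
proof
  assume L: ?L
  show ?R
  proof (intro allI impI)
    fix t :: real assume "\<forall>i<length J. \<not> J ! i \<longrightarrow> t * of_int (xs ! i) \<in> \<int>"
    then have "t * of_int (off_gcd J xs) \<in> \<int>" using Ints_mult_off_gcd[OF assms, of t] by simp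
    then show "t \<in> \<int>" using L by simp
  qed
next
  assume R: ?R
  let ?d = "off_gcd J xs"
  show ?L
  proof (rule ccontr)
    assume n1: "?d \<noteq> 1"
    \<comment> \<open>if \<open>d = 0\<close>, then all entries vanish and any non-integral \<open>t\<close> is a counterexample\<close>
    define t :: real where "t = (if ?d = 0 then 1 / 2 else 1 / of_int ?d)"
    have "t * of_int (xs ! i) \<in> \<int>" if "i < length J" "\<not> J ! i" for i
      using off_gcd_dvd[OF assms that] by (auto simp: t_def elim!: dvdE)
    then have "t \<in> \<int>" using R by blast
    then obtain k :: int where k: "t = of_int k" by (auto elim: Ints_cases)
    have t: "0 < t" "t < 1" using n1 off_gcd_nonneg[of J xs] by (auto simp: t_def divide_less_eq)
    then have "0 < k" "k < 1" using k by simp_all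
    then show False by linarith
  qed
qed

lemma off_pivot_cases:
  assumes "length J = length xs" "length xs = length ys"
  shows "(off_pivot J xs ys = (0, 0) \<and> (\<forall>i<length J. \<not> J ! i \<longrightarrow> xs ! i = 0)) \<or>
    (\<exists>p<length J. \<not> J ! p \<and> xs ! p \<noteq> 0 \<and> off_pivot J xs ys = (xs ! p, ys ! p))"
  using assms
proof (induction J xs ys rule: list_induct3)
  case (Cons b J x xs y ys)
  show ?case
  proof (cases "b \<or> x = 0")
    case True
    from Cons.IH show ?thesis
    proof (elim disjE exE conjE)
      fix p assume "p < length J" "\<not> J ! p" "xs ! p \<noteq> 0" "off_pivot J xs ys = (xs ! p, ys ! p)"
      then show ?thesis using True by (intro disjI2 exI[of _ "Suc p"]) auto
    qed (use True in \<open>auto simp: All_less_Suc2\<close>)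
  next
    case False
    then show ?thesis by (intro disjI2 exI[of _ 0]) auto
  qed
qed simp

fun masks :: "nat \<Rightarrow> bool list list" where
  "masks 0 = [[]]"
| "masks (Suc n) = map (Cons True) (masks n) @ map (Cons False) (masks n)"

lemma set_masks: "set (masks n) = {J. length J = n}"
proof (induction n)
  case (Suc n)
  then show ?case by (auto simp: length_Suc_conv image_iff) 
qed auto

section \<open>Roots in simple coordinates\<close>

locale root_coordinates =
  fixes \<Phi> :: "'a::euclidean_space set" and \<alpha> :: "'a list" and G Ct :: "int list list" and s :: real
  assumes root_system: "root_system \<Phi>" and simple_system: "simple_system \<Phi> (set \<alpha>)"
    and distinct: "distinct \<alpha>" and s_pos: "s > 0"
    and length_G: "length G = length \<alpha>" "\<And>r. r \<in> set G \<Longrightarrow> length r = length \<alpha>"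
    and length_Ct: "length Ct = length \<alpha>" "\<And>r. r \<in> set Ct \<Longrightarrow> length r = length \<alpha>"
    and gram: "\<And>i j. i < length \<alpha> \<Longrightarrow> j < length \<alpha> \<Longrightarrow> \<alpha> ! i \<bullet> \<alpha> ! j = s * of_int (G ! i ! j)"
    and cartan: "\<And>i j. i < length \<alpha> \<Longrightarrow> j < length \<alpha> \<Longrightarrow> 2 * G ! j ! i = Ct ! i ! j * G ! i ! i"
begin

sublocale based_root_system \<Phi> "set \<alpha>"
  using root_system simple_system by unfold_locales

abbreviation n :: nat where "n \<equiv> length \<alpha>"

definition lincomb :: "int list \<Rightarrow> 'a" where
  "lincomb c = (\<Sum>i<n. of_int (c ! i) *\<^sub>R \<alpha> ! i)"

definition selected :: "bool list \<Rightarrow> 'a set" where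
  "selected J = {\<alpha> ! i | i. i < n \<and> J ! i}"

lemma nth_G: "i < n \<Longrightarrow> length (G ! i) = n" and nth_Ct: "i < n \<Longrightarrow> length (Ct ! i) = n"
  using length_G length_Ct by simp_all

lemma selected_subset: "selected J \<subseteq> set \<alpha>"
  by (auto simp: selected_def)

lemma nth_in_selected: "i < n \<Longrightarrow> \<alpha> ! i \<in> selected J \<longleftrightarrow> J ! i"
  using distinct by (auto simp: selected_def nth_eq_iff_index_eq)

lemma subset_eq_selected: "K \<subseteq> set \<alpha> \<Longrightarrow> K = selected (map (\<lambda>a. a \<in> K) \<alpha>)"
proof (intro equalityI subsetI)
  fix x assume "K \<subseteq> set \<alpha>" "x \<in> K"
  then obtain i where "i < n" "x = \<alpha> ! i" by (metis in_set_conv_nth subsetD)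
  then show "x \<in> selected (map (\<lambda>a. a \<in> K) \<alpha>)" using \<open>x \<in> K\<close> by (auto simp: selected_def)
qed (auto simp: selected_def)

lemma sum_selected: "(\<Sum>v\<in>selected J. f v) = (\<Sum>i<n. if J ! i then f (\<alpha> ! i) else 0)"
proof -
  have "selected J = (!) \<alpha> ` {i\<in>{..<n}. J ! i}" by (auto simp: selected_def)
  moreover have "inj_on ((!) \<alpha>) {i\<in>{..<n}. J ! i}" using distinct by (auto intro!: inj_onI simp: nth_eq_iff_index_eq)
  ultimately have "(\<Sum>v\<in>selected J. f v) = (\<Sum>i\<in>{i\<in>{..<n}. J ! i}. f (\<alpha> ! i))" by (simp add: sum.reindex)
  then show ?thesis by (simp only: sum.inter_filter[OF finite_lessThan])
qed

lemma finite_selected: "finite (selected J)"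
  using selected_subset finite_subset by blast

lemma coweight_lincomb: "i < n \<Longrightarrow> coweight (\<alpha> ! i) \<bullet> lincomb c = of_int (c ! i)"
proof -
  assume i: "i < n"
  have "coweight (\<alpha> ! i) \<bullet> lincomb c = (\<Sum>j<n. if j = i then of_int (c ! j) else 0)"
    unfolding lincomb_def inner_sum_right using i distinct
    by (intro sum.cong) (auto simp: coweight_simple nth_eq_iff_index_eq)
  then show ?thesis using i by simp
qed

lemma lincomb_inj: "length c = n \<Longrightarrow> length d = n \<Longrightarrow> lincomb c = lincomb d \<Longrightarrow> c = d"
  by (intro nth_equalityI) (metis coweight_lincomb of_int_eq_iff)+

lemma lincomb_add: "length c = n \<Longrightarrow> length d = n \<Longrightarrow> lincomb (map2 (\<lambda>x y. x + r * y) c d) = lincomb c + of_int r *\<^sub>R lincomb d"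
  by (simp add: lincomb_def sum.distrib[symmetric] scaleR_sum_right algebra_simps)

lemma lincomb_uminus: "length c = n \<Longrightarrow> lincomb (map uminus c) = - lincomb c"
  by (simp add: lincomb_def sum_negf[symmetric])

lemma lincomb_unit: "i < n \<Longrightarrow> lincomb (unit_list n i) = \<alpha> ! i"
proof -
  assume i: "i < n"
  have "lincomb (unit_list n i) = (\<Sum>j<n. if j = i then \<alpha> ! j else 0)"
    unfolding lincomb_def unit_list_def by (intro sum.cong) (auto simp: nth_list_update)
  then show ?thesis using i by simp
qed

lemma sum_selected_eq_lincomb: "length J = n \<Longrightarrow> \<Sum>(selected J) = lincomb (indicator_list J)"
  unfolding sum_selected lincomb_def by (intro sum.cong) (auto simp: nth_indicator_list)

lemma inner_simple_lincomb: "i < n \<Longrightarrow> length c = n \<Longrightarrow> \<alpha> ! i \<bullet> lincomb c = s * of_int (mat_vec G c ! i)"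
  unfolding lincomb_def inner_sum_right
  using length_G nth_G by (simp add: nth_mat_vec dotp_eq_sum gram sum_distrib_left algebra_simps)

lemma inner_lincomb: "length c = n \<Longrightarrow> length d = n \<Longrightarrow> lincomb d \<bullet> lincomb c = s * of_int (dotp (mat_vec G c) d)"
proof -
  assume l: "length c = n" "length d = n"
  have "lincomb d \<bullet> lincomb c = (\<Sum>i<n. of_int (d ! i) * (\<alpha> ! i \<bullet> lincomb c))" by (simp add: lincomb_def inner_sum_left)
  also have "\<dots> = (\<Sum>i<n. of_int (d ! i) * (s * of_int (mat_vec G c ! i)))"
    using inner_simple_lincomb l by (intro sum.cong) auto
  finally show ?thesis using l length_G by (simp add: dotp_eq_sum sum_distrib_left algebra_simps)
qed

lemma reflection_lincomb:
  assumes i: "i < n" and c: "length c = n"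
  shows "reflection (\<alpha> ! i) (lincomb c) = lincomb (reflect_list Ct i c)"
    and "2 * (lincomb c \<bullet> \<alpha> ! i) / (\<alpha> ! i \<bullet> \<alpha> ! i) = of_int (dotp (Ct ! i) c)"
proof -
  have "2 * mat_vec G c ! i = (\<Sum>j<n. (2 * G ! i ! j) * c ! j)"
    using i c length_G nth_G by (simp add: nth_mat_vec dotp_eq_sum sum_distrib_left algebra_simps)
  also have "\<dots> = (\<Sum>j<n. Ct ! i ! j * c ! j * G ! i ! i)"
  proof (intro sum.cong refl)
    fix j assume "j \<in> {..<n}"
    then have "of_int (G ! i ! j) = (of_int (G ! j ! i) :: real)"
      using gram[of i j] gram[of j i] i s_pos by (simp add: inner_commute)
    then show "2 * G ! i ! j * c ! j = Ct ! i ! j * c ! j * G ! i ! i"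
      using cartan[OF i, of j] \<open>j \<in> {..<n}\<close> by simp
  qed
  finally have e: "2 * mat_vec G c ! i = dotp (Ct ! i) c * G ! i ! i"
    using i c nth_Ct by (simp add: dotp_eq_sum sum_distrib_right)
  have "\<alpha> ! i \<bullet> \<alpha> ! i > 0" using simple_nonzero i by simp
  have "2 * (lincomb c \<bullet> \<alpha> ! i) = s * of_int (2 * mat_vec G c ! i)"
    using inner_simple_lincomb[OF i c] by (simp add: inner_commute)
  also have "\<dots> = of_int (dotp (Ct ! i) c) * (\<alpha> ! i \<bullet> \<alpha> ! i)" unfolding e gram[OF i i] by simp
  finally show q: "2 * (lincomb c \<bullet> \<alpha> ! i) / (\<alpha> ! i \<bullet> \<alpha> ! i) = of_int (dotp (Ct ! i) c)"
    using \<open>\<alpha> ! i \<bullet> \<alpha> ! i > 0\<close> by (simp add: nonzero_divide_eq_eq)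
  have "lincomb (reflect_list Ct i c) = (\<Sum>j<n. of_int (c ! j) *\<^sub>R \<alpha> ! j - (if j = i then of_int (dotp (Ct ! i) c) *\<^sub>R \<alpha> ! j else 0))"
    unfolding lincomb_def reflect_list_def using c by (intro sum.cong) (auto simp: nth_list_update algebra_simps)
  also have "\<dots> = lincomb c - of_int (dotp (Ct ! i) c) *\<^sub>R \<alpha> ! i"
    using i by (simp add: sum_subtractf lincomb_def)
  finally show "reflection (\<alpha> ! i) (lincomb c) = lincomb (reflect_list Ct i c)"
    unfolding reflection_def q by simp
qed

lemma check_heights_props:
  assumes "check_heights m k Ls"
  shows "distinct (concat Ls)"
    "\<And>c. c \<in> set (concat Ls) \<Longrightarrow> length c = m \<and> sum_list c \<ge> k \<and> (\<forall>x\<in>set c. x \<ge> 0)"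
proof -
  have "distinct (concat Ls) \<and> (\<forall>c\<in>set (concat Ls). length c = m \<and> sum_list c \<ge> k \<and> (\<forall>x\<in>set c. x \<ge> 0))"
    using assms
  proof (induction Ls arbitrary: k)
    case (Cons L Ls)
    then have L: "\<And>c. c \<in> set L \<Longrightarrow> length c = m \<and> sum_list c = k \<and> (\<forall>x\<in>set c. 0 \<le> x)" "distinct L"
      and IH: "distinct (concat Ls)" "\<forall>c\<in>set (concat Ls). length c = m \<and> sum_list c \<ge> k + 1 \<and> (\<forall>x\<in>set c. x \<ge> 0)"
      by (auto simp: list_all_iff)
    have "c \<notin> set (concat Ls)" if "c \<in> set L" for c
    proof
      assume "c \<in> set (concat Ls)"
      then have "sum_list c \<ge> k + 1" using IH(2) by blast
      then show False using L(1)[OF that] by simp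
    qed
    then have "distinct (concat (L # Ls))" using L(2) IH(1) by auto
    moreover have "length c = m \<and> sum_list c \<ge> k \<and> (\<forall>x\<in>set c. x \<ge> 0)" if "c \<in> set (concat (L # Ls))" for c
    proof (cases "c \<in> set L")
      case True
      then show ?thesis using L(1) by simp
    next
      case False
      then have "c \<in> set (concat Ls)" using that by simp
      then have "length c = m \<and> sum_list c \<ge> k + 1 \<and> (\<forall>x\<in>set c. x \<ge> 0)" using IH(2) by blast
      then show ?thesis by linarith
    qed
    ultimately show ?case by blast
  qed auto
  then show "distinct (concat Ls)"
    "\<And>c. c \<in> set (concat Ls) \<Longrightarrow> length c = m \<and> sum_list c \<ge> k \<and> (\<forall>x\<in>set c. x \<ge> 0)" by blast+
qed

lemma check_reached_root:
  assumes "check_reached Ct Ms Ls" "\<And>c. c \<in> set (concat Ms) \<Longrightarrow> length c = n \<and> lincomb c \<in> \<Phi>"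
    "\<And>c. c \<in> set (concat Ls) \<Longrightarrow> length c = n"
  shows "c \<in> set (concat Ls) \<Longrightarrow> lincomb c \<in> \<Phi>"
  using assms
proof (induction Ls arbitrary: Ms)
  case (Cons L Ls)
  have L: "lincomb d \<in> \<Phi>" if d: "d \<in> set L" for d
  proof -
    obtain i M where i: "i < n" and M: "M \<in> set Ms" "reflect_list Ct i d \<in> set M"
      using Cons.prems(2) d length_Ct(1) by (fastforce simp: list_all_iff list_ex_iff split: if_splits)
    have ld: "length d = n" using Cons.prems(4) d by auto
    have "lincomb (reflect_list Ct i d) \<in> \<Phi>" using Cons.prems(3) M by auto
    then have "reflection (\<alpha> ! i) (lincomb d) \<in> \<Phi>" using reflection_lincomb(1)[OF i ld] by simp
    then have "reflection (\<alpha> ! i) (reflection (\<alpha> ! i) (lincomb d)) \<in> \<Phi>" using reflection_root simple_root i by simp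
    then show ?thesis using reflection_reflection[OF simple_nonzero, of "\<alpha> ! i"] i by simp
  qed
  show ?case
  proof (cases "c \<in> set L")
    case False
    then show ?thesis
      using Cons.IH[of "L # Ms"] Cons.prems L by auto
  qed (use L in auto)
qed auto

lemma check_closed_reflect:
  assumes "check_closed Ct Ls" "c \<in> set (concat Ls)" "i < n" "dotp (Ct ! i) c < 0"
  shows "reflect_list Ct i c \<in> set (concat Ls)"
  using assms
proof (induction Ls)
  case (Cons L Ls)
  show ?case
  proof (cases "c \<in> set L")
    case True
    then show ?thesis
    proof -
      have "list_all (\<lambda>i. if dotp (Ct ! i) c < 0
        then list_ex (\<lambda>M. reflect_list Ct i c \<in> set M) Ls else True) [0..<n]"
        using Cons.prems(1) True length_Ct(1) by (simp add: list_all_iff)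
      then have "list_ex (\<lambda>M. reflect_list Ct i c \<in> set M) Ls"
        using Cons.prems(3,4) unfolding list_all_iff by fastforce
      then show ?thesis by (auto simp: list_ex_iff)
    qed
  next
    case False
    then show ?thesis using Cons by auto
  qed
qed auto

text \<open>
  The listed vectors are roots since each is a simple root or a reflection of an earlier one, and every
  positive root is listed by \<open>pos_root_induct\<close>.
\<close>
lemma roots_eq:
  assumes chk: "check_roots Ct Ls"
  shows "\<Phi> = lincomb ` set (concat (signed_list Ls))"
    "distinct (concat (signed_list Ls))"
    "\<And>c. c \<in> set (concat (signed_list Ls)) \<Longrightarrow> length c = n"
proof -
  obtain L Ls' where Ls: "Ls = L # Ls'" using chk by (cases Ls) auto
  have L: "L = map (unit_list n) [0..<n]" and h: "check_heights n 1 Ls" and cl: "check_closed Ct Ls"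
    and re: "check_reached Ct [L] Ls'"
    using chk unfolding Ls check_roots.simps length_Ct(1) by blast+
  note hp = check_heights_props[OF h]
  have unit: "length (unit_list n i) = n" for i by (simp add: unit_list_def)
  have R: "lincomb c \<in> \<Phi>" if "c \<in> set (concat Ls)" for c
  proof -
    have LR: "length c = n \<and> lincomb c \<in> \<Phi>" if "c \<in> set L" for c
      using that lincomb_unit simple_root unit unfolding L by auto
    then show ?thesis
      using check_reached_root[OF re, of c] that hp(2) unfolding Ls by auto
  qed
  have pos: "v \<in> lincomb ` set (concat Ls)" if "pos v" for v
    using that
  proof (induction v rule: pos_root_induct)
    case (simple a)
    then obtain i where "i < n" "a = \<alpha> ! i" by (auto simp: in_set_conv_nth)
    then show ?case using lincomb_unit[of i] unfolding Ls L by force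
  next
    case (reflect v a)
    obtain i where i: "i < n" "a = \<alpha> ! i" using reflect by (auto simp: in_set_conv_nth)
    obtain c where c: "c \<in> set (concat Ls)" "v = lincomb c" using reflect by blast
    have lc: "length c = n" using hp(2)[OF c(1)] by blast
    have "a \<bullet> a > 0" using simple_nonzero reflect(2) by simp
    then have "2 * (v \<bullet> a) / (a \<bullet> a) < 0" using reflect(3) by (simp add: divide_neg_pos)
    then have "dotp (Ct ! i) c < 0" using reflection_lincomb(2)[OF i(1) lc] i c by simp
    then have "reflect_list Ct i c \<in> set (concat Ls)" using check_closed_reflect[OF cl c(1) i(1)] by blast
    then show ?case using reflection_lincomb(1)[OF i(1) lc] i c by blast
  qed
  have conc: "set (concat (signed_list Ls)) = set (concat Ls) \<union> map uminus ` set (concat Ls)"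
    unfolding signed_list_def by auto
  show len: "length c = n" if "c \<in> set (concat (signed_list Ls))" for c
    using that hp(2) unfolding conc by (metis Un_iff image_iff length_map)
  show "\<Phi> = lincomb ` set (concat (signed_list Ls))"
  proof (intro equalityI subsetI)
    fix v assume v: "v \<in> \<Phi>"
    from pos_cases[OF this] show "v \<in> lincomb ` set (concat (signed_list Ls))"
    proof
      assume "pos v"
      then have "v \<in> lincomb ` set (concat Ls)" by (rule pos)
      then show ?thesis unfolding conc by blast
    next
      assume "pos (- v)"
      then obtain c where c: "c \<in> set (concat Ls)" "- v = lincomb c" using pos by blast
      then have "v = lincomb (map uminus c)" using lincomb_uminus[of c] hp(2)[OF c(1)] by (metis minus_minus)
      then show ?thesis using c(1) unfolding conc by blast
    qed
  next
    fix v assume "v \<in> lincomb ` set (concat (signed_list Ls))"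
    then obtain c where c: "c \<in> set (concat Ls)" "v = lincomb c \<or> v = lincomb (map uminus c)"
      unfolding conc by blast
    have "length c = n" using hp(2)[OF c(1)] by blast
    then show "v \<in> \<Phi>" using c(2) R[OF c(1)] uminus_root[OF R[OF c(1)]] lincomb_uminus[of c] by auto
  qed
  have sgn: "sum_list (map uminus c) = - sum_list c" for c :: "int list" by (induction c) auto
  have neg: "map uminus c \<notin> set (concat Ls)" if "c \<in> set (concat Ls)" for c
  proof
    assume m: "map uminus c \<in> set (concat Ls)"
    have "sum_list c \<ge> 1" "sum_list (map uminus c) \<ge> 1" using hp(2)[OF that] hp(2)[OF m] by blast+
    then show False using sgn[of c] by linarith
  qed
  have inj: "map uminus c = map uminus d \<Longrightarrow> c = d" for c d :: "int list"
    by (metis (no_types, lifting) list.inj_map_strong neg_equal_iff_equal)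
  have "distinct (concat (map (\<lambda>c. [c, map uminus c]) cs))"
    if "distinct cs" "\<And>c d. c \<in> set cs \<Longrightarrow> d \<in> set cs \<Longrightarrow> c \<noteq> map uminus d" for cs :: "int list list"
    using that
  proof (induction cs)
    case (Cons c cs)
    have "c \<notin> set cs" using Cons.prems(1) by simp
    moreover have "c \<noteq> map uminus c" using Cons.prems(2)[of c c] by simp
    moreover have "c \<noteq> map uminus d" "map uminus c \<noteq> d" "map uminus c \<noteq> map uminus d" if d: "d \<in> set cs" for d
    proof -
      show "c \<noteq> map uminus d" using Cons.prems(2)[of c d] d by simp
      show "map uminus c \<noteq> d" using Cons.prems(2)[of d c] d by auto
      show "map uminus c \<noteq> map uminus d" using inj[of c d] d Cons.prems(1) by auto
    qed
    ultimately have "c \<notin> set (map uminus c # concat (map (\<lambda>c. [c, map uminus c]) cs))"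
      "map uminus c \<notin> set (concat (map (\<lambda>c. [c, map uminus c]) cs))"
      by (auto simp del: map_eq_conv)
    moreover have "distinct (concat (map (\<lambda>c. [c, map uminus c]) cs))"
      using Cons.prems by (intro Cons.IH) auto
    ultimately show ?case by simp
  qed simp
  moreover have "concat (signed_list Ls) = concat (map (\<lambda>c. [c, map uminus c]) (concat Ls))"
    unfolding signed_list_def by (induction Ls) auto
  moreover have "c \<noteq> map uminus d" if "c \<in> set (concat Ls)" "d \<in> set (concat Ls)" for c d
    using neg that by blast
  ultimately show "distinct (concat (signed_list Ls))" using hp(1) by presburger
qed

end

section \<open>Checks for certificates\<close>

text \<open>
  The moments of all extensions of the selected roots by a root that passes the test \<open>T\<close>. Recursion inside
  the levels and then over the levels keeps the terms small that each rewriting step has to traverse.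
\<close>
fun extension_moments_level ::
  "(bool list \<Rightarrow> int list \<times> int list \<Rightarrow> bool) \<Rightarrow> int list list \<Rightarrow> bool list \<Rightarrow> int list \<Rightarrow>
   (int list \<times> int list) list \<Rightarrow> (int \<times> int \<times> int) list" where
  "extension_moments_level T G J h [] = []"
| "extension_moments_level T G J h (p # ps) =
     (if T J p then list_moments G 1 J (fst p) (map2 (+) h (snd p)) # extension_moments_level T G J h ps
      else extension_moments_level T G J h ps)"

fun extension_moments ::
  "(bool list \<Rightarrow> int list \<times> int list \<Rightarrow> bool) \<Rightarrow> int list list \<Rightarrow> bool list \<Rightarrow> int list \<Rightarrow>
   (int list \<times> int list) list list \<Rightarrow> (int \<times> int \<times> int) list" where
  "extension_moments T G J h [] = []"
| "extension_moments T G J h (P # Ps) = extension_moments_level T G J h P @ extension_moments T G J h Ps"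

lemma extension_moments_eq:
  "extension_moments T G J h Ps =
     map (\<lambda>p. list_moments G 1 J (fst p) (map2 (+) h (snd p))) (filter (T J) (concat Ps))"
proof -
  have "extension_moments_level T G J h P =
     map (\<lambda>p. list_moments G 1 J (fst p) (map2 (+) h (snd p))) (filter (T J) P)" for P
    by (induction P) auto
  then show ?thesis by (induction Ps) auto
qed

text \<open>
  The criterion \<open>simply_laced_parabolic_base_insert_iff\<close> for a root given with its products.
\<close>
definition simply_laced_test :: "bool list \<Rightarrow> int list \<times> int list \<Rightarrow> bool" where
  "simply_laced_test J p \<longleftrightarrow> nonpos_on J (snd p) \<and> off_gcd J (fst p) = 1"

text \<open>
  \<open>(x, y)\<close> is the pivot of \<open>c\<close> and \<open>d\<close>, so \<open>d\<close> lies in the span iff \<open>x d - y c\<close> vanishes off \<open>J\<close>, and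
  the multiple of \<open>c\<close> in \<open>d\<close> can only be \<open>y / x\<close>.
\<close>
fun coherent_test :: "bool list \<Rightarrow> int list \<Rightarrow> int list \<Rightarrow> int \<times> int \<Rightarrow> bool" where
  "coherent_test J c d (x, y) \<longleftrightarrow>
     (zero_off J (map2 (\<lambda>u v. x * v - y * u) c d) \<longrightarrow>
      y mod x = 0 \<and> (0 \<le> y div x \<and> nonpos_on J (map2 (\<lambda>u v. y div x * u - v) c d) \<or>
        y div x \<le> 0 \<and> nonpos_on J (map2 (\<lambda>u v. v - y div x * u) c d)))"

text \<open>
  The criterion \<open>parabolic_base_insert_iff\<close>, with \<open>ds\<close> listing all roots; a zero pivot means that the root
  itself lies in the span of the selected simple roots.
\<close>
definition coherence_test :: "int list list \<Rightarrow> bool list \<Rightarrow> int list \<times> int list \<Rightarrow> bool" where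
  "coherence_test ds J p \<longleftrightarrow> fst (off_pivot J (fst p) (fst p)) \<noteq> 0 \<and>
     list_all (\<lambda>d. coherent_test J (fst p) d (off_pivot J (fst p) d)) ds"

definition removals :: "bool list \<Rightarrow> bool list list" where
  "removals J = map (\<lambda>i. J[i := False]) (filter (\<lambda>i. J ! i) [0..<length J])"

text \<open>
  A conditional in place of the conjunction, since rewriting then skips the product for roots with the wrong
  support.
\<close>
fun component_roots ::
  "bool list \<Rightarrow> int \<Rightarrow> (int list \<times> int list) list list \<Rightarrow> (int list \<times> int list) list" where
  "component_roots C N [] = []"
| "component_roots C N (P # Ps) =
     filter (\<lambda>p. if zero_off C (fst p) then dotp (snd p) (fst p) = N else False) P @ component_roots C N Ps"

lemma component_roots_eq:
  "component_roots C N Ps = filter (\<lambda>p. zero_off C (fst p) \<and> dotp (snd p) (fst p) = N) (concat Ps)"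
  by (induction Ps) (auto intro: filter_cong)

text \<open>
  \<open>C\<close> is a component of the diagram, \<open>m\<close> the number of its roots with squared length \<open>N\<close>, and \<open>Z\<close> marks
  the simple roots orthogonal to the only dominant one among these.
\<close>
definition check_component ::
  "(int list \<times> int list) list list \<Rightarrow> bool list \<times> int \<times> int \<times> bool list \<Rightarrow> bool" where
  "check_component Ps = (\<lambda>(C, N, m, Z). let R = component_roots C N Ps in
     int (length R) = m \<and>
     map (\<lambda>p. map (\<lambda>x. x = 0) (snd p)) (filter (\<lambda>p. nonpos_on C (map uminus (snd p))) R) = [Z])"

type_synonym moment_table = "((int \<times> int \<times> int) \<times> int \<times> int) list"

definition bases_entry :: "moment_table \<Rightarrow> int \<times> int \<times> int \<Rightarrow> int" where
  "bases_entry tab t = fst (the (map_of tab t))"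

definition order_entry :: "moment_table \<Rightarrow> int \<times> int \<times> int \<Rightarrow> int" where
  "order_entry tab t = snd (the (map_of tab t))"

text \<open>
  One application of \<open>card_parabolic_step\<close>. Passing to the simple roots orthogonal to the dominant root has
  to make \<open>K\<close> smaller, so that the reduction terminates.
\<close>
definition reduces_by ::
  "int list list \<Rightarrow> moment_table \<Rightarrow> bool list \<Rightarrow> bool list \<times> int \<times> int \<times> bool list \<Rightarrow> bool" where
  "reduces_by G tab K = (\<lambda>(C, N, m, Z).
     if list_all2 (\<longrightarrow>) C K then
       zero_off (map2 (\<longrightarrow>) K C) (mat_vec G (indicator_list C)) \<and> map2 (\<and>) K Z \<noteq> K \<and>
       order_entry tab (simple_moments G K) = m * order_entry tab (simple_moments G (map2 (\<and>) K Z))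
     else False)"

definition check_order ::
  "int list list \<Rightarrow> moment_table \<Rightarrow> (bool list \<times> int \<times> int \<times> bool list) list \<Rightarrow> bool list \<Rightarrow> bool" where
  "check_order G tab comps K \<longleftrightarrow> map_of tab (simple_moments G K) \<noteq> None \<and>
     (if list_all Not K then order_entry tab (simple_moments G K) = 1
      else list_ex (reduces_by G tab K) comps)"

type_synonym edge = "(int \<times> int \<times> int) \<times> (int \<times> int \<times> int) \<times> int \<times> int"

text \<open>
  An incidence \<open>(s, t, c, e)\<close> claims that every base in class \<open>t\<close> has \<open>c\<close> elements whose removal leads to
  class \<open>s\<close>, and that every base in class \<open>s\<close> has \<open>e\<close> extensions in class \<open>t\<close>.
\<close>
definition check_down :: "int list list \<Rightarrow> edge list \<Rightarrow> bool list \<Rightarrow> bool" where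
  "check_down G edges K = (let t = simple_moments G K; ds = map (simple_moments G) (removals K) in
     list_all (\<lambda>(s, t', c, e). if t' = t then int (count_list ds s) = c else True) edges)"

definition check_up ::
  "(bool list \<Rightarrow> int list \<times> int list \<Rightarrow> bool) \<Rightarrow> int list list \<Rightarrow>
   (int list \<times> int list) list list \<Rightarrow> edge list \<Rightarrow> bool list \<Rightarrow> bool" where
  "check_up T G Ps edges J = (let es = filter (\<lambda>(s, t, c, e). s = simple_moments G J) edges in
     if es = [] then True
     else (let ts = extension_moments T G J (mat_vec G (indicator_list J)) Ps in
       list_all (\<lambda>(s, t, c, e). int (count_list ts t) = e) es))"

text \<open>
  Starting from the class of the empty base, each incidence confirms the size of one class from the size of
  the other. Nothing remains if an incidence is inconsistent with the table.
\<close>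
fun propagate :: "moment_table \<Rightarrow> (int \<times> int \<times> int) list \<Rightarrow> edge list \<Rightarrow> (int \<times> int \<times> int) list" where
  "propagate tab ts [] = ts"
| "propagate tab ts ((s, t, c, e) # es) =
     (if c < 0 \<or> e < 0 \<or> bases_entry tab t * c \<noteq> bases_entry tab s * e then []
      else if s \<in> set ts \<and> c \<noteq> 0 then propagate tab (t # ts) es
      else if t \<in> set ts \<and> e \<noteq> 0 then propagate tab (s # ts) es
      else [])"

definition check_table :: "moment_table \<Rightarrow> edge list \<Rightarrow> bool" where
  "check_table tab edges \<longleftrightarrow> distinct (map fst tab) \<and>
     bases_entry tab (0, 0, 0) = 1 \<and>
     list_all (\<lambda>t. t \<in> set (propagate tab [(0, 0, 0)] edges)) (map fst tab)"

definition table_total :: "moment_table \<Rightarrow> int \<Rightarrow> int" where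
  "table_total tab w = sum_list (map (\<lambda>(t, u, b). u * w div (b * b)) tab)"

definition check_total :: "moment_table \<Rightarrow> int \<Rightarrow> bool" where
  "check_total tab w \<longleftrightarrow> list_all (\<lambda>(t, u, b). 0 < b \<and> u * w mod (b * b) = 0) tab"

section \<open>Correctness of the checks\<close>

context root_coordinates
begin

definition scaled :: "int \<times> int \<times> int \<Rightarrow> int \<times> real \<times> real" where
  "scaled = (\<lambda>(k, x, y). (k, s ^ 3 * of_int x, s ^ 3 * of_int y))"

lemma scaled_eq_iff: "scaled t = scaled t' \<longleftrightarrow> t = t'"
  using s_pos by (auto simp: scaled_def split: prod.splits)

lemma sum_list_eq_sum: "sum_list xs = (\<Sum>i<length xs. xs ! i)" for xs :: "int list"
  by (simp add: sum_list_sum_nth atLeast0LessThan)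

lemma card_selected:
  assumes "length J = n" shows "sum_list (indicator_list J) = int (card (selected J))"
proof -
  have "int (card (selected J)) = (\<Sum>v\<in>selected J. 1)" by simp
  also have "\<dots> = sum_list (indicator_list J)"
    unfolding sum_selected sum_list_eq_sum using assms
    by (intro sum.cong) (auto simp: nth_indicator_list)
  finally show ?thesis by simp
qed

text \<open>
  The integral Gram matrix differs from the true one by the factor \<open>s\<close>. The last two moments are cubic in
  the inner product and differ by \<open>s ^ 3\<close>.
\<close>
lemma moments_core:
  assumes J: "length J = n" and b: "length b = n" and \<sigma>: "length \<sigma> = n"
  shows "list_moments G k J b (mat_vec G \<sigma>) = (k + int (card (selected J)), x, y) \<longleftrightarrow>
     s ^ 3 * of_int x = (\<Sum>v\<in>selected J. (lincomb \<sigma> \<bullet> v) ^ 3) + (lincomb \<sigma> \<bullet> lincomb b) ^ 3 \<and>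
     s ^ 3 * of_int y = ((\<Sum>v\<in>selected J. (lincomb \<sigma> \<bullet> v) *\<^sub>R v) + (lincomb \<sigma> \<bullet> lincomb b) *\<^sub>R lincomb b) \<bullet>
       ((\<Sum>v\<in>selected J. (lincomb \<sigma> \<bullet> v) *\<^sub>R v) + (lincomb \<sigma> \<bullet> lincomb b) *\<^sub>R lincomb b)"
proof -
  let ?h = "mat_vec G \<sigma>"
  define r m where "r = dotp ?h b" and "m = select J ?h"
  define t where "t = map2 (\<lambda>x y. x + r * y) m b"
  have lm: "length m = n" using J length_G by (simp add: m_def length_select)
  have lt: "length t = n" using lm b by (simp add: t_def)
  have nm: "m ! i = (if J ! i then ?h ! i else 0)" if "i < n" for i
    using that J length_G by (simp add: m_def nth_select)
  have ip: "lincomb \<sigma> \<bullet> \<alpha> ! i = s * of_int (?h ! i)" if "i < n" for i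
    using inner_simple_lincomb[OF that \<sigma>] by (simp add: inner_commute)
  have ib: "lincomb \<sigma> \<bullet> lincomb b = s * of_int r"
    using inner_lincomb[OF \<sigma> b] by (simp add: inner_commute r_def)
  note c = card_selected[OF J]
  have cube: "(\<Sum>v\<in>selected J. (lincomb \<sigma> \<bullet> v) ^ 3) = s ^ 3 * of_int (sum_list (map (\<lambda>x. x * x * x) m))"
  proof -
    have "(if J ! i then (lincomb \<sigma> \<bullet> \<alpha> ! i) ^ 3 else 0) = s ^ 3 * of_int (map (\<lambda>x. x * x * x) m ! i)" if "i < n" for i
      using that lm nm[OF that] ip[OF that] by (simp add: power_mult_distrib power3_eq_cube)
    then have "(\<Sum>i<n. if J ! i then (lincomb \<sigma> \<bullet> \<alpha> ! i) ^ 3 else 0) =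
        (\<Sum>i<n. s ^ 3 * of_int (map (\<lambda>x. x * x * x) m ! i))"
      by (intro sum.cong) auto
    then show ?thesis
      unfolding sum_selected sum_list_eq_sum using lm by (simp only: length_map of_int_sum sum_distrib_left)
  qed
  have "(\<Sum>v\<in>selected J. (lincomb \<sigma> \<bullet> v) *\<^sub>R v) = s *\<^sub>R lincomb m"
    unfolding sum_selected lincomb_def[of m] scaleR_sum_right
    using nm ip by (intro sum.cong) auto
  then have tau: "(\<Sum>v\<in>selected J. (lincomb \<sigma> \<bullet> v) *\<^sub>R v) + (lincomb \<sigma> \<bullet> lincomb b) *\<^sub>R lincomb b = s *\<^sub>R lincomb t"
    unfolding t_def lincomb_add[OF lm b] ib by (simp add: scaleR_add_right)
  have eval: "list_moments G k J b ?h = (k + int (card (selected J)), sum_list (map (\<lambda>x. x * x * x) m) + r * r * r, dotp (mat_vec G t) t)"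
    by (simp add: list_moments_def Let_def r_def m_def t_def c)
  have "s ^ 3 * of_int x = (\<Sum>v\<in>selected J. (lincomb \<sigma> \<bullet> v) ^ 3) + (lincomb \<sigma> \<bullet> lincomb b) ^ 3 \<longleftrightarrow>
    x = sum_list (map (\<lambda>x. x * x * x) m) + r * r * r"
  proof -
    have "(\<Sum>v\<in>selected J. (lincomb \<sigma> \<bullet> v) ^ 3) + (lincomb \<sigma> \<bullet> lincomb b) ^ 3 =
      s ^ 3 * of_int (sum_list (map (\<lambda>x. x * x * x) m) + r * r * r)"
      unfolding cube ib by (simp add: power_mult_distrib power3_eq_cube algebra_simps)
    then show ?thesis using s_pos by (simp del: of_int_add of_int_mult)
  qed
  moreover have "(s *\<^sub>R lincomb t) \<bullet> (s *\<^sub>R lincomb t) = s ^ 3 * of_int (dotp (mat_vec G t) t)"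
    using inner_lincomb[OF lt lt] by (simp add: power3_eq_cube)
  ultimately show ?thesis unfolding tau eval using s_pos by auto
qed

lemma moments_selected:
  assumes J: "length J = n"
  shows "moments (selected J) = scaled (simple_moments G J)"
proof -
  let ?z = "map (\<lambda>_. 0) J"
  have z: "lincomb ?z = 0" using J by (simp add: lincomb_def)
  obtain k x y where e: "simple_moments G J = (k, x, y)" by (metis prod_cases3)
  have k: "k = 0 + int (card (selected J))"
    using e card_selected[OF J] by (simp add: simple_moments_def list_moments_def Let_def)
  have "list_moments G 0 J ?z (mat_vec G (indicator_list J)) = (0 + int (card (selected J)), x, y)"
    using e k by (simp add: simple_moments_def)
  note * = this[unfolded moments_core[OF J _ length_indicator_list[of J, unfolded J], of ?z 0 x y, simplified J length_map, OF refl]]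
  then show ?thesis
    using k e unfolding moments_def scaled_def sum_selected_eq_lincomb[OF J] z
    by (simp add: Let_def)
qed

lemma moments_insert_selected:
  assumes J: "length J = n" and b: "length b = n" and nb: "lincomb b \<notin> selected J"
  shows "moments (insert (lincomb b) (selected J)) =
    scaled (list_moments G 1 J b (map2 (+) (mat_vec G (indicator_list J)) (mat_vec G b)))"
proof -
  define \<sigma> where "\<sigma> = map2 (\<lambda>x y. x + 1 * y) (indicator_list J) b"
  have l\<sigma>: "length \<sigma> = n" using J b by (simp add: \<sigma>_def)
  have h: "map2 (+) (mat_vec G (indicator_list J)) (mat_vec G b) = mat_vec G \<sigma>"
  proof (rule nth_equalityI)
    fix i assume "i < length (map2 (+) (mat_vec G (indicator_list J)) (mat_vec G b))"
    then have i: "i < n" using length_G by simp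
    then show "map2 (+) (mat_vec G (indicator_list J)) (mat_vec G b) ! i = mat_vec G \<sigma> ! i"
      using length_G nth_G J b l\<sigma> by (simp add: nth_mat_vec dotp_eq_sum \<sigma>_def sum.distrib[symmetric] algebra_simps)
  qed (simp add: \<sigma>_def)
  have s: "\<Sum>(insert (lincomb b) (selected J)) = lincomb \<sigma>"
    using nb finite_selected J b by (simp add: \<sigma>_def lincomb_add sum_selected_eq_lincomb add.commute del: mult_1)
  obtain k x y where e: "list_moments G 1 J b (mat_vec G \<sigma>) = (k, x, y)" by (metis prod_cases3)
  have k: "k = 1 + int (card (selected J))"
    using e card_selected[OF J] by (simp add: list_moments_def Let_def)
  note * = e[unfolded k moments_core[OF J b l\<sigma>]]
  then show ?thesis
    using k e nb finite_selected unfolding h moments_def scaled_def s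
    by (simp add: Let_def add.commute)
qed

lemma card_selected_removals:
  assumes J: "length J = n"
  shows "card {a\<in>selected J. moments (selected J - {a}) = scaled t} = count_list (map (simple_moments G) (removals J)) t"
proof -
  have rem: "selected J - {\<alpha> ! i} = selected (J[i := False])" if i: "i < n" "J ! i" for i
    using distinct J i by (auto simp: selected_def nth_eq_iff_index_eq nth_list_update split: if_splits)
  let ?I = "{i\<in>{..<n}. J ! i \<and> simple_moments G (J[i := False]) = t}"
  have "{a\<in>selected J. moments (selected J - {a}) = scaled t} = (!) \<alpha> ` ?I"
  proof -
    have "moments (selected J - {\<alpha> ! i}) = scaled t \<longleftrightarrow> simple_moments G (J[i := False]) = t" if "i < n" "J ! i" for i
      using rem[OF that] moments_selected[of "J[i := False]"] J scaled_eq_iff by simp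
    then show ?thesis by (auto simp: selected_def)
  qed
  moreover have "inj_on ((!) \<alpha>) ?I" by (rule inj_on_nth[OF distinct]) simp
  ultimately have "card {a\<in>selected J. moments (selected J - {a}) = scaled t} = card ?I"
    by (simp add: card_image)
  also have "\<dots> = length (filter (\<lambda>i. simple_moments G (J[i := False]) = t) (filter (\<lambda>i. J ! i) [0..<n]))"
  proof -
    let ?l = "filter (\<lambda>i. simple_moments G (J[i := False]) = t) (filter (\<lambda>i. J ! i) [0..<n])"
    have "?I = set ?l" by auto
    then have "card ?I = card (set ?l)" by (rule arg_cong)
    also have "\<dots> = length ?l" by (rule distinct_card) simp
    finally show ?thesis .
  qed
  also have "\<dots> = count_list (map (simple_moments G) (removals J)) t"
    unfolding removals_def count_list_eq_length_filter filter_map length_map J comp_def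
    by (simp only: eq_commute[of t])
  finally show ?thesis .
qed

text \<open>
  Both criteria concern roots, so the test is compared with them on coordinates of roots.
\<close>
definition correct_test :: "(bool list \<Rightarrow> int list \<times> int list \<Rightarrow> bool) \<Rightarrow> bool" where
  "correct_test T \<longleftrightarrow> (\<forall>J c. length J = n \<longrightarrow> length c = n \<longrightarrow> lincomb c \<in> \<Phi> \<longrightarrow>
     T J (c, mat_vec G c) = (lincomb c \<notin> selected J \<and> parabolic_base (insert (lincomb c) (selected J))))"

lemma card_extensions:
  assumes chk: "check_roots Ct Ls" and T: "correct_test T" and J: "length J = n"
  shows "card {b\<in>\<Phi>. b \<notin> selected J \<and> parabolic_base (insert b (selected J)) \<and>
      moments (insert b (selected J)) = scaled t} =
    count_list (extension_moments T G J (mat_vec G (indicator_list J)) (with_products G (signed_list Ls))) t"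
proof -
  note R = roots_eq[OF chk]
  let ?R = "concat (signed_list Ls)" and ?h = "mat_vec G (indicator_list J)"
  let ?m = "\<lambda>c. list_moments G 1 J c (map2 (+) ?h (mat_vec G c))"
  have conc: "concat (with_products G Ms) = map (\<lambda>c. (c, mat_vec G c)) (concat Ms)" for Ms
    unfolding with_products_def by (simp add: map_concat)
  let ?C = "{c\<in>set ?R. T J (c, mat_vec G c) \<and> ?m c = t}"
  have iff: "lincomb c \<notin> selected J \<and> parabolic_base (insert (lincomb c) (selected J)) \<and>
      moments (insert (lincomb c) (selected J)) = scaled t \<longleftrightarrow> T J (c, mat_vec G c) \<and> ?m c = t"
    if c: "c \<in> set ?R" for c
  proof -
    have "lincomb c \<in> lincomb ` set ?R" using c by (rule imageI)
    then have l: "length c = n" and r: "lincomb c \<in> \<Phi>" using R(3)[OF c] R(1) by simp_all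
    have "T J (c, mat_vec G c) = (lincomb c \<notin> selected J \<and> parabolic_base (insert (lincomb c) (selected J)))"
      using T J l r unfolding correct_test_def by blast
    then show ?thesis using moments_insert_selected[OF J l] scaled_eq_iff[of "?m c" t] by auto
  qed
  have "{b\<in>\<Phi>. b \<notin> selected J \<and> parabolic_base (insert b (selected J)) \<and>
      moments (insert b (selected J)) = scaled t} = lincomb ` ?C"
  proof (intro equalityI subsetI)
    fix b assume b: "b \<in> {b\<in>\<Phi>. b \<notin> selected J \<and> parabolic_base (insert b (selected J)) \<and>
      moments (insert b (selected J)) = scaled t}"
    then have "b \<in> lincomb ` set ?R" using R(1) by simp
    then obtain c where c: "c \<in> set ?R" "b = lincomb c" by (elim imageE)
    then have "c \<in> ?C" using iff[OF c(1)] b by simp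
    then show "b \<in> lincomb ` ?C" using c(2) by (intro image_eqI)
  next
    fix b assume "b \<in> lincomb ` ?C"
    then obtain c where c: "c \<in> ?C" "b = lincomb c" by (elim imageE)
    then have cR: "c \<in> set ?R" by simp
    then have "lincomb c \<in> lincomb ` set ?R" by (rule imageI)
    then have "b \<in> \<Phi>" using R(1) c(2) by simp
    then show "b \<in> {b\<in>\<Phi>. b \<notin> selected J \<and> parabolic_base (insert b (selected J)) \<and>
      moments (insert b (selected J)) = scaled t}"
      using iff[OF cR] c by simp
  qed
  moreover have "inj_on lincomb ?C"
  proof (rule inj_onI)
    fix c d assume "c \<in> ?C" "d \<in> ?C" "lincomb c = lincomb d"
    then show "c = d" using lincomb_inj[of c d] R(3)[of c] R(3)[of d] by simp
  qed
  ultimately have "card {b\<in>\<Phi>. b \<notin> selected J \<and> parabolic_base (insert b (selected J)) \<and>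
      moments (insert b (selected J)) = scaled t} = card ?C" by (simp add: card_image)
  also have "\<dots> = length (filter (\<lambda>c. T J (c, mat_vec G c) \<and> ?m c = t) ?R)"
  proof -
    let ?l = "filter (\<lambda>c. T J (c, mat_vec G c) \<and> ?m c = t) ?R"
    have "?C = set ?l" by auto
    then have "card ?C = card (set ?l)" by (rule arg_cong)
    also have "\<dots> = length ?l" by (rule distinct_card) (use R(2) in simp)
    finally show ?thesis .
  qed
  also have "\<dots> = count_list (extension_moments T G J ?h (with_products G (signed_list Ls))) t"
    unfolding extension_moments_eq conc count_list_eq_length_filter filter_map length_map comp_def fst_conv snd_conv filter_filter
    by (simp only: eq_commute[of t])
  finally show ?thesis .
qed

lemma span_selected_iff:
  assumes "length C = n" "length c = n"
  shows "lincomb c \<in> span (selected C) \<longleftrightarrow> zero_off C c"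
proof
  assume *: "lincomb c \<in> span (selected C)"
  have "c ! i = 0" if i: "i < n" "\<not> C ! i" for i
  proof -
    have "\<alpha> ! i \<in> set \<alpha> - selected C" using i nth_in_selected by simp
    then have "coweight (\<alpha> ! i) \<bullet> lincomb c = 0" using simple_coords_span[OF selected_subset *] by blast
    then show ?thesis using coweight_lincomb[OF i(1)] by simp
  qed
  then show "zero_off C c" using assms by (simp add: zero_off_iff)
next
  assume "zero_off C c"
  then have "\<forall>i<n. \<not> C ! i \<longrightarrow> c ! i = 0" using assms by (simp add: zero_off_iff)
  then have "of_int (c ! i) *\<^sub>R \<alpha> ! i \<in> span (selected C)" if "i < n" for i
    using that nth_in_selected[OF that, of C] by (cases "C ! i") (auto intro: span_scale span_base span_zero)
  then show "lincomb c \<in> span (selected C)" unfolding lincomb_def by (intro span_sum) auto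
qed

lemma nonpos_on_selected:
  assumes "length J = n" "length c = n"
  shows "nonpos_on J (mat_vec G c) \<longleftrightarrow> (\<forall>a\<in>selected J. lincomb c \<bullet> a \<le> 0)"
proof -
  have "lincomb c \<bullet> \<alpha> ! i \<le> 0 \<longleftrightarrow> mat_vec G c ! i \<le> 0" if "i < n" for i
    using inner_simple_lincomb[OF that assms(2)] s_pos by (simp add: inner_commute mult_le_0_iff)
  then show ?thesis using assms length_G by (auto simp: nonpos_on_iff selected_def)
qed

lemma correct_simply_laced_test:
  assumes N: "\<And>v. v \<in> \<Phi> \<Longrightarrow> v \<bullet> v = N"
  shows "correct_test simply_laced_test"
  unfolding correct_test_def
proof (intro allI impI)
  fix J :: "bool list" and c :: "int list"
  assume J: "length J = n" and c: "length c = n" and r: "lincomb c \<in> \<Phi>"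
  have off: "set \<alpha> - selected J = {\<alpha> ! i | i. i < n \<and> \<not> J ! i}"
  proof (intro equalityI subsetI)
    fix x assume x: "x \<in> set \<alpha> - selected J"
    then obtain i where "i < n" "x = \<alpha> ! i" by (auto simp: in_set_conv_nth)
    then show "x \<in> {\<alpha> ! i | i. i < n \<and> \<not> J ! i}" using x nth_in_selected by blast
  next
    fix x assume "x \<in> {\<alpha> ! i | i. i < n \<and> \<not> J ! i}"
    then show "x \<in> set \<alpha> - selected J" using nth_in_selected by auto
  qed
  have "(\<forall>a\<in>set \<alpha> - selected J. t * (coweight a \<bullet> lincomb c) \<in> \<int>) \<longleftrightarrow>
    (\<forall>i<n. \<not> J ! i \<longrightarrow> t * of_int (c ! i) \<in> \<int>)" for t :: real
  proof -
    have "(\<forall>a\<in>set \<alpha> - selected J. t * (coweight a \<bullet> lincomb c) \<in> \<int>) \<longleftrightarrow>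
      (\<forall>i<n. \<not> J ! i \<longrightarrow> t * (coweight (\<alpha> ! i) \<bullet> lincomb c) \<in> \<int>)" unfolding off by blast
    then show ?thesis by (simp add: coweight_lincomb)
  qed
  then have "simply_laced_test J (c, mat_vec G c) \<longleftrightarrow> (\<forall>a\<in>selected J. lincomb c \<bullet> a \<le> 0) \<and>
    (\<forall>t::real. (\<forall>a\<in>set \<alpha> - selected J. t * (coweight a \<bullet> lincomb c) \<in> \<int>) \<longrightarrow> t \<in> \<int>)"
    unfolding simply_laced_test_def
    using nonpos_on_selected[OF J c] off_gcd_eq_1_iff[of J c] J c by simp
  also have "\<dots> \<longleftrightarrow> lincomb c \<notin> selected J \<and> parabolic_base (insert (lincomb c) (selected J))"
    by (rule simply_laced_parabolic_base_insert_iff[OF N selected_subset r, symmetric])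
  finally show "simply_laced_test J (c, mat_vec G c) =
    (lincomb c \<notin> selected J \<and> parabolic_base (insert (lincomb c) (selected J)))" .
qed

lemma correct_coherence_test:
  assumes chk: "check_roots Ct Ls"
  shows "correct_test (coherence_test (concat (signed_list Ls)))"
  unfolding correct_test_def
proof (intro allI impI)
  note R = roots_eq[OF chk]
  fix J :: "bool list" and c :: "int list"
  assume J: "length J = n" and c: "length c = n" and r: "lincomb c \<in> \<Phi>"
  let ?b = "lincomb c" and ?K = "selected J"
  have off_span: "d ! i = 0" if "lincomb d \<in> span ?K" "length d = n" "i < n" "\<not> J ! i" for d i
    using that span_selected_iff[OF J that(2)] zero_off_iff[of J d] J by simp
  have nspan: "?b \<notin> span ?K \<longleftrightarrow> fst (off_pivot J c c) \<noteq> 0"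
    using off_pivot_cases[of J c c] J c span_selected_iff[OF J c] zero_off_iff[of J c] by auto
  have key: "coherent_test J c d (off_pivot J c d) \<longleftrightarrow>
     (lincomb d \<in> span (insert ?b ?K) \<longrightarrow> coherent ?K ?b (lincomb d))"
    if nb: "?b \<notin> span ?K" and d: "length d = n" for d
  proof -
    obtain i where "i < n" "\<not> J ! i" "c ! i \<noteq> 0"
      using nb span_selected_iff[OF J c] zero_off_iff[of J c] J c by auto
    then obtain p where p: "p < n" "\<not> J ! p" "c ! p \<noteq> 0" "off_pivot J c d = (c ! p, d ! p)"
      using off_pivot_cases[of J c d] J c d by auto
    define x y where "x = c ! p" and "y = d ! p"
    let ?w = "map2 (\<lambda>u v. x * v - y * u) c d"
    have w: "lincomb ?w = of_int x *\<^sub>R lincomb d - of_int y *\<^sub>R ?b"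
      using c d by (simp add: lincomb_def sum_subtractf[symmetric] scaleR_sum_right algebra_simps)
    have lw: "length ?w = n" using c d by simp
    have span_iff: "lincomb d \<in> span (insert ?b ?K) \<longleftrightarrow> zero_off J ?w"
    proof
      assume "lincomb d \<in> span (insert ?b ?K)"
      then obtain t where t: "lincomb d - t *\<^sub>R ?b \<in> span ?K" using span_breakdown_eq by blast
      have co: "of_int (d ! i) = t * of_int (c ! i)" if "i < n" "\<not> J ! i" for i
      proof -
        have "\<alpha> ! i \<in> set \<alpha> - ?K" using that nth_in_selected by simp
        then have "coweight (\<alpha> ! i) \<bullet> (lincomb d - t *\<^sub>R ?b) = 0"
          using simple_coords_span[OF selected_subset t] by blast
        then show ?thesis using coweight_lincomb[OF that(1)] by (simp add: inner_diff_right)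
      qed
      have "x * d ! i - y * c ! i = 0" if "i < n" "\<not> J ! i" for i
      proof -
        have "real_of_int (x * d ! i - y * c ! i) = 0"
          using co[OF that] co[OF p(1,2)] by (simp add: x_def y_def)
        then show ?thesis by (simp only: of_int_eq_0_iff)
      qed
      then show "zero_off J ?w" using J c d lw by (simp add: zero_off_iff)
    next
      assume "zero_off J ?w"
      then have "lincomb ?w \<in> span ?K" using span_selected_iff[OF J lw] by simp
      then have "lincomb ?w + of_int y *\<^sub>R ?b \<in> span (insert ?b ?K)"
        by (intro span_add span_scale) (auto intro: span_base set_mp[OF span_mono[OF subset_insertI]])
      then have "(1 / of_int x) *\<^sub>R (of_int x *\<^sub>R lincomb d) \<in> span (insert ?b ?K)"
        unfolding w by (intro span_scale[of "of_int x *\<^sub>R lincomb d"]) simp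
      moreover have "(1 / of_int x) *\<^sub>R (of_int x *\<^sub>R lincomb d) = lincomb d" using p(3) by (simp add: x_def)
      ultimately show "lincomb d \<in> span (insert ?b ?K)" by (simp only:)
    qed
    have diff: "lincomb (map2 (\<lambda>u v. v - m * u) c d) = lincomb d - of_int m *\<^sub>R ?b" for m :: int
      using c d by (simp add: lincomb_def sum_subtractf[symmetric] scaleR_sum_right algebra_simps)
    have m_eq: "y = m * x" if "lincomb d - of_int m *\<^sub>R ?b \<in> span ?K" for m :: int
      using off_span[of "map2 (\<lambda>u v. v - m * u) c d" p] that p c d diff[of m] by (simp add: x_def y_def)
    have coord: "coweight (\<alpha> ! i) \<bullet> (lincomb d - of_int m *\<^sub>R ?b) = of_int (d ! i - m * c ! i)" if "i < n" for i and m :: int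
      using coweight_lincomb[OF that] by (simp add: inner_diff_right)
    have ge: "(\<forall>a\<in>?K. coweight a \<bullet> (lincomb d - of_int m *\<^sub>R ?b) \<ge> 0) \<longleftrightarrow> nonpos_on J (map2 (\<lambda>u v. m * u - v) c d)" for m :: int
    proof -
      have "(\<forall>a\<in>?K. coweight a \<bullet> (lincomb d - of_int m *\<^sub>R ?b) \<ge> 0) \<longleftrightarrow>
        (\<forall>i<n. J ! i \<longrightarrow> (0::real) \<le> of_int (d ! i - m * c ! i))"
        unfolding selected_def using coord by auto
      also have "\<dots> \<longleftrightarrow> nonpos_on J (map2 (\<lambda>u v. m * u - v) c d)"
        using J c d by (simp only: of_int_0_le_iff) (simp add: nonpos_on_iff)
      finally show ?thesis .
    qed
    have le: "(\<forall>a\<in>?K. coweight a \<bullet> (lincomb d - of_int m *\<^sub>R ?b) \<le> 0) \<longleftrightarrow> nonpos_on J (map2 (\<lambda>u v. v - m * u) c d)" for m :: int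
    proof -
      have "(\<forall>a\<in>?K. coweight a \<bullet> (lincomb d - of_int m *\<^sub>R ?b) \<le> 0) \<longleftrightarrow>
        (\<forall>i<n. J ! i \<longrightarrow> of_int (d ! i - m * c ! i) \<le> (0::real))"
        unfolding selected_def using coord by auto
      also have "\<dots> \<longleftrightarrow> nonpos_on J (map2 (\<lambda>u v. v - m * u) c d)"
        using J c d by (simp only: of_int_le_0_iff) (simp add: nonpos_on_iff)
      finally show ?thesis .
    qed
    have in_span: "lincomb d - of_int m *\<^sub>R ?b \<in> span ?K" if z: "zero_off J ?w" and m: "y = m * x" for m :: int
    proof -
      have "(map2 (\<lambda>u v. v - m * u) c d) ! i = 0" if i: "i < n" "\<not> J ! i" for i
      proof -
        have "?w ! i = 0" using z i J c d lw by (simp add: zero_off_iff)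
        then have "x * (d ! i - m * c ! i) = 0" using i c d m by (simp add: algebra_simps)
        then show ?thesis using p(3) i c d by (simp add: x_def)
      qed
      then have "zero_off J (map2 (\<lambda>u v. v - m * u) c d)" using J c d by (simp add: zero_off_iff)
      then show ?thesis using span_selected_iff[OF J, of "map2 (\<lambda>u v. v - m * u) c d"] c d diff[of m] by simp
    qed
    have x0: "x \<noteq> 0" using p(3) by (simp add: x_def)
    have pv: "off_pivot J c d = (x, y)" using p(4) by (simp add: x_def y_def)
    show ?thesis
      unfolding pv coherent_test.simps coherent_def span_iff ge le
    proof (intro imp_cong refl iffI)
      assume z: "zero_off J ?w"
        and A: "y mod x = 0 \<and> (0 \<le> y div x \<and> nonpos_on J (map2 (\<lambda>u v. y div x * u - v) c d) \<or>
          y div x \<le> 0 \<and> nonpos_on J (map2 (\<lambda>u v. v - y div x * u) c d))"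
      then have "y = (y div x) * x" by (metis add.right_neutral div_mult_mod_eq)
      then show "\<exists>m::int. lincomb d - of_int m *\<^sub>R ?b \<in> span ?K \<and>
        (m \<ge> 0 \<and> nonpos_on J (map2 (\<lambda>u v. m * u - v) c d) \<or> m \<le> 0 \<and> nonpos_on J (map2 (\<lambda>u v. v - m * u) c d))"
        using in_span[OF z, of "y div x"] A by (intro exI[of _ "y div x"]) blast
    next
      assume "\<exists>m::int. lincomb d - of_int m *\<^sub>R ?b \<in> span ?K \<and>
        (m \<ge> 0 \<and> nonpos_on J (map2 (\<lambda>u v. m * u - v) c d) \<or> m \<le> 0 \<and> nonpos_on J (map2 (\<lambda>u v. v - m * u) c d))"
      then obtain m :: int where m: "lincomb d - of_int m *\<^sub>R ?b \<in> span ?K"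
        "m \<ge> 0 \<and> nonpos_on J (map2 (\<lambda>u v. m * u - v) c d) \<or> m \<le> 0 \<and> nonpos_on J (map2 (\<lambda>u v. v - m * u) c d)" by blast
      have "y div x = m" "y mod x = 0" using m_eq[OF m(1)] x0 by simp_all
      then show "y mod x = 0 \<and> (0 \<le> y div x \<and> nonpos_on J (map2 (\<lambda>u v. y div x * u - v) c d) \<or>
          y div x \<le> 0 \<and> nonpos_on J (map2 (\<lambda>u v. v - y div x * u) c d))"
        using m(2) by simp
    qed
  qed
  let ?Q = "\<lambda>v. v \<in> span (insert ?b ?K) \<longrightarrow> coherent ?K ?b v"
  have all: "(\<forall>v\<in>\<Phi>. ?Q v) \<longleftrightarrow> (\<forall>d\<in>set (concat (signed_list Ls)). ?Q (lincomb d))"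
  proof (intro iffI ballI)
    fix d assume A: "\<forall>v\<in>\<Phi>. ?Q v" and d: "d \<in> set (concat (signed_list Ls))"
    have "lincomb d \<in> lincomb ` set (concat (signed_list Ls))" using d by (rule imageI)
    then have "lincomb d \<in> \<Phi>" using R(1) by simp
    then show "?Q (lincomb d)" using A by blast
  next
    fix v assume A: "\<forall>d\<in>set (concat (signed_list Ls)). ?Q (lincomb d)" and v: "v \<in> \<Phi>"
    have "v \<in> lincomb ` set (concat (signed_list Ls))" using v R(1) by simp
    then obtain d where "d \<in> set (concat (signed_list Ls))" "v = lincomb d" by (elim imageE)
    then show "?Q v" using A by blast
  qed
  have "coherence_test (concat (signed_list Ls)) J (c, mat_vec G c) \<longleftrightarrow>
    ?b \<notin> span ?K \<and> (\<forall>d\<in>set (concat (signed_list Ls)). coherent_test J c d (off_pivot J c d))"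
    unfolding coherence_test_def fst_conv nspan list_all_iff by blast
  also have "\<dots> \<longleftrightarrow> ?b \<notin> span ?K \<and> (\<forall>d\<in>set (concat (signed_list Ls)). ?Q (lincomb d))"
    using key R(3) by blast
  also have "\<dots> \<longleftrightarrow> ?b \<notin> span ?K \<and> (\<forall>v\<in>\<Phi>. ?Q v)" unfolding all ..
  also have "\<dots> \<longleftrightarrow> ?b \<notin> ?K \<and> parabolic_base (insert ?b ?K)"
    unfolding parabolic_base_insert_iff[OF selected_subset r] ..
  finally show "coherence_test (concat (signed_list Ls)) J (c, mat_vec G c) =
    (?b \<notin> ?K \<and> parabolic_base (insert ?b ?K))" .
qed

end

section \<open>From certificates to the order\<close>

context root_coordinates
begin

lemma component_props:
  assumes chk: "check_roots Ct Ls" and C: "length C = n"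
    and comp: "check_component (with_products G (signed_list Ls)) (C, N, m, Z)"
  obtains \<theta> where "\<theta> \<in> \<Phi>" "\<theta> \<in> span (selected C)" "\<And>a. a \<in> selected C \<Longrightarrow> \<theta> \<bullet> a \<ge> 0"
    "\<And>v. v \<in> \<Phi> \<Longrightarrow> v \<in> span (selected C) \<Longrightarrow> v \<bullet> v = \<theta> \<bullet> \<theta> \<Longrightarrow> (\<And>a. a \<in> selected C \<Longrightarrow> v \<bullet> a \<ge> 0) \<Longrightarrow> v = \<theta>"
    "int (card {v\<in>\<Phi>. v \<in> span (selected C) \<and> v \<bullet> v = \<theta> \<bullet> \<theta>}) = m"
    "length Z = n" "\<And>i. i < n \<Longrightarrow> Z ! i \<longleftrightarrow> \<theta> \<bullet> \<alpha> ! i = 0"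
proof -
  note R = roots_eq[OF chk]
  let ?R = "concat (signed_list Ls)"
  have conc: "concat (with_products G Ms) = map (\<lambda>c. (c, mat_vec G c)) (concat Ms)" for Ms
    unfolding with_products_def by (simp add: map_concat)
  have root: "lincomb c \<in> \<Phi>" if "c \<in> set ?R" for c
  proof -
    have "lincomb c \<in> lincomb ` set ?R" using that by (rule imageI)
    then show ?thesis using R(1) by simp
  qed
  have root': "\<exists>c\<in>set ?R. v = lincomb c" if "v \<in> \<Phi>" for v
  proof -
    have "v \<in> lincomb ` set ?R" using that R(1) by simp
    then show ?thesis by (elim imageE) blast
  qed
  define cs where "cs = filter (\<lambda>c. zero_off C c \<and> dotp (mat_vec G c) c = N) ?R"
  have comps: "component_roots C N (with_products G (signed_list Ls)) = map (\<lambda>c. (c, mat_vec G c)) cs"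
    unfolding component_roots_eq conc cs_def filter_map comp_def by simp
  have m: "int (length cs) = m"
    and Z: "map (\<lambda>c. map (\<lambda>x. x = 0) (mat_vec G c)) (filter (\<lambda>c. nonpos_on C (map uminus (mat_vec G c))) cs) = [Z]"
    using comp by (simp_all add: check_component_def Let_def comps filter_map comp_def)
  have dom_iff: "nonpos_on C (map uminus (mat_vec G c)) \<longleftrightarrow> (\<forall>a\<in>selected C. lincomb c \<bullet> a \<ge> 0)" if c: "length c = n" for c
  proof -
    have "lincomb c \<bullet> \<alpha> ! i \<ge> 0 \<longleftrightarrow> - (mat_vec G c ! i) \<le> 0" if "i < n" for i
      using inner_simple_lincomb[OF that c] s_pos by (simp add: inner_commute zero_le_mult_iff)
    then show ?thesis using C length_G by (auto simp: nonpos_on_iff selected_def)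
  qed
  have cs_iff: "c \<in> set cs \<longleftrightarrow> c \<in> set ?R \<and> lincomb c \<in> span (selected C) \<and> lincomb c \<bullet> lincomb c = s * of_int N" for c
  proof (cases "c \<in> set ?R")
    case True
    then have l: "length c = n" using R(3) by blast
    have "lincomb c \<bullet> lincomb c = s * of_int N \<longleftrightarrow> dotp (mat_vec G c) c = N"
      using inner_lincomb[OF l l] s_pos by simp
    then show ?thesis using True span_selected_iff[OF C l] by (auto simp: cs_def)
  qed (simp add: cs_def)
  obtain c0 where c0: "filter (\<lambda>c. nonpos_on C (map uminus (mat_vec G c))) cs = [c0]"
    "map (\<lambda>x. x = 0) (mat_vec G c0) = Z" using Z by (auto simp: map_eq_Cons_conv)
  then have "c0 \<in> set (filter (\<lambda>c. nonpos_on C (map uminus (mat_vec G c))) cs)" by simp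
  then have c0cs: "c0 \<in> set cs" "nonpos_on C (map uminus (mat_vec G c0))" by auto
  then have c0R: "c0 \<in> set ?R" using cs_iff by blast
  have l0: "length c0 = n" using R(3)[OF c0R] .
  have norm0: "lincomb c0 \<bullet> lincomb c0 = s * of_int N" using c0cs(1) cs_iff by blast
  have img: "{v\<in>\<Phi>. v \<in> span (selected C) \<and> v \<bullet> v = lincomb c0 \<bullet> lincomb c0} = lincomb ` set cs"
  proof (intro equalityI subsetI)
    fix v assume v: "v \<in> {v\<in>\<Phi>. v \<in> span (selected C) \<and> v \<bullet> v = lincomb c0 \<bullet> lincomb c0}"
    then obtain c where "c \<in> set ?R" "v = lincomb c" using root' by blast
    then show "v \<in> lincomb ` set cs" using v norm0 cs_iff[of c] by auto
  next
    fix v assume "v \<in> lincomb ` set cs"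
    then obtain c where c: "c \<in> set cs" "v = lincomb c" by (elim imageE)
    then show "v \<in> {v\<in>\<Phi>. v \<in> span (selected C) \<and> v \<bullet> v = lincomb c0 \<bullet> lincomb c0}"
      using cs_iff[of c] root[of c] norm0 by auto
  qed
  have lcs: "length c = n" if "c \<in> set cs" for c using that cs_iff[of c] R(3) by blast
  have "inj_on lincomb (set cs)"
    using lincomb_inj lcs by (intro inj_onI) blast
  then have "card (lincomb ` set cs) = card (set cs)" by (rule card_image)
  also have "\<dots> = length cs" unfolding cs_def by (rule distinct_card) (use R(2) in simp)
  finally have card: "int (card {v\<in>\<Phi>. v \<in> span (selected C) \<and> v \<bullet> v = lincomb c0 \<bullet> lincomb c0}) = m"
    unfolding img using m by simp
  have uniq: "v = lincomb c0" if v: "v \<in> \<Phi>" "v \<in> span (selected C)" "v \<bullet> v = lincomb c0 \<bullet> lincomb c0"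
    "\<And>a. a \<in> selected C \<Longrightarrow> v \<bullet> a \<ge> 0" for v
  proof -
    have "v \<in> lincomb ` set cs" using v(1-3) img by blast
    then obtain c where c: "c \<in> set cs" "v = lincomb c" by (elim imageE)
    then have "nonpos_on C (map uminus (mat_vec G c))" using dom_iff[OF lcs[OF c(1)]] v(4) by blast
    then have "c \<in> set (filter (\<lambda>c. nonpos_on C (map uminus (mat_vec G c))) cs)" using c(1) by simp
    then have "c = c0" using c0(1) by simp
    then show ?thesis using c(2) by simp
  qed
  have Zi: "Z ! i \<longleftrightarrow> lincomb c0 \<bullet> \<alpha> ! i = 0" if "i < n" for i
    using c0(2) that length_G inner_simple_lincomb[OF that l0] s_pos by (auto simp: inner_commute)
  have lZ: "length Z = n" using c0(2) length_G by auto
  show thesis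
  proof (rule that[of "lincomb c0"])
    show "lincomb c0 \<in> \<Phi>" using root[OF c0R] .
    show "lincomb c0 \<in> span (selected C)" using c0cs(1) cs_iff by blast
    show "\<And>a. a \<in> selected C \<Longrightarrow> lincomb c0 \<bullet> a \<ge> 0" using dom_iff[OF l0] c0cs(2) by blast
  qed (fact uniq card lZ Zi)+
qed

text \<open>
  The component \<open>C\<close> is orthogonal to the rest of \<open>K\<close>: the products of a simple root \<open>a\<close> outside \<open>C\<close> with
  the elements of \<open>C\<close> are nonpositive and the check makes their sum vanish.
\<close>
lemma card_parabolic_reduce:
  assumes chk: "check_roots Ct Ls" and K: "length K = n"
    and comp: "check_component (with_products G (signed_list Ls)) (C, N, m, Z)"
    and red: "reduces_by G tab K (C, N, m, Z)"
  shows "length (map2 (\<and>) K Z) = n" "selected (map2 (\<and>) K Z) \<subset> selected K"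
    "int (card (parabolic (selected K))) = m * int (card (parabolic (selected (map2 (\<and>) K Z))))"
    "order_entry tab (simple_moments G K) = m * order_entry tab (simple_moments G (map2 (\<and>) K Z))"
proof -
  have sub: "list_all2 (\<longrightarrow>) C K"
    and sep: "zero_off (map2 (\<longrightarrow>) K C) (mat_vec G (indicator_list C))"
    and ne: "map2 (\<and>) K Z \<noteq> K"
    and ord: "order_entry tab (simple_moments G K) = m * order_entry tab (simple_moments G (map2 (\<and>) K Z))"
    using red unfolding reduces_by_def by (auto split: if_splits)
  have C: "length C = n" using sub K by (simp add: list_all2_lengthD)
  have CK: "K ! i" if "C ! i" "i < n" for i using sub that K C by (simp add: list_all2_conv_all_nth)
  obtain \<theta> where \<theta>: "\<theta> \<in> \<Phi>" "\<theta> \<in> span (selected C)" "\<And>a. a \<in> selected C \<Longrightarrow> \<theta> \<bullet> a \<ge> 0"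
    "\<And>v. v \<in> \<Phi> \<Longrightarrow> v \<in> span (selected C) \<Longrightarrow> v \<bullet> v = \<theta> \<bullet> \<theta> \<Longrightarrow> (\<And>a. a \<in> selected C \<Longrightarrow> v \<bullet> a \<ge> 0) \<Longrightarrow> v = \<theta>"
    "int (card {v\<in>\<Phi>. v \<in> span (selected C) \<and> v \<bullet> v = \<theta> \<bullet> \<theta>}) = m"
    "length Z = n" "\<And>i. i < n \<Longrightarrow> Z ! i \<longleftrightarrow> \<theta> \<bullet> \<alpha> ! i = 0"
    using component_props[OF chk C comp] by blast
  show lKZ: "length (map2 (\<and>) K Z) = n" using K \<theta>(6) by simp
  have KZ: "{a\<in>selected K. \<theta> \<bullet> a = 0} = selected (map2 (\<and>) K Z)"
    using \<theta>(6,7) K by (auto simp: selected_def)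
  have CKs: "selected C \<subseteq> selected K" using CK by (auto simp: selected_def)
  have orth: "c \<bullet> a = 0" if a: "a \<in> selected K - selected C" and c: "c \<in> selected C" for a c
  proof -
    obtain i where i: "i < n" "a = \<alpha> ! i" "K ! i" using a by (auto simp: selected_def)
    have "\<not> C ! i" using a i nth_in_selected[OF i(1), of C] by simp
    then have "mat_vec G (indicator_list C) ! i = 0"
      using sep i K C length_G by (simp add: zero_off_iff)
    then have "a \<bullet> lincomb (indicator_list C) = 0"
      using inner_simple_lincomb[OF i(1), of "indicator_list C"] C i by simp
    then have "(\<Sum>c\<in>selected C. - (a \<bullet> c)) = 0"
      using sum_selected_eq_lincomb[OF C] by (simp add: inner_sum_right[symmetric] sum_negf)
    moreover have "- (a \<bullet> c) \<ge> 0" if "c \<in> selected C" for c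
    proof -
      have "c \<noteq> a" using that a by blast
      moreover have "a \<in> set \<alpha>" using i by simp
      moreover have "c \<in> set \<alpha>" using that selected_subset by blast
      ultimately have "a \<bullet> c \<le> 0" using simple_obtuse by blast
      then show ?thesis by simp
    qed
    ultimately have "\<forall>c\<in>selected C. - (a \<bullet> c) = 0"
      using sum_nonneg_eq_0_iff[OF finite_selected, of C "\<lambda>c. - (a \<bullet> c)"] by simp
    then have "a \<bullet> c = 0" using c by simp
    then show ?thesis by (subst inner_commute)
  qed
  have "card (parabolic (selected K)) =
    card {v\<in>\<Phi>. v \<in> span (selected C) \<and> v \<bullet> v = \<theta> \<bullet> \<theta>} * card (parabolic {a\<in>selected K. \<theta> \<bullet> a = 0})"
    using card_parabolic_step[OF selected_subset CKs orth \<theta>(1-4)] .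
  then show "int (card (parabolic (selected K))) = m * int (card (parabolic (selected (map2 (\<and>) K Z))))"
    unfolding KZ using \<theta>(5) by (simp only: of_nat_mult)
  obtain i where i: "i < n" "map2 (\<and>) K Z ! i \<noteq> K ! i"
    using ne nth_equalityI[of "map2 (\<and>) K Z" K] lKZ K by metis
  have "\<alpha> ! i \<in> selected K" "\<alpha> ! i \<notin> selected (map2 (\<and>) K Z)"
    using i nth_in_selected[OF i(1)] K \<theta>(6) by auto
  moreover have "selected (map2 (\<and>) K Z) \<subseteq> selected K" unfolding KZ[symmetric] by blast
  ultimately show "selected (map2 (\<and>) K Z) \<subset> selected K" by blast
  show "order_entry tab (simple_moments G K) = m * order_entry tab (simple_moments G (map2 (\<and>) K Z))" by (fact ord)
qed

lemma card_parabolic_table: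
  assumes chk: "check_roots Ct Ls"
    and comps: "list_all (check_component (with_products G (signed_list Ls))) comps"
    and ord: "list_all (check_order G tab comps) (masks n)"
    and K: "length K = n"
  shows "int (card (parabolic (selected K))) = order_entry tab (simple_moments G K)"
  using K
proof (induction "card (selected K)" arbitrary: K rule: less_induct)
  case less
  have cK: "check_order G tab comps K" using ord less.prems by (simp add: list_all_iff set_masks)
  show ?case
  proof (cases "list_all Not K")
    case True
    then have "selected K = {}" using less.prems by (auto simp: selected_def list_all_length)
    moreover have "parabolic {} = {id}" unfolding parabolic_def by (auto simp: act_Nil)
    ultimately show ?thesis using cK True by (simp add: check_order_def)
  next
    case False
    then obtain p where p: "p \<in> set comps" "reduces_by G tab K p"
      using cK by (auto simp: check_order_def list_ex_iff)
    obtain C N m Z where pe: "p = (C, N, m, Z)" by (metis prod_cases4)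
    have comp: "check_component (with_products G (signed_list Ls)) (C, N, m, Z)"
      using comps p(1) pe by (simp add: list_all_iff)
    note red = card_parabolic_reduce[OF chk less.prems comp p(2)[unfolded pe]]
    have "card (selected (map2 (\<and>) K Z)) < card (selected K)"
      using red(2) finite_selected psubset_card_mono by blast
    then have "int (card (parabolic (selected (map2 (\<and>) K Z)))) = order_entry tab (simple_moments G (map2 (\<and>) K Z))"
      using less.hyps red(1) by blast
    then show ?thesis using red(3,4) by simp
  qed
qed

lemma selected_cases:
  assumes "K \<subseteq> set \<alpha>" obtains J where "length J = n" "K = selected J"
  using subset_eq_selected[OF assms] that by (metis length_map)

definition class_card :: "int \<times> int \<times> int \<Rightarrow> int" where
  "class_card t = int (card (base_class moments (scaled t)))"

lemma class_card_edge:
  assumes chk: "check_roots Ct Ls" and T: "correct_test T"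
    and down: "list_all (check_down G edges) (masks n)"
    and up: "list_all (check_up T G (with_products G (signed_list Ls)) edges) (masks n)"
    and e: "(s', t, c, e) \<in> set edges" "c \<ge> 0" "e \<ge> 0"
  shows "class_card t * c = class_card s' * e"
proof -
  have "card (base_class moments (scaled t)) * nat c = card (base_class moments (scaled s')) * nat e"
  proof (rule card_base_class_edge)
    fix K assume K: "K \<subseteq> set \<alpha>" "moments K = scaled t"
    obtain J where J: "length J = n" "K = selected J" using selected_cases K(1) by blast
    have t: "simple_moments G J = t" using K(2) J moments_selected[OF J(1)] scaled_eq_iff by simp
    have "check_down G edges J" using down J(1) by (simp add: list_all_iff set_masks)
    then have "int (count_list (map (simple_moments G) (removals J)) s') = c"
      using e(1) t unfolding check_down_def Let_def list_all_iff by fastforce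
    then show "card {a\<in>K. moments (K - {a}) = scaled s'} = nat c"
      using card_selected_removals[OF J(1), of s'] J(2) by simp
  next
    fix K assume K: "K \<subseteq> set \<alpha>" "moments K = scaled s'"
    obtain J where J: "length J = n" "K = selected J" using selected_cases K(1) by blast
    have t: "simple_moments G J = s'" using K(2) J moments_selected[OF J(1)] scaled_eq_iff by simp
    have cu: "check_up T G (with_products G (signed_list Ls)) edges J" using up J(1) by (simp add: list_all_iff set_masks)
    let ?es = "filter (\<lambda>(s, t, c, e). s = simple_moments G J) edges"
    have mem: "(s', t, c, e) \<in> set ?es" using e(1) t by simp
    then have "?es \<noteq> []" by (metis list.set(1) empty_iff)
    then have "list_all (\<lambda>(s, t, c, e). int (count_list (extension_moments T G J (mat_vec G (indicator_list J)) (with_products G (signed_list Ls))) t) = e) ?es"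
      using cu unfolding check_up_def Let_def by (simp only: if_False)
    then have "int (count_list (extension_moments T G J (mat_vec G (indicator_list J)) (with_products G (signed_list Ls))) t) = e"
      using mem unfolding list_all_iff by fast
    then show "card {b\<in>\<Phi>. b \<notin> K \<and> parabolic_base (insert b K) \<and> moments (insert b K) = scaled t} = nat e"
      using card_extensions[OF chk T J(1), of t] J(2) by simp
  qed (rule moments_image)
  then show ?thesis using e(2,3) unfolding class_card_def by (metis int_nat_eq of_nat_mult)
qed

lemma propagate_class_card:
  assumes "\<And>s t c e. (s, t, c, e) \<in> set es \<Longrightarrow> c \<ge> 0 \<Longrightarrow> e \<ge> 0 \<Longrightarrow> class_card t * c = class_card s * e"
    and "\<And>t. t \<in> set ts \<Longrightarrow> class_card t = bases_entry tab t"
    and "t \<in> set (propagate tab ts es)"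
  shows "class_card t = bases_entry tab t"
  using assms
proof (induction tab ts es rule: propagate.induct)
  case (2 tab ts s t' c e es)
  have ce: "c \<ge> 0" "e \<ge> 0" "bases_entry tab t' * c = bases_entry tab s * e"
    using 2(5) by (auto split: if_splits)
  have eq: "class_card t' * c = class_card s * e" using 2(3) ce by simp
  have rej: "\<not> (c < 0 \<or> e < 0 \<or> bases_entry tab t' * c \<noteq> bases_entry tab s * e)" using ce by auto
  have prem: "\<And>s t c e. (s, t, c, e) \<in> set es \<Longrightarrow> c \<ge> 0 \<Longrightarrow> e \<ge> 0 \<Longrightarrow> class_card t * c = class_card s * e"
    using 2(3) by (meson list.set_intros(2))
  consider (fwd) "s \<in> set ts \<and> c \<noteq> 0" | (bwd) "\<not> (s \<in> set ts \<and> c \<noteq> 0)" "t' \<in> set ts \<and> e \<noteq> 0"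
    | (none) "\<not> (s \<in> set ts \<and> c \<noteq> 0)" "\<not> (t' \<in> set ts \<and> e \<noteq> 0)" by blast
  then show ?case
  proof cases
    case fwd
    have "class_card t' * c = bases_entry tab t' * c" using eq 2(4)[of s] fwd ce(3) by simp
    then have "class_card t' = bases_entry tab t'" using fwd by simp
    then show ?thesis using 2(1)[OF rej fwd prem] 2(4,5) rej fwd by auto
  next
    case bwd
    have "class_card s * e = bases_entry tab s * e" using eq 2(4)[of t'] bwd ce(3) by simp
    then have "class_card s = bases_entry tab s" using bwd by simp
    then show ?thesis using 2(2)[OF rej bwd prem] 2(4,5) rej bwd by auto
  next
    case none
    then show ?thesis using 2(5) rej by (auto split: if_splits)
  qed
qed simp

lemma class_card_empty: "class_card (0, 0, 0) = 1"
proof -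
  have "base_class moments (scaled (0, 0, 0)) = {{}}"
  proof (intro equalityI subsetI)
    fix B assume "B \<in> base_class moments (scaled (0, 0, 0))"
    then have B: "parabolic_base B" "card B = 0"
      by (auto simp: base_class_def moments_def scaled_def Let_def)
    then have "finite B" using parabolic_base_roots finite_roots finite_subset by metis
    then show "B \<in> {{}}" using B(2) by simp
  next
    fix B assume "B \<in> {{}::'a set}"
    then show "B \<in> base_class moments (scaled (0, 0, 0))"
      using parabolic_base_simple[of "{}"]
      by (simp add: base_class_def moments_def scaled_def Let_def)
  qed
  then show ?thesis by (simp add: class_card_def)
qed

text \<open>
  The checks establish the hypotheses of \<open>order_arrangement_monoid_by_class\<close>: the stabilizer orders by
  \<open>card_parabolic_table\<close> and the class sizes by \<open>propagate_class_card\<close>.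
\<close>
theorem order_by_certificate:
  assumes chk: "check_roots Ct Ls" and T: "correct_test T"
    and comps: "list_all (check_component (with_products G (signed_list Ls))) comps"
    and ord: "list_all (check_order G tab comps) (masks n)"
    and down: "list_all (check_down G edges) (masks n)"
    and up: "list_all (check_up T G (with_products G (signed_list Ls)) edges) (masks n)"
    and tab: "check_table tab edges"
    and tot: "check_total tab (order_entry tab (simple_moments G (replicate n True)))"
  shows "int (Coset.order (arrangement_monoid \<Phi>)) =
    table_total tab (order_entry tab (simple_moments G (replicate n True)))"
proof -
  let ?w = "order_entry tab (simple_moments G (replicate n True))"
  define b where "b \<tau> = nat (order_entry tab (inv_into UNIV scaled \<tau>))" for \<tau>
  have inj: "inj scaled" using scaled_eq_iff by (intro injI) blast
  have b: "b (scaled t) = nat (order_entry tab t)" for t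
    unfolding b_def inv_f_f[OF inj] ..
  let ?D = "set (map fst tab)"
  have memK: "moments K \<in> scaled ` ?D \<and> card (parabolic K) = b (moments K)" if K: "K \<subseteq> set \<alpha>" for K
  proof -
    obtain J where J: "length J = n" "K = selected J" using selected_cases K by blast
    have "check_order G tab comps J" using ord J(1) by (simp add: list_all_iff set_masks)
    then have "simple_moments G J \<in> ?D" by (auto simp: check_order_def map_of_eq_None_iff)
    moreover have "card (parabolic K) = nat (order_entry tab (simple_moments G J))"
      using card_parabolic_table[OF chk comps ord J(1)] J(2) by (metis nat_int)
    ultimately show ?thesis unfolding J(2) moments_selected[OF J(1)] b by blast
  qed
  have W: "int (b (moments (set \<alpha>))) = ?w"
  proof -
    have "set \<alpha> \<subseteq> selected (replicate n True)"
    proof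
      fix x assume "x \<in> set \<alpha>"
      then obtain i where "i < n" "x = \<alpha> ! i" by (auto simp: in_set_conv_nth)
      then show "x \<in> selected (replicate n True)" using nth_in_selected[of i "replicate n True"] by simp
    qed
    then have "selected (replicate n True) = set \<alpha>" using selected_subset by blast
    then show ?thesis
      using memK[of "set \<alpha>"] card_parabolic_table[OF chk comps ord, of "replicate n True"] by simp
  qed
  have cls: "class_card t = bases_entry tab t" if t: "t \<in> ?D" for t
  proof (rule propagate_class_card)
    show "t \<in> set (propagate tab [(0, 0, 0)] edges)"
      using tab t unfolding check_table_def list_all_iff by blast
    show "class_card t' = bases_entry tab t'" if "t' \<in> set [(0, 0, 0)]" for t'
      using that class_card_empty tab by (simp add: check_table_def)
    show "\<And>s t c e. (s, t, c, e) \<in> set edges \<Longrightarrow> c \<ge> 0 \<Longrightarrow> e \<ge> 0 \<Longrightarrow> class_card t * c = class_card s * e"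
      using class_card_edge[OF chk T down up] .
  qed
  have dist: "distinct (map fst tab)" using tab by (simp add: check_table_def)
  have summand: "real (card (base_class moments (scaled (fst p)))) * real (b (moments (set \<alpha>))) / (real (b (scaled (fst p))))\<^sup>2
     = real_of_int (case p of (t, u, b) \<Rightarrow> u * ?w div (b * b))" if p: "p \<in> set tab" for p
  proof -
    obtain t u c where pe: "p = (t, u, c)" by (metis prod_cases3)
    have mo: "map_of tab t = Some (u, c)" using p pe dist by (simp add: map_of_is_SomeI)
    have tD: "t \<in> ?D" using p pe by force
    have u: "int (card (base_class moments (scaled t))) = u"
      using cls[OF tD] mo by (simp add: class_card_def bases_entry_def)
    have c0: "0 < c" and dv: "u * ?w mod (c * c) = 0"
      using tot p unfolding check_total_def list_all_iff pe by auto
    have "b (scaled t) = nat c" using b mo by (simp add: order_entry_def)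
    then have bt: "real (b (scaled t)) = of_int c" using c0 by simp
    have u': "real (card (base_class moments (scaled t))) = of_int u" using u by (metis of_int_of_nat_eq)
    have w': "real (b (moments (set \<alpha>))) = of_int ?w" using W by (metis of_int_of_nat_eq)
    have "real_of_int (u * ?w div (c * c)) = real_of_int (u * ?w) / real_of_int (c * c)"
      using dv by (intro real_of_int_div) auto
    then show ?thesis unfolding pe fst_conv prod.case u' w' bt by (simp add: power2_eq_square)
  qed
  have "real (Coset.order (arrangement_monoid \<Phi>)) =
    (\<Sum>\<tau>\<in>scaled ` ?D. real (card (base_class moments \<tau>)) * real (b (moments (set \<alpha>))) / (real (b \<tau>))\<^sup>2)"
    by (rule order_arrangement_monoid_by_class) (use memK in \<open>auto intro: moments_image\<close>)
  also have "\<dots> = (\<Sum>t\<in>?D. real (card (base_class moments (scaled t))) * real (b (moments (set \<alpha>))) / (real (b (scaled t)))\<^sup>2)"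
    by (subst sum.reindex) (use inj in \<open>auto intro: inj_on_subset\<close>)
  also have "\<dots> = (\<Sum>p\<in>set tab. real (card (base_class moments (scaled (fst p)))) * real (b (moments (set \<alpha>))) / (real (b (scaled (fst p))))\<^sup>2)"
  proof -
    have "inj_on fst (set tab)" using dist by (simp add: distinct_map)
    then show ?thesis unfolding set_map by (subst sum.reindex) simp_all
  qed
  also have "\<dots> = (\<Sum>p\<in>set tab. real_of_int (case p of (t, u, b) \<Rightarrow> u * ?w div (b * b)))"
    by (intro sum.cong refl) (rule summand)
  also have "\<dots> = real_of_int (\<Sum>p\<in>set tab. case p of (t, u, b) \<Rightarrow> u * ?w div (b * b))" by simp
  also have "(\<Sum>p\<in>set tab. case p of (t, u, b) \<Rightarrow> u * ?w div (b * b)) = table_total tab ?w"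
    unfolding table_total_def using dist by (subst sum_list_distinct_conv_sum_set) (auto simp: distinct_map)
  finally show ?thesis by (metis of_int_eq_iff of_int_of_nat_eq)
qed

end

section \<open>Certificates for the exceptional types\<close>

text \<open>
  Gram matrices of the simple roots, scaled such that the short roots have squared length 2.
\<close>
fun gram :: "exceptional_type \<Rightarrow> int list list" where
  "gram G2 =
     [[2, -3], [-3, 6]]"
| "gram F4 =
     [[4, -2, 0, 0], [-2, 4, -2, 0], [0, -2, 2, -1], [0, 0, -1, 2]]"
| "gram E6 =
     [[2, 0, -1, 0, 0, 0], [0, 2, 0, -1, 0, 0], [-1, 0, 2, -1, 0, 0], [0, -1, -1, 2, -1, 0],
      [0, 0, 0, -1, 2, -1], [0, 0, 0, 0, -1, 2]]"
| "gram E7 =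
     [[2, 0, -1, 0, 0, 0, 0], [0, 2, 0, -1, 0, 0, 0], [-1, 0, 2, -1, 0, 0, 0], [0, -1, -1, 2, -1, 0, 0],
      [0, 0, 0, -1, 2, -1, 0], [0, 0, 0, 0, -1, 2, -1], [0, 0, 0, 0, 0, -1, 2]]"
| "gram E8 =
     [[2, 0, -1, 0, 0, 0, 0, 0], [0, 2, 0, -1, 0, 0, 0, 0], [-1, 0, 2, -1, 0, 0, 0, 0],
      [0, -1, -1, 2, -1, 0, 0, 0], [0, 0, 0, -1, 2, -1, 0, 0], [0, 0, 0, 0, -1, 2, -1, 0],
      [0, 0, 0, 0, 0, -1, 2, -1], [0, 0, 0, 0, 0, 0, -1, 2]]"

text \<open>
  A spanning tree of the Dynkin diagram, grown from the first node.
\<close>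
fun diagram_edges :: "exceptional_type \<Rightarrow> (nat \<times> nat) list" where
  "diagram_edges G2 =
     [(0, 1)]"
| "diagram_edges F4 =
     [(0, 1), (1, 2), (2, 3)]"
| "diagram_edges E6 =
     [(0, 2), (2, 3), (3, 1), (3, 4), (4, 5)]"
| "diagram_edges E7 =
     [(0, 2), (2, 3), (3, 1), (3, 4), (4, 5), (5, 6)]"
| "diagram_edges E8 =
     [(0, 2), (2, 3), (3, 1), (3, 4), (4, 5), (5, 6), (6, 7)]"

text \<open>
  Coefficients with respect to the simple roots, grouped by height.
\<close>
fun positive_roots :: "exceptional_type \<Rightarrow> int list list list" where
  "positive_roots G2 =
     [[[1, 0], [0, 1]], [[1, 1]], [[2, 1]], [[3, 1]], [[3, 2]]]"
| "positive_roots F4 =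
     [[[1, 0, 0, 0], [0, 1, 0, 0], [0, 0, 1, 0], [0, 0, 0, 1]], [[1, 1, 0, 0], [0, 1, 1, 0], [0, 0, 1, 1]],
      [[1, 1, 1, 0], [0, 1, 2, 0], [0, 1, 1, 1]], [[1, 1, 2, 0], [1, 1, 1, 1], [0, 1, 2, 1]], [[1, 2, 2, 0],
      [1, 1, 2, 1], [0, 1, 2, 2]], [[1, 2, 2, 1], [1, 1, 2, 2]], [[1, 2, 3, 1], [1, 2, 2, 2]], [[1, 2, 3, 2]],
      [[1, 2, 4, 2]], [[1, 3, 4, 2]], [[2, 3, 4, 2]]]"
| "positive_roots E6 =
     [[[1, 0, 0, 0, 0, 0], [0, 1, 0, 0, 0, 0], [0, 0, 1, 0, 0, 0], [0, 0, 0, 1, 0, 0], [0, 0, 0, 0, 1, 0],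
      [0, 0, 0, 0, 0, 1]], [[1, 0, 1, 0, 0, 0], [0, 1, 0, 1, 0, 0], [0, 0, 1, 1, 0, 0], [0, 0, 0, 1, 1, 0],
      [0, 0, 0, 0, 1, 1]], [[1, 0, 1, 1, 0, 0], [0, 1, 1, 1, 0, 0], [0, 1, 0, 1, 1, 0], [0, 0, 1, 1, 1, 0],
      [0, 0, 0, 1, 1, 1]], [[1, 1, 1, 1, 0, 0], [1, 0, 1, 1, 1, 0], [0, 1, 1, 1, 1, 0], [0, 1, 0, 1, 1, 1],
      [0, 0, 1, 1, 1, 1]], [[1, 1, 1, 1, 1, 0], [1, 0, 1, 1, 1, 1], [0, 1, 1, 2, 1, 0], [0, 1, 1, 1, 1, 1]],
      [[1, 1, 1, 2, 1, 0], [1, 1, 1, 1, 1, 1], [0, 1, 1, 2, 1, 1]], [[1, 1, 2, 2, 1, 0], [1, 1, 1, 2, 1, 1],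
      [0, 1, 1, 2, 2, 1]], [[1, 1, 2, 2, 1, 1], [1, 1, 1, 2, 2, 1]], [[1, 1, 2, 2, 2, 1]],
      [[1, 1, 2, 3, 2, 1]], [[1, 2, 2, 3, 2, 1]]]"
| "positive_roots E7 =
     [[[1, 0, 0, 0, 0, 0, 0], [0, 1, 0, 0, 0, 0, 0], [0, 0, 1, 0, 0, 0, 0], [0, 0, 0, 1, 0, 0, 0],
      [0, 0, 0, 0, 1, 0, 0], [0, 0, 0, 0, 0, 1, 0], [0, 0, 0, 0, 0, 0, 1]], [[1, 0, 1, 0, 0, 0, 0],
      [0, 1, 0, 1, 0, 0, 0], [0, 0, 1, 1, 0, 0, 0], [0, 0, 0, 1, 1, 0, 0], [0, 0, 0, 0, 1, 1, 0],
      [0, 0, 0, 0, 0, 1, 1]], [[1, 0, 1, 1, 0, 0, 0], [0, 1, 1, 1, 0, 0, 0], [0, 1, 0, 1, 1, 0, 0],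
      [0, 0, 1, 1, 1, 0, 0], [0, 0, 0, 1, 1, 1, 0], [0, 0, 0, 0, 1, 1, 1]], [[1, 1, 1, 1, 0, 0, 0],
      [1, 0, 1, 1, 1, 0, 0], [0, 1, 1, 1, 1, 0, 0], [0, 1, 0, 1, 1, 1, 0], [0, 0, 1, 1, 1, 1, 0],
      [0, 0, 0, 1, 1, 1, 1]], [[1, 1, 1, 1, 1, 0, 0], [1, 0, 1, 1, 1, 1, 0], [0, 1, 1, 2, 1, 0, 0],
      [0, 1, 1, 1, 1, 1, 0], [0, 1, 0, 1, 1, 1, 1], [0, 0, 1, 1, 1, 1, 1]], [[1, 1, 1, 2, 1, 0, 0],
      [1, 1, 1, 1, 1, 1, 0], [1, 0, 1, 1, 1, 1, 1], [0, 1, 1, 2, 1, 1, 0], [0, 1, 1, 1, 1, 1, 1]],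
      [[1, 1, 2, 2, 1, 0, 0], [1, 1, 1, 2, 1, 1, 0], [1, 1, 1, 1, 1, 1, 1], [0, 1, 1, 2, 2, 1, 0],
      [0, 1, 1, 2, 1, 1, 1]], [[1, 1, 2, 2, 1, 1, 0], [1, 1, 1, 2, 2, 1, 0], [1, 1, 1, 2, 1, 1, 1],
      [0, 1, 1, 2, 2, 1, 1]], [[1, 1, 2, 2, 2, 1, 0], [1, 1, 2, 2, 1, 1, 1], [1, 1, 1, 2, 2, 1, 1],
      [0, 1, 1, 2, 2, 2, 1]], [[1, 1, 2, 3, 2, 1, 0], [1, 1, 2, 2, 2, 1, 1], [1, 1, 1, 2, 2, 2, 1]],
      [[1, 2, 2, 3, 2, 1, 0], [1, 1, 2, 3, 2, 1, 1], [1, 1, 2, 2, 2, 2, 1]], [[1, 2, 2, 3, 2, 1, 1],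
      [1, 1, 2, 3, 2, 2, 1]], [[1, 2, 2, 3, 2, 2, 1], [1, 1, 2, 3, 3, 2, 1]], [[1, 2, 2, 3, 3, 2, 1]],
      [[1, 2, 2, 4, 3, 2, 1]], [[1, 2, 3, 4, 3, 2, 1]], [[2, 2, 3, 4, 3, 2, 1]]]"
| "positive_roots E8 =
     [[[1, 0, 0, 0, 0, 0, 0, 0], [0, 1, 0, 0, 0, 0, 0, 0], [0, 0, 1, 0, 0, 0, 0, 0], [0, 0, 0, 1, 0, 0, 0, 0],
      [0, 0, 0, 0, 1, 0, 0, 0], [0, 0, 0, 0, 0, 1, 0, 0], [0, 0, 0, 0, 0, 0, 1, 0], [0, 0, 0, 0, 0, 0, 0, 1]],
      [[1, 0, 1, 0, 0, 0, 0, 0], [0, 1, 0, 1, 0, 0, 0, 0], [0, 0, 1, 1, 0, 0, 0, 0], [0, 0, 0, 1, 1, 0, 0, 0],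
      [0, 0, 0, 0, 1, 1, 0, 0], [0, 0, 0, 0, 0, 1, 1, 0], [0, 0, 0, 0, 0, 0, 1, 1]],
      [[1, 0, 1, 1, 0, 0, 0, 0], [0, 1, 1, 1, 0, 0, 0, 0], [0, 1, 0, 1, 1, 0, 0, 0], [0, 0, 1, 1, 1, 0, 0, 0],
      [0, 0, 0, 1, 1, 1, 0, 0], [0, 0, 0, 0, 1, 1, 1, 0], [0, 0, 0, 0, 0, 1, 1, 1]],
      [[1, 1, 1, 1, 0, 0, 0, 0], [1, 0, 1, 1, 1, 0, 0, 0], [0, 1, 1, 1, 1, 0, 0, 0], [0, 1, 0, 1, 1, 1, 0, 0],
      [0, 0, 1, 1, 1, 1, 0, 0], [0, 0, 0, 1, 1, 1, 1, 0], [0, 0, 0, 0, 1, 1, 1, 1]],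
      [[1, 1, 1, 1, 1, 0, 0, 0], [1, 0, 1, 1, 1, 1, 0, 0], [0, 1, 1, 2, 1, 0, 0, 0], [0, 1, 1, 1, 1, 1, 0, 0],
      [0, 1, 0, 1, 1, 1, 1, 0], [0, 0, 1, 1, 1, 1, 1, 0], [0, 0, 0, 1, 1, 1, 1, 1]],
      [[1, 1, 1, 2, 1, 0, 0, 0], [1, 1, 1, 1, 1, 1, 0, 0], [1, 0, 1, 1, 1, 1, 1, 0], [0, 1, 1, 2, 1, 1, 0, 0],
      [0, 1, 1, 1, 1, 1, 1, 0], [0, 1, 0, 1, 1, 1, 1, 1], [0, 0, 1, 1, 1, 1, 1, 1]],
      [[1, 1, 2, 2, 1, 0, 0, 0], [1, 1, 1, 2, 1, 1, 0, 0], [1, 1, 1, 1, 1, 1, 1, 0], [1, 0, 1, 1, 1, 1, 1, 1],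
      [0, 1, 1, 2, 2, 1, 0, 0], [0, 1, 1, 2, 1, 1, 1, 0], [0, 1, 1, 1, 1, 1, 1, 1]],
      [[1, 1, 2, 2, 1, 1, 0, 0], [1, 1, 1, 2, 2, 1, 0, 0], [1, 1, 1, 2, 1, 1, 1, 0], [1, 1, 1, 1, 1, 1, 1, 1],
      [0, 1, 1, 2, 2, 1, 1, 0], [0, 1, 1, 2, 1, 1, 1, 1]], [[1, 1, 2, 2, 2, 1, 0, 0],
      [1, 1, 2, 2, 1, 1, 1, 0], [1, 1, 1, 2, 2, 1, 1, 0], [1, 1, 1, 2, 1, 1, 1, 1], [0, 1, 1, 2, 2, 2, 1, 0],
      [0, 1, 1, 2, 2, 1, 1, 1]], [[1, 1, 2, 3, 2, 1, 0, 0], [1, 1, 2, 2, 2, 1, 1, 0],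
      [1, 1, 2, 2, 1, 1, 1, 1], [1, 1, 1, 2, 2, 2, 1, 0], [1, 1, 1, 2, 2, 1, 1, 1], [0, 1, 1, 2, 2, 2, 1, 1]],
      [[1, 2, 2, 3, 2, 1, 0, 0], [1, 1, 2, 3, 2, 1, 1, 0], [1, 1, 2, 2, 2, 2, 1, 0], [1, 1, 2, 2, 2, 1, 1, 1],
      [1, 1, 1, 2, 2, 2, 1, 1], [0, 1, 1, 2, 2, 2, 2, 1]], [[1, 2, 2, 3, 2, 1, 1, 0],
      [1, 1, 2, 3, 2, 2, 1, 0], [1, 1, 2, 3, 2, 1, 1, 1], [1, 1, 2, 2, 2, 2, 1, 1], [1, 1, 1, 2, 2, 2, 2, 1]],
      [[1, 2, 2, 3, 2, 2, 1, 0], [1, 2, 2, 3, 2, 1, 1, 1], [1, 1, 2, 3, 3, 2, 1, 0], [1, 1, 2, 3, 2, 2, 1, 1],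
      [1, 1, 2, 2, 2, 2, 2, 1]], [[1, 2, 2, 3, 3, 2, 1, 0], [1, 2, 2, 3, 2, 2, 1, 1],
      [1, 1, 2, 3, 3, 2, 1, 1], [1, 1, 2, 3, 2, 2, 2, 1]], [[1, 2, 2, 4, 3, 2, 1, 0],
      [1, 2, 2, 3, 3, 2, 1, 1], [1, 2, 2, 3, 2, 2, 2, 1], [1, 1, 2, 3, 3, 2, 2, 1]],
      [[1, 2, 3, 4, 3, 2, 1, 0], [1, 2, 2, 4, 3, 2, 1, 1], [1, 2, 2, 3, 3, 2, 2, 1],
      [1, 1, 2, 3, 3, 3, 2, 1]], [[2, 2, 3, 4, 3, 2, 1, 0], [1, 2, 3, 4, 3, 2, 1, 1],
      [1, 2, 2, 4, 3, 2, 2, 1], [1, 2, 2, 3, 3, 3, 2, 1]], [[2, 2, 3, 4, 3, 2, 1, 1],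
      [1, 2, 3, 4, 3, 2, 2, 1], [1, 2, 2, 4, 3, 3, 2, 1]], [[2, 2, 3, 4, 3, 2, 2, 1],
      [1, 2, 3, 4, 3, 3, 2, 1], [1, 2, 2, 4, 4, 3, 2, 1]], [[2, 2, 3, 4, 3, 3, 2, 1],
      [1, 2, 3, 4, 4, 3, 2, 1]], [[2, 2, 3, 4, 4, 3, 2, 1], [1, 2, 3, 5, 4, 3, 2, 1]],
      [[2, 2, 3, 5, 4, 3, 2, 1], [1, 3, 3, 5, 4, 3, 2, 1]], [[2, 3, 3, 5, 4, 3, 2, 1],
      [2, 2, 4, 5, 4, 3, 2, 1]], [[2, 3, 4, 5, 4, 3, 2, 1]], [[2, 3, 4, 6, 4, 3, 2, 1]],
      [[2, 3, 4, 6, 5, 3, 2, 1]], [[2, 3, 4, 6, 5, 4, 2, 1]], [[2, 3, 4, 6, 5, 4, 3, 1]],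
      [[2, 3, 4, 6, 5, 4, 3, 2]]]"

text \<open>
  For each connected subdiagram: its nodes, the squared length of its highest root, the number of its roots
  of this length, and the simple roots of the whole system that are orthogonal to the highest root.
\<close>
fun components :: "exceptional_type \<Rightarrow> (nat list \<times> int \<times> int \<times> nat list) list" where
  "components G2 =
     [([0], 2, 2, []), ([1], 6, 2, []), ([0, 1], 6, 6, [0])]"
| "components F4 =
     [([0], 4, 2, [2, 3]), ([1], 4, 2, [3]), ([2], 2, 2, [0]), ([3], 2, 2, [0, 1]), ([0, 1], 4, 6, [3]),
      ([1, 2], 4, 4, [1]), ([2, 3], 2, 6, [0]), ([0, 1, 2], 4, 12, [0, 2]), ([1, 2, 3], 4, 6, [1, 2]),
      ([0, 1, 2, 3], 4, 24, [1, 2, 3])]"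
| "components E6 =
     [([0], 2, 2, [1, 3, 4, 5]), ([1], 2, 2, [0, 2, 4, 5]), ([2], 2, 2, [1, 4, 5]), ([3], 2, 2, [0, 5]),
      ([4], 2, 2, [0, 1, 2]), ([5], 2, 2, [0, 1, 2, 3]), ([0, 2], 2, 6, [1, 4, 5]), ([1, 3], 2, 6, [0, 5]),
      ([2, 3], 2, 6, [5]), ([3, 4], 2, 6, [0]), ([4, 5], 2, 6, [0, 1, 2]), ([0, 2, 3], 2, 12, [2, 5]),
      ([1, 2, 3], 2, 12, [3, 5]), ([1, 3, 4], 2, 12, [0, 3]), ([2, 3, 4], 2, 12, [3]),
      ([3, 4, 5], 2, 12, [0, 4]), ([0, 1, 2, 3], 2, 20, [2, 3, 5]), ([0, 2, 3, 4], 2, 20, [2, 3]),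
      ([1, 2, 3, 4], 2, 24, [1, 2, 4]), ([1, 3, 4, 5], 2, 20, [0, 3, 4]), ([2, 3, 4, 5], 2, 20, [3, 4]),
      ([0, 1, 2, 3, 4], 2, 40, [0, 1, 3, 4]), ([0, 2, 3, 4, 5], 2, 30, [2, 3, 4]),
      ([1, 2, 3, 4, 5], 2, 40, [1, 2, 3, 5]), ([0, 1, 2, 3, 4, 5], 2, 72, [0, 2, 3, 4, 5])]"
| "components E7 =
     [([0], 2, 2, [1, 3, 4, 5, 6]), ([1], 2, 2, [0, 2, 4, 5, 6]), ([2], 2, 2, [1, 4, 5, 6]),
      ([3], 2, 2, [0, 5, 6]), ([4], 2, 2, [0, 1, 2, 6]), ([5], 2, 2, [0, 1, 2, 3]),
      ([6], 2, 2, [0, 1, 2, 3, 4]), ([0, 2], 2, 6, [1, 4, 5, 6]), ([1, 3], 2, 6, [0, 5, 6]),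
      ([2, 3], 2, 6, [5, 6]), ([3, 4], 2, 6, [0, 6]), ([4, 5], 2, 6, [0, 1, 2]), ([5, 6], 2, 6, [0, 1, 2, 3]),
      ([0, 2, 3], 2, 12, [2, 5, 6]), ([1, 2, 3], 2, 12, [3, 5, 6]), ([1, 3, 4], 2, 12, [0, 3, 6]),
      ([2, 3, 4], 2, 12, [3, 6]), ([3, 4, 5], 2, 12, [0, 4]), ([4, 5, 6], 2, 12, [0, 1, 2, 5]),
      ([0, 1, 2, 3], 2, 20, [2, 3, 5, 6]), ([0, 2, 3, 4], 2, 20, [2, 3, 6]),
      ([1, 2, 3, 4], 2, 24, [1, 2, 4, 6]), ([1, 3, 4, 5], 2, 20, [0, 3, 4]), ([2, 3, 4, 5], 2, 20, [3, 4]),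
      ([3, 4, 5, 6], 2, 20, [0, 4, 5]), ([0, 1, 2, 3, 4], 2, 40, [0, 1, 3, 4, 6]),
      ([0, 2, 3, 4, 5], 2, 30, [2, 3, 4]), ([1, 2, 3, 4, 5], 2, 40, [1, 2, 3, 5]),
      ([1, 3, 4, 5, 6], 2, 30, [0, 3, 4, 5]), ([2, 3, 4, 5, 6], 2, 30, [3, 4, 5]),
      ([0, 1, 2, 3, 4, 5], 2, 72, [0, 2, 3, 4, 5]), ([0, 2, 3, 4, 5, 6], 2, 42, [2, 3, 4, 5]),
      ([1, 2, 3, 4, 5, 6], 2, 60, [1, 2, 3, 4, 6]), ([0, 1, 2, 3, 4, 5, 6], 2, 126, [1, 2, 3, 4, 5, 6])]"
| "components E8 =
     [([0], 2, 2, [1, 3, 4, 5, 6, 7]), ([1], 2, 2, [0, 2, 4, 5, 6, 7]), ([2], 2, 2, [1, 4, 5, 6, 7]),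
      ([3], 2, 2, [0, 5, 6, 7]), ([4], 2, 2, [0, 1, 2, 6, 7]), ([5], 2, 2, [0, 1, 2, 3, 7]),
      ([6], 2, 2, [0, 1, 2, 3, 4]), ([7], 2, 2, [0, 1, 2, 3, 4, 5]), ([0, 2], 2, 6, [1, 4, 5, 6, 7]),
      ([1, 3], 2, 6, [0, 5, 6, 7]), ([2, 3], 2, 6, [5, 6, 7]), ([3, 4], 2, 6, [0, 6, 7]),
      ([4, 5], 2, 6, [0, 1, 2, 7]), ([5, 6], 2, 6, [0, 1, 2, 3]), ([6, 7], 2, 6, [0, 1, 2, 3, 4]),
      ([0, 2, 3], 2, 12, [2, 5, 6, 7]), ([1, 2, 3], 2, 12, [3, 5, 6, 7]), ([1, 3, 4], 2, 12, [0, 3, 6, 7]),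
      ([2, 3, 4], 2, 12, [3, 6, 7]), ([3, 4, 5], 2, 12, [0, 4, 7]), ([4, 5, 6], 2, 12, [0, 1, 2, 5]),
      ([5, 6, 7], 2, 12, [0, 1, 2, 3, 6]), ([0, 1, 2, 3], 2, 20, [2, 3, 5, 6, 7]),
      ([0, 2, 3, 4], 2, 20, [2, 3, 6, 7]), ([1, 2, 3, 4], 2, 24, [1, 2, 4, 6, 7]),
      ([1, 3, 4, 5], 2, 20, [0, 3, 4, 7]), ([2, 3, 4, 5], 2, 20, [3, 4, 7]), ([3, 4, 5, 6], 2, 20, [0, 4, 5]),
      ([4, 5, 6, 7], 2, 20, [0, 1, 2, 5, 6]), ([0, 1, 2, 3, 4], 2, 40, [0, 1, 3, 4, 6, 7]),
      ([0, 2, 3, 4, 5], 2, 30, [2, 3, 4, 7]), ([1, 2, 3, 4, 5], 2, 40, [1, 2, 3, 5, 7]),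
      ([1, 3, 4, 5, 6], 2, 30, [0, 3, 4, 5]), ([2, 3, 4, 5, 6], 2, 30, [3, 4, 5]),
      ([3, 4, 5, 6, 7], 2, 30, [0, 4, 5, 6]), ([0, 1, 2, 3, 4, 5], 2, 72, [0, 2, 3, 4, 5, 7]),
      ([0, 2, 3, 4, 5, 6], 2, 42, [2, 3, 4, 5]), ([1, 2, 3, 4, 5, 6], 2, 60, [1, 2, 3, 4, 6]),
      ([1, 3, 4, 5, 6, 7], 2, 42, [0, 3, 4, 5, 6]), ([2, 3, 4, 5, 6, 7], 2, 42, [3, 4, 5, 6]),
      ([0, 1, 2, 3, 4, 5, 6], 2, 126, [1, 2, 3, 4, 5, 6]), ([0, 2, 3, 4, 5, 6, 7], 2, 56, [2, 3, 4, 5, 6]),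
      ([1, 2, 3, 4, 5, 6, 7], 2, 84, [1, 2, 3, 4, 5, 7]),
      ([0, 1, 2, 3, 4, 5, 6, 7], 2, 240, [0, 1, 2, 3, 4, 5, 6])]"

text \<open>
  Each entry gives the moments of a class, the number of its parabolic bases, and the order of the pointwise
  stabilizer of their orthogonal complements.
\<close>
fun class_table :: "exceptional_type \<Rightarrow> moment_table" where
  "class_table G2 =
     [((0, 0, 0), 1, 1), ((1, 8, 8), 6, 2), ((1, 216, 216), 6, 2), ((2, 26, 74), 12, 12)]"
| "class_table F4 =
     [((0, 0, 0), 1, 1), ((1, 8, 8), 24, 2), ((1, 64, 64), 24, 2), ((2, 2, 2), 96, 6), ((2, 8, 16), 144, 8),
      ((2, 16, 16), 96, 6), ((2, 72, 72), 288, 4), ((3, 8, 16), 576, 48), ((3, 8, 30), 576, 48),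
      ((3, 24, 24), 576, 12), ((3, 66, 66), 576, 12), ((4, 8, 22), 1152, 1152)]"
| "class_table E6 =
     [((0, 0, 0), 1, 1), ((1, 8, 8), 72, 2), ((2, 2, 2), 720, 6), ((2, 16, 16), 1080, 4),
      ((3, 2, 4), 6480, 24), ((3, 10, 10), 8640, 12), ((3, 24, 24), 4320, 8), ((4, 2, 4), 25920, 120),
      ((4, 2, 14), 8640, 192), ((4, 4, 4), 4320, 36), ((4, 10, 12), 25920, 48), ((4, 18, 18), 25920, 24),
      ((5, 2, 4), 25920, 720), ((5, 2, 12), 51840, 1920), ((5, 10, 12), 51840, 240), ((5, 12, 12), 25920, 72),
      ((6, 2, 10), 51840, 51840)]"
| "class_table E7 =
     [((0, 0, 0), 1, 1), ((1, 8, 8), 126, 2), ((2, 2, 2), 2016, 6), ((2, 16, 16), 3780, 4),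
      ((3, 2, 4), 30240, 24), ((3, 10, 10), 60480, 12), ((3, 24, 24), 32760, 8), ((4, 2, 4), 241920, 120),
      ((4, 2, 14), 60480, 192), ((4, 4, 4), 120960, 36), ((4, 10, 12), 423360, 48), ((4, 18, 18), 362880, 24),
      ((4, 32, 32), 60480, 16), ((5, 2, 4), 967680, 720), ((5, 2, 12), 725760, 1920),
      ((5, 4, 6), 725760, 144), ((5, 10, 12), 1451520, 240), ((5, 10, 22), 362880, 384),
      ((5, 12, 12), 725760, 72), ((5, 18, 20), 725760, 96), ((5, 26, 26), 241920, 48),
      ((6, 2, 4), 1451520, 5040), ((6, 2, 10), 1451520, 51840), ((6, 2, 12), 1451520, 23040),
      ((6, 4, 6), 1451520, 720), ((6, 10, 12), 1451520, 1440), ((6, 10, 20), 1451520, 3840),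
      ((6, 12, 14), 1451520, 288), ((7, 2, 10), 2903040, 2903040)]"
| "class_table E8 =
     [((0, 0, 0), 1, 1), ((1, 8, 8), 240, 2), ((2, 2, 2), 6720, 6), ((2, 16, 16), 15120, 4),
      ((3, 2, 4), 181440, 24), ((3, 10, 10), 483840, 12), ((3, 24, 24), 302400, 8), ((4, 2, 4), 2903040, 120),
      ((4, 2, 14), 604800, 192), ((4, 4, 4), 2419200, 36), ((4, 10, 12), 7257600, 48),
      ((4, 18, 18), 7257600, 24), ((4, 32, 32), 1814400, 16), ((5, 2, 4), 29030400, 720),
      ((5, 2, 12), 14515200, 1920), ((5, 4, 6), 43545600, 144), ((5, 10, 12), 58060800, 240),
      ((5, 10, 22), 14515200, 384), ((5, 12, 12), 29030400, 72), ((5, 18, 20), 43545600, 96),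
      ((5, 26, 26), 29030400, 48), ((6, 2, 4), 174182400, 5040), ((6, 2, 10), 58060800, 51840),
      ((6, 2, 12), 87091200, 23040), ((6, 4, 6), 174182400, 720), ((6, 4, 8), 87091200, 576),
      ((6, 4, 16), 58060800, 1152), ((6, 10, 12), 174182400, 1440), ((6, 10, 20), 174182400, 3840),
      ((6, 12, 14), 174182400, 288), ((6, 18, 20), 174182400, 480), ((6, 20, 20), 87091200, 144),
      ((7, 2, 4), 348364800, 40320), ((7, 2, 10), 348364800, 2903040), ((7, 2, 12), 348364800, 322560),
      ((7, 4, 8), 348364800, 2880), ((7, 4, 14), 348364800, 11520), ((7, 10, 12), 348364800, 10080),
      ((7, 10, 18), 348364800, 103680), ((7, 12, 14), 348364800, 1440), ((8, 2, 10), 696729600, 696729600)]"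

text \<open>
  Entries \<open>(s, t, c, e)\<close> as in \<open>check_down\<close> and \<open>check_up\<close>. They form a spanning tree of the classes with few
  distinct \<open>s\<close>, as only sets of simple roots in such a class \<open>s\<close> require a search for extensions.
\<close>
fun incidences :: "exceptional_type \<Rightarrow> edge list" where
  "incidences G2 =
     [((0, 0, 0), (1, 8, 8), 1, 6), ((0, 0, 0), (1, 216, 216), 1, 6), ((1, 216, 216), (2, 26, 74), 1, 2)]"
| "incidences F4 =
     [((0, 0, 0), (1, 8, 8), 1, 24), ((0, 0, 0), (1, 64, 64), 1, 24), ((1, 64, 64), (2, 8, 16), 1, 6),
      ((1, 64, 64), (2, 16, 16), 2, 8), ((1, 64, 64), (2, 72, 72), 1, 12), ((2, 8, 16), (3, 8, 16), 1, 4),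
      ((2, 8, 16), (3, 8, 30), 1, 4), ((2, 2, 2), (3, 8, 30), 1, 6), ((2, 2, 2), (3, 66, 66), 1, 6),
      ((3, 66, 66), (4, 8, 22), 1, 2), ((3, 24, 24), (4, 8, 22), 1, 2)]"
| "incidences E6 =
     [((0, 0, 0), (1, 8, 8), 1, 72), ((1, 8, 8), (2, 2, 2), 2, 20), ((1, 8, 8), (2, 16, 16), 2, 30),
      ((2, 2, 2), (3, 2, 4), 2, 18), ((2, 2, 2), (3, 10, 10), 1, 12), ((3, 2, 4), (4, 2, 4), 2, 8),
      ((3, 2, 4), (4, 2, 14), 3, 4), ((3, 2, 4), (4, 10, 12), 1, 4), ((4, 2, 14), (5, 2, 12), 1, 6),
      ((5, 2, 12), (6, 2, 10), 2, 2), ((5, 10, 12), (6, 2, 10), 2, 2), ((5, 12, 12), (6, 2, 10), 1, 2),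
      ((3, 24, 24), (4, 2, 14), 1, 2), ((3, 24, 24), (4, 18, 18), 2, 12), ((4, 4, 4), (5, 12, 12), 1, 6),
      ((4, 4, 4), (5, 2, 4), 1, 6)]"
| "incidences E7 =
     [((0, 0, 0), (1, 8, 8), 1, 126), ((1, 8, 8), (2, 2, 2), 2, 32), ((1, 8, 8), (2, 16, 16), 2, 60),
      ((2, 16, 16), (3, 2, 4), 1, 8), ((2, 16, 16), (3, 10, 10), 2, 32), ((2, 16, 16), (3, 24, 24), 3, 26),
      ((3, 2, 4), (4, 2, 4), 2, 16), ((3, 2, 4), (4, 2, 14), 3, 6), ((3, 2, 4), (4, 10, 12), 1, 14),
      ((4, 2, 14), (5, 2, 12), 1, 12), ((4, 2, 14), (5, 10, 22), 1, 6), ((5, 10, 22), (6, 2, 12), 1, 4),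
      ((5, 10, 22), (6, 10, 20), 1, 4), ((6, 10, 20), (7, 2, 10), 1, 2), ((6, 4, 6), (7, 2, 10), 1, 2),
      ((6, 12, 14), (7, 2, 10), 1, 2), ((6, 10, 12), (7, 2, 10), 1, 2), ((6, 2, 4), (7, 2, 10), 1, 2),
      ((4, 18, 18), (5, 2, 12), 1, 2), ((4, 18, 18), (5, 4, 6), 1, 2), ((4, 18, 18), (5, 10, 12), 2, 8),
      ((4, 18, 18), (5, 12, 12), 4, 8), ((4, 18, 18), (5, 18, 20), 2, 4), ((4, 18, 18), (5, 26, 26), 3, 2),
      ((4, 32, 32), (5, 10, 22), 1, 6), ((4, 4, 4), (5, 4, 6), 2, 12), ((6, 2, 10), (7, 2, 10), 1, 2),
      ((4, 4, 4), (5, 2, 4), 1, 8)]"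
| "incidences E8 =
     [((0, 0, 0), (1, 8, 8), 1, 240), ((1, 8, 8), (2, 2, 2), 2, 56), ((1, 8, 8), (2, 16, 16), 2, 126),
      ((2, 2, 2), (3, 2, 4), 2, 54), ((2, 2, 2), (3, 10, 10), 1, 72), ((3, 2, 4), (4, 2, 4), 2, 32),
      ((3, 2, 4), (4, 2, 14), 3, 10), ((3, 2, 4), (4, 10, 12), 1, 40), ((4, 2, 4), (5, 2, 4), 2, 20),
      ((4, 2, 4), (5, 2, 12), 2, 10), ((4, 2, 4), (5, 10, 12), 1, 20), ((4, 4, 4), (5, 2, 4), 1, 12),
      ((4, 4, 4), (5, 4, 6), 2, 36), ((4, 4, 4), (5, 12, 12), 1, 12), ((4, 2, 14), (5, 10, 22), 1, 24),
      ((5, 10, 22), (6, 2, 12), 1, 6), ((5, 10, 22), (6, 4, 16), 2, 8), ((5, 10, 22), (6, 10, 20), 1, 12),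
      ((6, 2, 12), (7, 2, 10), 1, 4), ((6, 2, 12), (7, 2, 12), 1, 4), ((3, 24, 24), (4, 2, 14), 1, 2),
      ((3, 24, 24), (4, 18, 18), 2, 48), ((3, 24, 24), (4, 32, 32), 4, 24), ((5, 26, 26), (6, 4, 16), 1, 2),
      ((5, 26, 26), (6, 12, 14), 1, 6), ((5, 26, 26), (6, 18, 20), 2, 12), ((5, 26, 26), (6, 20, 20), 4, 12),
      ((5, 18, 20), (6, 2, 12), 1, 2), ((5, 18, 20), (6, 4, 8), 2, 4), ((5, 18, 20), (6, 10, 12), 2, 8),
      ((6, 2, 10), (7, 2, 10), 1, 6), ((6, 2, 10), (7, 10, 18), 1, 6), ((6, 4, 6), (7, 2, 10), 1, 2),
      ((6, 4, 6), (7, 4, 8), 2, 4), ((6, 4, 6), (7, 4, 14), 2, 4), ((6, 4, 6), (7, 12, 14), 1, 2),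
      ((6, 2, 4), (7, 2, 10), 1, 2), ((6, 2, 4), (7, 10, 12), 1, 2), ((7, 12, 14), (8, 2, 10), 1, 2),
      ((6, 4, 6), (7, 2, 4), 2, 4)]"

abbreviation rank :: "exceptional_type \<Rightarrow> nat" where
  "rank T \<equiv> length (cartan_matrix T)"

definition cartan_transpose :: "exceptional_type \<Rightarrow> int list list" where
  "cartan_transpose T = map (\<lambda>i. map (\<lambda>r. r ! i) (cartan_matrix T)) [0..<rank T]"

definition signed_roots :: "exceptional_type \<Rightarrow> (int list \<times> int list) list list" where
  "signed_roots T = with_products (gram T) (signed_list (positive_roots T))"

definition component_masks :: "exceptional_type \<Rightarrow> (bool list \<times> int \<times> int \<times> bool list) list" where
  "component_masks T = map (\<lambda>(C, N, m, Z).
     (map (\<lambda>i. i \<in> set C) [0..<rank T], N, m, map (\<lambda>i. i \<in> set Z) [0..<rank T])) (components T)"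

definition simply_laced :: "exceptional_type \<Rightarrow> bool" where
  "simply_laced T \<longleftrightarrow> list_all (\<lambda>i. gram T ! i ! i = 2) [0..<rank T]"

definition extension_test :: "exceptional_type \<Rightarrow> bool list \<Rightarrow> int list \<times> int list \<Rightarrow> bool" where
  "extension_test T = (if simply_laced T then simply_laced_test
     else coherence_test (concat (signed_list (positive_roots T))))"

text \<open>
  Nodes connected to \<open>ks\<close> by the edges; along an edge the Cartan matrix fixes the ratio of the lengths.
\<close>
fun reached :: "int list list \<Rightarrow> nat list \<Rightarrow> (nat \<times> nat) list \<Rightarrow> nat list" where
  "reached G ks [] = ks"
| "reached G ks ((i, j) # ps) =
     (if i \<in> set ks \<and> j < length G \<and> G ! i ! j \<noteq> 0 then reached G (j # ks) ps else [])"

definition check_gram :: "exceptional_type \<Rightarrow> bool" where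
  "check_gram T \<longleftrightarrow> (let n = rank T; C = cartan_matrix T; G = gram T in
     0 < n \<and> length G = n \<and> list_all (\<lambda>r. length r = n) G \<and>
     list_all (\<lambda>i. 0 < G ! i ! i \<and> i \<in> set (reached G [0] (diagram_edges T)) \<and>
       list_all (\<lambda>j. 2 * G ! i ! j = C ! i ! j * G ! j ! j \<and> G ! i ! j = G ! j ! i) [0..<n]) [0..<n])"

definition check_classes :: "exceptional_type \<Rightarrow> bool" where
  "check_classes T \<longleftrightarrow> (let w = order_entry (class_table T) (simple_moments (gram T) (replicate (rank T) True)) in
     check_table (class_table T) (incidences T) \<and> check_total (class_table T) w)"

definition monoid_order :: "exceptional_type \<Rightarrow> int" where
  "monoid_order T = table_total (class_table T)
     (order_entry (class_table T) (simple_moments (gram T) (replicate (rank T) True)))"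

definition check_setup :: "exceptional_type \<Rightarrow> bool" where
  "check_setup T \<longleftrightarrow> check_gram T \<and> check_roots (cartan_transpose T) (positive_roots T) \<and> check_classes T"

definition check_orders :: "exceptional_type \<Rightarrow> bool" where
  "check_orders T \<longleftrightarrow> list_all (check_component (signed_roots T)) (component_masks T) \<and>
     list_all (check_order (gram T) (class_table T) (component_masks T)) (masks (rank T))"

definition check_downs :: "exceptional_type \<Rightarrow> bool" where
  "check_downs T \<longleftrightarrow> list_all (check_down (gram T) (incidences T)) (masks (rank T))"

definition check_ups :: "exceptional_type \<Rightarrow> bool" where
  "check_ups T \<longleftrightarrow>
     list_all (check_up (extension_test T) (gram T) (signed_roots T) (incidences T)) (masks (rank T))"

section \<open>Orders of the exceptional arrangement monoids\<close>

lemma (in based_root_system) norm_eq_if_simple_norm_eq: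
  assumes "\<And>a. a \<in> \<Delta> \<Longrightarrow> a \<bullet> a = N" and "v \<in> \<Phi>"
  shows "v \<bullet> v = N"
proof -
  have "u \<bullet> u = N" if "pos u" for u
    using that by (induction u rule: pos_root_induct) (auto simp: assms(1) simple_nonzero)
  from this[of v] this[of "- v"] show ?thesis using pos_cases[OF assms(2)] by auto
qed

text \<open>
  The Cartan integers determine the Gram matrix up to a common factor because the Dynkin diagram is
  connected.
\<close>
lemma has_type_root_coordinates:
  fixes \<Phi> :: "'a::euclidean_space set"
  assumes rs: "root_system \<Phi>" and type: "has_type \<Phi> T" and chk: "check_gram T"
  obtains \<alpha> s where "root_coordinates \<Phi> \<alpha> (gram T) (cartan_transpose T) s" "length \<alpha> = rank T"
proof -
  let ?n = "rank T" and ?C = "cartan_matrix T" and ?G = "gram T"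
  obtain \<alpha> :: "'a list" where \<alpha>: "length \<alpha> = ?n" "distinct \<alpha>" "simple_system \<Phi> (set \<alpha>)"
    and cart: "\<And>i j. i < ?n \<Longrightarrow> j < ?n \<Longrightarrow> 2 * (\<alpha> ! i \<bullet> \<alpha> ! j) / (\<alpha> ! j \<bullet> \<alpha> ! j) = of_int (?C ! i ! j)"
    using type unfolding has_type_def by metis
  have n0: "0 < ?n" and lG: "length ?G = ?n" and rows: "\<And>r. r \<in> set ?G \<Longrightarrow> length r = ?n"
    and diag: "\<And>i. i < ?n \<Longrightarrow> 0 < ?G ! i ! i"
    and reach: "\<And>i. i < ?n \<Longrightarrow> i \<in> set (reached ?G [0] (diagram_edges T))"
    and rel: "\<And>i j. i < ?n \<Longrightarrow> j < ?n \<Longrightarrow> 2 * ?G ! i ! j = ?C ! i ! j * ?G ! j ! j"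
    and sym: "\<And>i j. i < ?n \<Longrightarrow> j < ?n \<Longrightarrow> ?G ! i ! j = ?G ! j ! i"
    using chk unfolding check_gram_def Let_def list_all_iff by auto
  have pos: "\<alpha> ! i \<bullet> \<alpha> ! i > 0" if "i < ?n" for i
  proof -
    have "\<alpha> ! i \<in> \<Phi>" using that \<alpha>(1,3) unfolding simple_system_def by (metis nth_mem subsetD)
    then show ?thesis using root_system_nonzero[OF rs] by simp
  qed
  have cart': "2 * (\<alpha> ! i \<bullet> \<alpha> ! j) = of_int (?C ! i ! j) * (\<alpha> ! j \<bullet> \<alpha> ! j)" if "i < ?n" "j < ?n" for i j
    using cart[OF that] pos[OF that(2)] by (simp add: divide_eq_eq)
  define s where "s = (\<alpha> ! 0 \<bullet> \<alpha> ! 0) / of_int (?G ! 0 ! 0)"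
  have s: "s > 0" unfolding s_def using pos[OF n0] diag[OF n0] by simp
  define good where "good k \<longleftrightarrow> k < ?n \<and> \<alpha> ! k \<bullet> \<alpha> ! k = s * of_int (?G ! k ! k)" for k
  have step: "good j" if i: "good i" and j: "j < ?n" and ij: "?G ! i ! j \<noteq> 0" for i j
  proof -
    have il: "i < ?n" and ni: "\<alpha> ! i \<bullet> \<alpha> ! i = s * of_int (?G ! i ! i)" using i by (auto simp: good_def)
    have "of_int (?C ! i ! j) * (\<alpha> ! j \<bullet> \<alpha> ! j) = of_int (?C ! j ! i) * (s * of_int (?G ! i ! i))"
      using cart'[OF il j] cart'[OF j il] ni by (simp add: inner_commute)
    also have "\<dots> = s * of_int (?C ! j ! i * ?G ! i ! i)" by simp
    also have "\<dots> = s * of_int (?C ! i ! j * ?G ! j ! j)"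
      using rel[OF il j] rel[OF j il] sym[OF il j] by simp
    finally have "of_int (?C ! i ! j) * (\<alpha> ! j \<bullet> \<alpha> ! j) = of_int (?C ! i ! j) * (s * of_int (?G ! j ! j))" by simp
    moreover have "?C ! i ! j \<noteq> 0" using rel[OF il j] ij by auto
    ultimately show ?thesis using j by (simp add: good_def)
  qed
  have good_reached: "good k" if "k \<in> set (reached ?G ks ps)" "\<forall>k\<in>set ks. good k" for k ks ps
    using that
  proof (induction ps arbitrary: ks)
    case (Cons p ps)
    obtain i j where p: "p = (i, j)" by (cases p)
    have c: "i \<in> set ks" "j < ?n" "?G ! i ! j \<noteq> 0" and k: "k \<in> set (reached ?G (j # ks) ps)"
      using Cons.prems(1) lG unfolding p by (auto split: if_splits)
    have "good j" using step c Cons.prems(2) by blast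
    then show ?case using Cons.IH[OF k] Cons.prems(2) by simp
  qed simp
  have "good 0" unfolding good_def s_def using n0 diag[OF n0] by simp
  then have norm: "\<alpha> ! k \<bullet> \<alpha> ! k = s * of_int (?G ! k ! k)" if "k < ?n" for k
    using good_reached[OF reach[OF that]] by (simp add: good_def)
  have gram: "\<alpha> ! i \<bullet> \<alpha> ! j = s * of_int (?G ! i ! j)" if "i < ?n" "j < ?n" for i j
  proof -
    have "2 * (\<alpha> ! i \<bullet> \<alpha> ! j) = s * of_int (?C ! i ! j * ?G ! j ! j)"
      using cart'[OF that] norm[OF that(2)] by simp
    also have "\<dots> = 2 * (s * of_int (?G ! i ! j))" unfolding rel[OF that, symmetric] by simp
    finally show ?thesis by simp
  qed
  have "root_coordinates \<Phi> \<alpha> ?G (cartan_transpose T) s"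
  proof
    show "2 * ?G ! j ! i = cartan_transpose T ! i ! j * ?G ! i ! i" if "i < length \<alpha>" "j < length \<alpha>" for i j
      using rel[of j i] that \<alpha>(1) by (simp add: cartan_transpose_def)
    show "\<And>r. r \<in> set (cartan_transpose T) \<Longrightarrow> length r = length \<alpha>"
      using \<alpha>(1) by (auto simp: cartan_transpose_def)
    show "length (cartan_transpose T) = length \<alpha>" using \<alpha>(1) by (simp add: cartan_transpose_def)
    show "\<And>i j. i < length \<alpha> \<Longrightarrow> j < length \<alpha> \<Longrightarrow> \<alpha> ! i \<bullet> \<alpha> ! j = s * of_int (?G ! i ! j)"
      using gram \<alpha>(1) by simp
    show "length ?G = length \<alpha>" "\<And>r. r \<in> set ?G \<Longrightarrow> length r = length \<alpha>" using lG rows \<alpha>(1) by simp_all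
  qed (fact rs \<alpha> s)+
  then show thesis using that \<alpha>(1) by blast
qed

theorem order_by_type:
  fixes \<Phi> :: "'a::euclidean_space set"
  assumes rs: "root_system \<Phi>" and type: "has_type \<Phi> T"
    and small: "check_setup T" and orders: "check_orders T" and downs: "check_downs T" and ups: "check_ups T"
  shows "int (Coset.order (arrangement_monoid \<Phi>)) = monoid_order T"
proof -
  have gr: "check_gram T" and roots: "check_roots (cartan_transpose T) (positive_roots T)" and cls: "check_classes T"
    using small unfolding check_setup_def by blast+
  obtain \<alpha> s where rc: "root_coordinates \<Phi> \<alpha> (gram T) (cartan_transpose T) s" and n: "length \<alpha> = rank T"
    using has_type_root_coordinates[OF rs type gr] by blast
  interpret root_coordinates \<Phi> \<alpha> "gram T" "cartan_transpose T" s by (rule rc)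
  have test: "correct_test (extension_test T)"
  proof (cases "simply_laced T")
    case True
    have "a \<bullet> a = 2 * s" if a: "a \<in> set \<alpha>" for a
    proof -
      obtain i where i: "i < length \<alpha>" "a = \<alpha> ! i" using a by (auto simp: in_set_conv_nth)
      then have "gram T ! i ! i = 2" using True n by (simp add: simply_laced_def list_all_iff)
      then show ?thesis using gram[OF i(1) i(1)] i(2) by simp
    qed
    then have "correct_test simply_laced_test"
      using norm_eq_if_simple_norm_eq by (intro correct_simply_laced_test) blast
    then show ?thesis using True by (simp add: extension_test_def)
  next
    case False
    then show ?thesis using correct_coherence_test[OF roots] by (simp add: extension_test_def)
  qed
  show ?thesis
    unfolding monoid_order_def
    using order_by_certificate[OF roots test, of "component_masks T" "class_table T" "incidences T"]
      orders downs ups cls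
    unfolding check_orders_def check_downs_def check_ups_def check_classes_def signed_roots_def n Let_def
    by blast
qed

lemma certificate_G2: "check_setup G2" "check_orders G2" "check_downs G2" "check_ups G2"
  by code_simp+

lemma certificate_F4: "check_setup F4" "check_orders F4" "check_downs F4" "check_ups F4"
  by code_simp+

lemma certificate_E6: "check_setup E6" "check_orders E6" "check_downs E6" "check_ups E6"
  by code_simp+

lemma certificate_E7: "check_setup E7" "check_orders E7" "check_downs E7" "check_ups E7"
  by code_simp+

lemma extensions_E8: "check_ups E8"
  by code_simp

lemma subsystems_E8: "check_orders E8" "check_downs E8"
  by code_simp+

lemma setup_E8: "check_setup E8"
  by code_simp

lemmas certificate_E8 = setup_E8 subsystems_E8 extensions_E8

lemma order_G2: "monoid_order G2 = 49"
  by code_simp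

lemma order_F4: "monoid_order F4 = 54241"
  by code_simp

lemma order_E6: "monoid_order E6 = 16217200"
  by code_simp

lemma order_E7: "monoid_order E7 = 8362300467"
  by code_simp

lemma order_E8: "monoid_order E8 = 47881782744961"
  by code_simp

theorem proposition16:
  fixes \<Phi> :: "'a::euclidean_space set"
  assumes "root_system \<Phi>"
  shows "(has_type \<Phi> G2 \<longrightarrow> Coset.order (arrangement_monoid \<Phi>) = 7 ^ 2) \<and>
         (has_type \<Phi> F4 \<longrightarrow> Coset.order (arrangement_monoid \<Phi>) = 11 * 4931) \<and>
         (has_type \<Phi> E6 \<longrightarrow> Coset.order (arrangement_monoid \<Phi>) = 2 ^ 4 * 5 ^ 2 * 40543) \<and>
         (has_type \<Phi> E7 \<longrightarrow> Coset.order (arrangement_monoid \<Phi>) = 3 * 113 * 24667553) \<and>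
         (has_type \<Phi> E8 \<longrightarrow> Coset.order (arrangement_monoid \<Phi>) = 11 * 79 * 55099865069)"
proof -
  note int_order = order_by_type[OF assms]
  have "int (Coset.order (arrangement_monoid \<Phi>)) = 49" if "has_type \<Phi> G2"
    using int_order[OF that certificate_G2] order_G2 by simp
  moreover have "int (Coset.order (arrangement_monoid \<Phi>)) = 54241" if "has_type \<Phi> F4"
    using int_order[OF that certificate_F4] order_F4 by simp
  moreover have "int (Coset.order (arrangement_monoid \<Phi>)) = 16217200" if "has_type \<Phi> E6"
    using int_order[OF that certificate_E6] order_E6 by simp
  moreover have "int (Coset.order (arrangement_monoid \<Phi>)) = 8362300467" if "has_type \<Phi> E7"
    using int_order[OF that certificate_E7] order_E7 by simp
  moreover have "int (Coset.order (arrangement_monoid \<Phi>)) = 47881782744961" if "has_type \<Phi> E8"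
    using int_order[OF that certificate_E8] order_E8 by simp
  ultimately show ?thesis by auto
qed

end
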